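(* Let $M$ be an $m$-dimensional $C^\infty$ manifold, let $n\geq 3$, and let $P\in\Gamma\wedge^{n}TM$ be an $n$-vector field on $M$. Then $P$ defines an $n$-ary Poisson bracket on $M$ if and only if one of the following holds: (i) $n$ is even and the Schouten-Nijenhuis bracket satisfies $[P,P]=0$; or (ii) $n$ is odd and $P$ satisfies both of the conditions $$(i(\alpha)P)\wedge(i(\beta)P)=0\qquad\text{for all } x\in M \text{ and all }\alpha,\beta\in T_x^{*}M,$$ $$\sum_{u=1}^{m}(i(dx^{u})P)\wedge(L_{\partial/\partial x^{u}}P)=0,$$ where $(x^{u})_{u=1,\dots,m}$ are local coordinates on $M$ (the second condition being required in the domain of every local coordinate chart).
   Context: Everything is in the $C^\infty$ category. An $n$-vector field is a smooth completely skew-symmetric contravariant $n$-tensor field, i.e. a section of $\wedge^n TM$. Given $P\in\Gamma\wedge^nTM$, put $\{f_1,\dots,f_n\}=P(df_1,\dots,df_n)$ for $f_1,\dots,f_n\in C^\infty(M)$. One says that $P$ defines an $n$-ary Poisson bracket (and that $P$ is a Poisson $n$-vector) if the generalized Jacobi identity of order $n$ holds: $$\sum_{\sigma\in S_{2n-1}}(\mathrm{sign}\,\sigma)\,\{\{f_{\sigma_{1}},\dots,f_{\sigma_{n}}\},f_{\sigma_{n+1}},\dots,f_{\sigma_{2n-1}}\}=0$$ for all $f_1,\dots,f_{2n-1}\in C^\infty(M)$, where $S_{2n-1}$ is the symmetric group. $i(\alpha)P$ denotes the contraction (interior product) of $P$ with the covector $\alpha$, and $L$ denotes the Lie derivative.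 *)

theory Defs
  imports "HOL-Analysis.Analysis"
begin

section \<open>Smooth functions on open subsets of Euclidean spaces\<close>

text \<open>These predicates are only meant for open sets \<open>S\<close>.\<close>

fun times_differentiable_on ::
    "nat \<Rightarrow> 'e set \<Rightarrow> ('e::euclidean_space \<Rightarrow> 'b::real_normed_vector) \<Rightarrow> bool" where
  "times_differentiable_on 0 S f \<longleftrightarrow> continuous_on S f"
| "times_differentiable_on (Suc k) S f \<longleftrightarrow>
     (\<forall>x\<in>S. f differentiable (at x)) \<and>
     (\<forall>v. times_differentiable_on k S (\<lambda>x. frechet_derivative f (at x) v))"

definition smooth_on ::
    "'e set \<Rightarrow> ('e::euclidean_space \<Rightarrow> 'b::real_normed_vector) \<Rightarrow> bool" where
  "smooth_on S f \<longleftrightarrow> (\<forall>k. times_differentiable_on k S f)"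


section \<open>Smooth manifolds\<close>

text \<open>A chart is a pair of its domain and its coordinate map; the values of the coordinate map
  outside of the domain are irrelevant.\<close>

type_synonym ('a, 'm) chart = "'a set \<times> ('a \<Rightarrow> real ^ 'm)"

definition chart_inv :: "('a, 'm) chart \<Rightarrow> real ^ 'm \<Rightarrow> 'a" where
  "chart_inv c = inv_into (fst c) (snd c)"

definition is_chart :: "('a::topological_space, 'm::finite) chart \<Rightarrow> bool" where
  "is_chart c \<longleftrightarrow> open (fst c) \<and> open (snd c ` fst c) \<and>
     homeomorphism (fst c) (snd c ` fst c) (snd c) (chart_inv c)"

definition smooth_transition :: "('a, 'm::finite) chart \<Rightarrow> ('a, 'm) chart \<Rightarrow> bool" where
  "smooth_transition c d \<longleftrightarrow> smooth_on (snd c ` (fst c \<inter> fst d)) (snd d \<circ> chart_inv c)"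

text \<open>A smooth structure is a maximal smooth atlas, so that its elements are all the local
  coordinate systems of the manifold. The manifold is the whole type \<open>'a\<close>; that it is
  Hausdorff and second countable is expressed by the sort of \<open>'a\<close>.
  Its dimension is \<open>CARD('m)\<close>.\<close>

definition smooth_structure ::
    "('a::{t2_space, second_countable_topology}, 'm::finite) chart set \<Rightarrow> bool" where
  "smooth_structure A \<longleftrightarrow>
     (\<forall>c\<in>A. is_chart c) \<and>
     (\<Union>c\<in>A. fst c) = UNIV \<and>
     (\<forall>c\<in>A. \<forall>d\<in>A. smooth_transition c d) \<and>
     (\<forall>c. is_chart c \<and> (\<forall>d\<in>A. smooth_transition c d \<and> smooth_transition d c) \<longrightarrow> c \<in> A)"

definition smooth_fun_on :: "('a, 'm::finite) chart set \<Rightarrow> 'a set \<Rightarrow> ('a \<Rightarrow> real) \<Rightarrow> bool" where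
  "smooth_fun_on A W f \<longleftrightarrow> (\<forall>c\<in>A. smooth_on (snd c ` (fst c \<inter> W)) (f \<circ> chart_inv c))"

definition smooth_fun_near ::
    "('a::topological_space, 'm::finite) chart set \<Rightarrow> 'a \<Rightarrow> ('a \<Rightarrow> real) \<Rightarrow> bool" where
  "smooth_fun_near A p f \<longleftrightarrow> (\<exists>W. open W \<and> p \<in> W \<and> smooth_fun_on A W f)"

definition smooth_curve_near_0 ::
    "('a::topological_space, 'm::finite) chart set \<Rightarrow> (real \<Rightarrow> 'a) \<Rightarrow> bool" where
  "smooth_curve_near_0 A \<gamma> \<longleftrightarrow>
     (\<exists>e>0. continuous_on {-e<..<e} \<gamma> \<and>
       (\<forall>c\<in>A. smooth_on {t \<in> {-e<..<e}. \<gamma> t \<in> fst c} (snd c \<circ> \<gamma>)))"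


section \<open>Tangent and cotangent spaces\<close>

text \<open>Tangent vectors at \<open>p\<close> are the velocities of smooth curves through \<open>p\<close>, seen as operators
  on the functions that are smooth near \<open>p\<close>. They and all further objects are total functions
  that take the value \<open>0\<close> outside of their proper domain. So equality in HOL is the intended
  equality, and the pointwise operations are those of the vector spaces.\<close>

type_synonym 'a tangent = "('a \<Rightarrow> real) \<Rightarrow> real"
type_synonym 'a cotangent = "'a tangent \<Rightarrow> real"

definition velocity ::
    "('a::topological_space, 'm::finite) chart set \<Rightarrow> (real \<Rightarrow> 'a) \<Rightarrow> 'a tangent" where
  "velocity A \<gamma> = (\<lambda>f. if smooth_fun_near A (\<gamma> 0) f then deriv (f \<circ> \<gamma>) 0 else 0)"

definition tangent_space ::
    "('a::topological_space, 'm::finite) chart set \<Rightarrow> 'a \<Rightarrow> 'a tangent set" where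
  "tangent_space A p = {velocity A \<gamma> |\<gamma>. smooth_curve_near_0 A \<gamma> \<and> \<gamma> 0 = p}"

definition cotangent_space ::
    "('a::topological_space, 'm::finite) chart set \<Rightarrow> 'a \<Rightarrow> 'a cotangent set" where
  "cotangent_space A p = {\<alpha>.
     (\<forall>v. v \<notin> tangent_space A p \<longrightarrow> \<alpha> v = 0) \<and>
     (\<forall>v\<in>tangent_space A p. \<forall>w\<in>tangent_space A p. \<forall>a b.
        \<alpha> (\<lambda>f. a * v f + b * w f) = a * \<alpha> v + b * \<alpha> w)}"

definition differential ::
    "('a::topological_space, 'm::finite) chart set \<Rightarrow> ('a \<Rightarrow> real) \<Rightarrow> 'a \<Rightarrow> 'a cotangent" where
  "differential A f p = (\<lambda>v. if v \<in> tangent_space A p then v f else 0)"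

text \<open>The coordinate functions \<open>x\<^sup>u\<close> of a chart and the coordinate fields
  \<open>\<partial>/\<partial>x\<^sup>u\<close>.\<close>

definition coord_fun :: "('a, 'm::finite) chart \<Rightarrow> 'm \<Rightarrow> 'a \<Rightarrow> real" where
  "coord_fun c u = (\<lambda>q. snd c q $ u)"

definition coord_field ::
    "('a::topological_space, 'm::finite) chart set \<Rightarrow> ('a, 'm) chart \<Rightarrow> 'm \<Rightarrow> 'a \<Rightarrow> 'a tangent" where
  "coord_field A c u p = (\<lambda>f. if smooth_fun_near A p f
     then frechet_derivative (f \<circ> chart_inv c) (at (snd c p)) (axis u 1) else 0)"


section \<open>Multivectors\<close>

text \<open>An element of \<open>\<wedge>\<^sup>n T\<^sub>p M\<close> is a multilinear completely skew-symmetric function of \<open>n\<close>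
  covectors, which are given as the first \<open>n\<close> entries of a sequence.\<close>

type_synonym 'a multivector = "(nat \<Rightarrow> 'a cotangent) \<Rightarrow> real"

definition multivectors ::
    "('a::topological_space, 'm::finite) chart set \<Rightarrow> nat \<Rightarrow> 'a \<Rightarrow> 'a multivector set" where
  "multivectors A n p = {T.
     (\<forall>\<alpha>. (\<exists>i<n. \<alpha> i \<notin> cotangent_space A p) \<longrightarrow> T \<alpha> = 0) \<and>
     (\<forall>\<alpha> \<beta>. (\<forall>i<n. \<alpha> i = \<beta> i) \<longrightarrow> T \<alpha> = T \<beta>) \<and>
     (\<forall>\<alpha>. \<forall>i<n. \<forall>\<beta>\<in>cotangent_space A p. \<forall>\<gamma>\<in>cotangent_space A p. \<forall>a b.
        T (\<alpha>(i := (\<lambda>v. a * \<beta> v + b * \<gamma> v))) = a * T (\<alpha>(i := \<beta>)) + b * T (\<alpha>(i := \<gamma>))) \<and>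
     (\<forall>\<alpha> \<sigma>. \<sigma> permutes {..<n} \<longrightarrow> T (\<alpha> \<circ> \<sigma>) = of_int (sign \<sigma>) * T \<alpha>)}"

definition contract :: "'a cotangent \<Rightarrow> 'a multivector \<Rightarrow> 'a multivector" where
  "contract \<alpha> T = (\<lambda>\<beta>. T (case_nat \<alpha> \<beta>))"

text \<open>The exterior product of a \<open>k\<close>-vector and an \<open>l\<close>-vector.\<close>

definition wedge :: "nat \<Rightarrow> nat \<Rightarrow> 'a multivector \<Rightarrow> 'a multivector \<Rightarrow> 'a multivector" where
  "wedge k l S T = (\<lambda>\<alpha>. (\<Sum>\<sigma> | \<sigma> permutes {..<k + l}.
     of_int (sign \<sigma>) * S (\<lambda>i. \<alpha> (\<sigma> i)) * T (\<lambda>i. \<alpha> (\<sigma> (k + i)))) / (fact k * fact l))"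

text \<open>The exterior product \<open>X\<^sub>0 \<wedge> \<dots> \<wedge> X\<^sub>k\<^sub>-\<^sub>1\<close> of tangent vectors at \<open>p\<close>.\<close>

definition wedge_vectors ::
    "('a::topological_space, 'm::finite) chart set \<Rightarrow> nat \<Rightarrow> 'a \<Rightarrow> (nat \<Rightarrow> 'a tangent) \<Rightarrow> 'a multivector"
where
  "wedge_vectors A k p X = (\<lambda>\<alpha>. if \<forall>i<k. \<alpha> i \<in> cotangent_space A p
     then \<Sum>\<sigma> | \<sigma> permutes {..<k}. of_int (sign \<sigma>) * (\<Prod>i<k. \<alpha> (\<sigma> i) (X i)) else 0)"


section \<open>Vector fields and multivector fields\<close>

definition vector_field_on ::
    "('a::topological_space, 'm::finite) chart set \<Rightarrow> 'a set \<Rightarrow> ('a \<Rightarrow> 'a tangent) \<Rightarrow> bool" where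
  "vector_field_on A W X \<longleftrightarrow>
     (\<forall>p\<in>W. X p \<in> tangent_space A p) \<and>
     (\<forall>V f. open V \<and> V \<subseteq> W \<and> smooth_fun_on A V f \<longrightarrow> smooth_fun_on A V (\<lambda>p. X p f))"

definition multivector_field ::
    "('a::topological_space, 'm::finite) chart set \<Rightarrow> nat \<Rightarrow> ('a \<Rightarrow> 'a multivector) \<Rightarrow> bool" where
  "multivector_field A n P \<longleftrightarrow>
     (\<forall>p. P p \<in> multivectors A n p) \<and>
     (\<forall>V f. open V \<and> (\<forall>i<n. smooth_fun_on A V (f i)) \<longrightarrow>
        smooth_fun_on A V (\<lambda>p. P p (\<lambda>i. differential A (f i) p)))"

definition lie_bracket ::
    "('a::topological_space, 'm::finite) chart set \<Rightarrow>
     ('a \<Rightarrow> 'a tangent) \<Rightarrow> ('a \<Rightarrow> 'a tangent) \<Rightarrow> 'a \<Rightarrow> 'a tangent" where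
  "lie_bracket A X Y p = (\<lambda>f. if smooth_fun_near A p f
     then X p (\<lambda>q. Y q f) - Y p (\<lambda>q. X q f) else 0)"

text \<open>The Lie derivative of an \<open>n\<close>-vector field is determined by the Leibniz rule
  \<open>(L\<^sub>X P)(df\<^sub>0, \<dots>, df\<^sub>n\<^sub>-\<^sub>1)
    = X (P(df\<^sub>0, \<dots>, df\<^sub>n\<^sub>-\<^sub>1)) - (\<Sum>i<n. P(df\<^sub>0, \<dots>, d(X f\<^sub>i), \<dots>, df\<^sub>n\<^sub>-\<^sub>1))\<close>.\<close>

definition lie_derivative ::
    "('a::topological_space, 'm::finite) chart set \<Rightarrow> nat \<Rightarrow>
     ('a \<Rightarrow> 'a tangent) \<Rightarrow> ('a \<Rightarrow> 'a multivector) \<Rightarrow> 'a \<Rightarrow> 'a multivector" where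
  "lie_derivative A n X P p = (THE T. T \<in> multivectors A n p \<and>
     (\<forall>f. (\<forall>i<n. smooth_fun_near A p (f i)) \<longrightarrow>
        T (\<lambda>i. differential A (f i) p) =
          X p (\<lambda>q. P q (\<lambda>i. differential A (f i) q))
          - (\<Sum>i<n. P p ((\<lambda>j. differential A (f j) p)
                (i := differential A (\<lambda>q. X q (f i)) p)))))"


section \<open>The Schouten-Nijenhuis bracket\<close>

text \<open>\<open>P\<close> is on the open set \<open>W\<close> the sum of the decomposable fields
  \<open>X a 0 \<wedge> \<dots> \<wedge> X a (k - 1)\<close>, where \<open>a < N\<close>. Every \<open>k\<close>-vector field with \<open>k \<ge> 1\<close> has such a
  decomposition near each point.\<close>

definition decomposition_on ::
    "('a::topological_space, 'm::finite) chart set \<Rightarrow> nat \<Rightarrow> ('a \<Rightarrow> 'a multivector) \<Rightarrow> 'a set \<Rightarrow>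
     nat \<Rightarrow> (nat \<Rightarrow> nat \<Rightarrow> 'a \<Rightarrow> 'a tangent) \<Rightarrow> bool" where
  "decomposition_on A k P W N X \<longleftrightarrow>
     (\<forall>a<N. \<forall>i<k. vector_field_on A W (X a i)) \<and>
     (\<forall>q\<in>W. P q = (\<lambda>\<alpha>. \<Sum>a<N. wedge_vectors A k q (\<lambda>i. X a i q) \<alpha>))"

text \<open>Enumerates the natural numbers other than \<open>i\<close>.\<close>

definition skip :: "nat \<Rightarrow> nat \<Rightarrow> nat" where
  "skip i s = (if s < i then s else Suc s)"

text \<open>The value at \<open>p\<close> of
  \<open>[X\<^sub>0 \<wedge> \<dots> \<wedge> X\<^sub>k\<^sub>-\<^sub>1, Y\<^sub>0 \<wedge> \<dots> \<wedge> Y\<^sub>l\<^sub>-\<^sub>1]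
    = (\<Sum>i<k. \<Sum>j<l. (-1)\<^sup>i\<^sup>+\<^sup>j [X\<^sub>i, Y\<^sub>j] \<wedge> X\<^sub>0 \<wedge> \<dots> \<wedge> X\<^sub>k\<^sub>-\<^sub>1 \<wedge> Y\<^sub>0 \<wedge> \<dots> \<wedge> Y\<^sub>l\<^sub>-\<^sub>1)\<close>,
  where \<open>X\<^sub>i\<close> and \<open>Y\<^sub>j\<close> are omitted from the product in the \<open>(i, j)\<close>-th summand.\<close>

definition schouten_decomposable ::
    "('a::topological_space, 'm::finite) chart set \<Rightarrow> nat \<Rightarrow> nat \<Rightarrow>
     (nat \<Rightarrow> 'a \<Rightarrow> 'a tangent) \<Rightarrow> (nat \<Rightarrow> 'a \<Rightarrow> 'a tangent) \<Rightarrow> 'a \<Rightarrow> 'a multivector" where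
  "schouten_decomposable A k l X Y p = (\<lambda>\<alpha>. \<Sum>i<k. \<Sum>j<l. (-1) ^ (i + j) *
     wedge_vectors A (k + l - 1) p
       (\<lambda>s. if s = 0 then lie_bracket A (X i) (Y j) p
            else if s < k then X (skip i (s - 1)) p
            else Y (skip j (s - k)) p) \<alpha>)"

text \<open>The bracket of a \<open>k\<close>-vector field and an \<open>l\<close>-vector field, where \<open>k, l \<ge> 1\<close>, is the
  bi-additive local extension of the bracket of decomposable fields (coefficient functions are
  absorbed into the vector fields). The value does not depend on the decompositions.\<close>

definition schouten_bracket ::
    "('a::topological_space, 'm::finite) chart set \<Rightarrow> nat \<Rightarrow> nat \<Rightarrow>
     ('a \<Rightarrow> 'a multivector) \<Rightarrow> ('a \<Rightarrow> 'a multivector) \<Rightarrow> 'a \<Rightarrow> 'a multivector" where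
  "schouten_bracket A k l P Q p = (THE T. \<forall>W N X K Y.
     open W \<and> p \<in> W \<and> decomposition_on A k P W N X \<and> decomposition_on A l Q W K Y \<longrightarrow>
     T = (\<lambda>\<alpha>. \<Sum>a<N. \<Sum>b<K. schouten_decomposable A k l (X a) (Y b) p \<alpha>))"


section \<open>Poisson brackets of order \<open>n\<close>\<close>

definition nary_bracket ::
    "('a::topological_space, 'm::finite) chart set \<Rightarrow> ('a \<Rightarrow> 'a multivector) \<Rightarrow>
     (nat \<Rightarrow> 'a \<Rightarrow> real) \<Rightarrow> 'a \<Rightarrow> real" where
  "nary_bracket A P f = (\<lambda>p. P p (\<lambda>i. differential A (f i) p))"

definition defines_nary_poisson_bracket ::
    "('a::topological_space, 'm::finite) chart set \<Rightarrow> nat \<Rightarrow> ('a \<Rightarrow> 'a multivector) \<Rightarrow> bool" where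
  "defines_nary_poisson_bracket A n P \<longleftrightarrow>
     (\<forall>f. (\<forall>i<2 * n - 1. smooth_fun_on A UNIV (f i)) \<longrightarrow>
       (\<forall>p. (\<Sum>\<sigma> | \<sigma> permutes {..<2 * n - 1}. of_int (sign \<sigma>) *
          nary_bracket A P
            (case_nat (nary_bracket A P (\<lambda>i. f (\<sigma> i))) (\<lambda>i. f (\<sigma> (n + i)))) p) = 0))"

end

theory Submission
  imports Defs
begin

text \<open>
  Write \<open>\<partial>\<^sub>u\<close> for the coordinate fields of a chart, \<open>L\<^sub>u\<close> for the Lie derivative along \<open>\<partial>\<^sub>u\<close> and
  \<open>i\<^sub>u\<close> for the contraction with \<open>dx\<^sup>u\<close>. The outer bracket of the generalized Jacobi sum expands as
  \<open>{g, h\<^sub>1, \<dots>} = (\<Sum>u. \<partial>\<^sub>u g * (i\<^sub>u P)(dh\<^sub>1, \<dots>))\<close>, where \<open>g\<close> is the inner bracket, and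
  \<open>\<partial>\<^sub>u {f\<^sub>1, \<dots>, f\<^sub>n} = (L\<^sub>u P)(df\<^sub>1, \<dots>, df\<^sub>n) + (\<Sum>i. P(df\<^sub>1, \<dots>, d(\<partial>\<^sub>u f\<^sub>i), \<dots>, df\<^sub>n))\<close>.
  So the Jacobi sum is a multiple of \<open>(\<Sum>u. i\<^sub>u P \<and> L\<^sub>u P)(df\<^sub>1, \<dots>)\<close>, the \<open>structure_form\<close>, plus a
  multiple of the \<open>hessian_sum\<close>, which alternates
  \<open>(\<Sum>u v. \<partial>\<^sub>u \<partial>\<^sub>v f\<^sub>k * (i\<^sub>v P \<and> i\<^sub>u P)(df\<^sub>1, \<dots>))\<close> over all arguments (lemma \<open>jacobi_sum_eq\<close>).

  The parity of \<open>n\<close> enters through the symmetry of \<open>i\<^sub>v P \<and> i\<^sub>u P\<close> in \<open>u\<close> and \<open>v\<close>. For even \<open>n\<close> these are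
  products of multivectors of odd degree, hence antisymmetric, and cancel against the symmetric
  second derivatives (\<open>hessian_sum_even\<close>). For odd \<open>n\<close> they are symmetric and survive. Since the
  2-jets of smooth functions at a point are arbitrary, the two parts of the Jacobi sum have to vanish
  separately: functions that are affine in the chart isolate the structure form
  (\<open>structure_form_zero_if_jacobi\<close>), and if one function is a product of two affine functions that
  vanish at the point, then only the product of two contractions of \<open>P\<close> remains
  (\<open>contractions_zero_if_jacobi\<close>). Functions on the manifold with these germs exist because there are
  smooth cutoff functions (\<open>extend_smooth_fun\<close>).

  For even \<open>n\<close> it remains to see that \<open>[P, P]\<close> is \<open>-2\<close> times the structure form
  (\<open>schouten_bracket_eq\<close>). On decomposable fields,
  \<open>[X\<^sub>i, Y\<^sub>j] = (\<Sum>u. X\<^sub>i\<^sup>u * \<partial>\<^sub>u Y\<^sub>j - Y\<^sub>j\<^sup>u * \<partial>\<^sub>u X\<^sub>i)\<close>, where \<open>\<partial>\<^sub>u\<close> acts on the components. The sum over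
  the factor that is only evaluated on \<open>x\<^sup>u\<close> is a Laplace expansion of a contraction
  (\<open>contract_wedge_vectors\<close>), the sum over the differentiated factor is a Lie derivative
  (\<open>L_decomposition\<close>). The resulting expression depends on \<open>P\<close> alone and so on no decomposition.
\<close>

section \<open>Calculus of smooth functions\<close>

lemma times_differentiable_on_cong:
  assumes "open S" "\<And>x. x \<in> S \<Longrightarrow> f x = g x" "times_differentiable_on k S f"
  shows "times_differentiable_on k S g"
  using assms(2,3)
proof (induction k arbitrary: f g)
  case 0
  then show ?case by (simp cong: continuous_on_cong)
next
  case (Suc k)
  have d: "f differentiable at x" if "x \<in> S" for x
    using Suc.prems(2) that by simp
  have d': "(g has_derivative frechet_derivative f (at x)) (at x)" if "x \<in> S" for x
    by (rule has_derivative_transform_within_open[OF _ \<open>open S\<close> that Suc.prems(1)])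
      (use d[OF that] frechet_derivative_works in auto)
  have "frechet_derivative f (at x) v = frechet_derivative g (at x) v" if "x \<in> S" for x v
    using frechet_derivative_at[OF d'[OF that]] by simp
  then have "times_differentiable_on k S (\<lambda>x. frechet_derivative g (at x) v)" for v
    using Suc.IH[of "\<lambda>x. frechet_derivative f (at x) v" "\<lambda>x. frechet_derivative g (at x) v"]
      Suc.prems(2) by simp
  then show ?case
    using d' by (auto simp: differentiable_def)
qed

lemma times_differentiable_on_subset:
  assumes "times_differentiable_on k S f" "T \<subseteq> S"
  shows "times_differentiable_on k T f"
  using assms by (induction k arbitrary: f) (auto intro: continuous_on_subset)

lemma times_differentiable_on_Suc_imp:
  "times_differentiable_on (Suc k) S f \<Longrightarrow> times_differentiable_on k S f"
proof (induction k arbitrary: f)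
  case 0
  then show ?case
    by (auto intro!: continuous_at_imp_continuous_on differentiable_imp_continuous_within)
qed auto

lemma times_differentiable_on_union:
  assumes "open S" "open T" "times_differentiable_on k S f" "times_differentiable_on k T f"
  shows "times_differentiable_on k (S \<union> T) f"
  using assms(3,4)
  by (induction k arbitrary: f) (auto intro: continuous_on_open_Un assms)

lemma times_differentiable_on_const: "times_differentiable_on k S (\<lambda>_. c)"
  by (induction k arbitrary: c) (auto simp: frechet_derivative_const)

lemma times_differentiable_on_SucI:
  assumes "open S"
    and d: "\<And>x. x \<in> S \<Longrightarrow> (f has_derivative f' x) (at x)"
    and k: "\<And>v. times_differentiable_on k S (\<lambda>x. f' x v)"
  shows "times_differentiable_on (Suc k) S f"
proof -
  have "times_differentiable_on k S (\<lambda>x. frechet_derivative f (at x) v)" for v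
    by (rule times_differentiable_on_cong[OF \<open>open S\<close> _ k[of v]])
      (use frechet_derivative_at[OF d] in simp)
  then show ?thesis using d by (auto simp: differentiable_def)
qed

lemma times_differentiable_on_SucD:
  assumes "times_differentiable_on (Suc k) S f" "x \<in> S"
  shows "(f has_derivative frechet_derivative f (at x)) (at x)"
  using assms by (simp add: frechet_derivative_works)

lemma times_differentiable_on_bounded_linear_compose:
  assumes "open S" "bounded_linear h" "times_differentiable_on k S f"
  shows "times_differentiable_on k S (\<lambda>x. h (f x))"
  using assms(3)
proof (induction k arbitrary: f)
  case 0
  then show ?case
    using bounded_linear.continuous_on[OF assms(2)] by simp
next
  case (Suc k)
  show ?case
    by (rule times_differentiable_on_SucI[OF \<open>open S\<close>, where f' = "\<lambda>x v. h (frechet_derivative f (at x) v)"])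
      (use Suc times_differentiable_on_SucD[OF Suc.prems] in
        \<open>auto intro: bounded_linear.has_derivative[OF assms(2)]\<close>)
qed

lemma times_differentiable_on_bounded_linear:
  assumes "open S" "bounded_linear h"
  shows "times_differentiable_on k S h"
proof (cases k)
  case 0
  then show ?thesis using assms(2) linear_continuous_on by auto
next
  case (Suc j)
  show ?thesis unfolding Suc
    by (rule times_differentiable_on_SucI[OF \<open>open S\<close>])
      (use assms(2) in \<open>auto intro: bounded_linear_imp_has_derivative times_differentiable_on_const\<close>)
qed

lemma times_differentiable_on_add:
  assumes "open S" "times_differentiable_on k S f" "times_differentiable_on k S g"
  shows "times_differentiable_on k S (\<lambda>x. f x + g x)"
  using assms(2,3)
proof (induction k arbitrary: f g)
  case 0
  then show ?case by (auto intro: continuous_on_add)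
next
  case (Suc k)
  show ?case
    by (rule times_differentiable_on_SucI[OF \<open>open S\<close>,
          where f' = "\<lambda>x v. frechet_derivative f (at x) v + frechet_derivative g (at x) v"])
      (use Suc.prems times_differentiable_on_SucD[OF Suc.prems(1)]
        times_differentiable_on_SucD[OF Suc.prems(2)] in
        \<open>auto intro!: has_derivative_add Suc.IH\<close>)
qed

lemma times_differentiable_on_sum:
  assumes "open S" "\<And>i. i \<in> I \<Longrightarrow> times_differentiable_on k S (f i)"
  shows "times_differentiable_on k S (\<lambda>x. \<Sum>i\<in>I. f i x)"
  using assms(2)
  by (induction I rule: infinite_finite_induct)
    (auto intro: times_differentiable_on_add assms times_differentiable_on_const)

lemma times_differentiable_on_bilinear:
  assumes "open S" "bounded_bilinear h"
    and "times_differentiable_on k S f" "times_differentiable_on k S g"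
  shows "times_differentiable_on k S (\<lambda>x. h (f x) (g x))"
  using assms(3,4)
proof (induction k arbitrary: f g)
  case 0
  then show ?case using bounded_bilinear.continuous_on[OF assms(2)] by auto
next
  case (Suc k)
  show ?case
  proof (rule times_differentiable_on_SucI[OF \<open>open S\<close>, where f' =
          "\<lambda>x v. h (f x) (frechet_derivative g (at x) v) + h (frechet_derivative f (at x) v) (g x)"])
    show "((\<lambda>x. h (f x) (g x)) has_derivative (\<lambda>v. h (f x) (frechet_derivative g (at x) v) +
        h (frechet_derivative f (at x) v) (g x))) (at x)" if "x \<in> S" for x
      by (rule bounded_bilinear.FDERIV[OF assms(2)])
        (use that Suc.prems times_differentiable_on_SucD in auto)
    show "times_differentiable_on k S (\<lambda>x. h (f x) (frechet_derivative g (at x) v) +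
        h (frechet_derivative f (at x) v) (g x))" for v
      by (intro times_differentiable_on_add \<open>open S\<close> Suc.IH)
        (use Suc.prems times_differentiable_on_Suc_imp in auto)
  qed
qed

text \<open>The chain rule is written in the basis expansion of the inner derivative, so that the derivative of
  the composition is a sum of products of functions to which the product rule and the induction
  hypothesis apply.\<close>

lemma times_differentiable_on_compose:
  fixes g :: "'e::euclidean_space \<Rightarrow> 'f::euclidean_space"
  assumes "open S" "open T" "g ` S \<subseteq> T"
    and "times_differentiable_on k T f" "times_differentiable_on k S g"
  shows "times_differentiable_on k S (\<lambda>x. f (g x))"
  using assms(4,5)
proof (induction k arbitrary: f)
  case 0
  then show ?case using assms(3) by (auto intro: continuous_on_compose2)
next
  case (Suc k)
  have g: "(g has_derivative frechet_derivative g (at x)) (at x)" if "x \<in> S" for x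
    using Suc.prems(2) that times_differentiable_on_SucD by blast
  have f: "(f has_derivative frechet_derivative f (at y)) (at y)" if "y \<in> T" for y
    using Suc.prems(1) that times_differentiable_on_SucD by blast
  have expand: "frechet_derivative f (at y) w =
      (\<Sum>b\<in>Basis. (w \<bullet> b) *\<^sub>R frechet_derivative f (at y) b)" if "y \<in> T" for y w
  proof -
    interpret linear "frechet_derivative f (at y)"
      using f[OF that] has_derivative_linear by blast
    show ?thesis by (metis (no_types, lifting) euclidean_representation scale sum sum.cong)
  qed
  show ?case
  proof (rule times_differentiable_on_SucI[OF \<open>open S\<close>, where f' = "\<lambda>x v. \<Sum>b\<in>Basis.
        (frechet_derivative g (at x) v \<bullet> b) *\<^sub>R frechet_derivative f (at (g x)) b"])
    fix x assume x: "x \<in> S"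
    then have gx: "g x \<in> T" using assms(3) by auto
    have "(\<lambda>v. frechet_derivative f (at (g x)) (frechet_derivative g (at x) v)) = (\<lambda>v. \<Sum>b\<in>Basis.
        (frechet_derivative g (at x) v \<bullet> b) *\<^sub>R frechet_derivative f (at (g x)) b)"
      by (rule ext) (rule expand[OF gx])
    then show "((\<lambda>x. f (g x)) has_derivative (\<lambda>v. \<Sum>b\<in>Basis.
        (frechet_derivative g (at x) v \<bullet> b) *\<^sub>R frechet_derivative f (at (g x)) b)) (at x)"
      using has_derivative_compose[OF g[OF x] f[OF gx]] by metis
  next
    fix v
    show "times_differentiable_on k S (\<lambda>x. \<Sum>b\<in>Basis.
        (frechet_derivative g (at x) v \<bullet> b) *\<^sub>R frechet_derivative f (at (g x)) b)"
    proof (rule times_differentiable_on_sum[OF \<open>open S\<close>],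
        rule times_differentiable_on_bilinear[OF \<open>open S\<close> bounded_bilinear_scaleR])
      fix b :: 'f
      show "times_differentiable_on k S (\<lambda>x. frechet_derivative g (at x) v \<bullet> b)"
        by (rule times_differentiable_on_bounded_linear_compose[OF \<open>open S\<close> bounded_linear_inner_left])
          (use Suc.prems(2) in simp)
      show "times_differentiable_on k S (\<lambda>x. frechet_derivative f (at (g x)) b)"
        by (rule Suc.IH) (use Suc.prems times_differentiable_on_Suc_imp in auto)
    qed
  qed
qed

lemma smooth_on_cong:
  "open S \<Longrightarrow> (\<And>x. x \<in> S \<Longrightarrow> f x = g x) \<Longrightarrow> smooth_on S f \<Longrightarrow> smooth_on S g"
  unfolding smooth_on_def using times_differentiable_on_cong by blast

lemma smooth_on_subset: "smooth_on S f \<Longrightarrow> T \<subseteq> S \<Longrightarrow> smooth_on T f"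
  unfolding smooth_on_def using times_differentiable_on_subset by blast

lemma smooth_on_union:
  "open S \<Longrightarrow> open T \<Longrightarrow> smooth_on S f \<Longrightarrow> smooth_on T f \<Longrightarrow> smooth_on (S \<union> T) f"
  unfolding smooth_on_def using times_differentiable_on_union by blast

lemma smooth_on_const: "smooth_on S (\<lambda>_. c)"
  unfolding smooth_on_def using times_differentiable_on_const by blast

lemma smooth_on_bounded_linear: "open S \<Longrightarrow> bounded_linear h \<Longrightarrow> smooth_on S h"
  unfolding smooth_on_def using times_differentiable_on_bounded_linear by blast

lemma smooth_on_bounded_linear_compose:
  "open S \<Longrightarrow> bounded_linear h \<Longrightarrow> smooth_on S f \<Longrightarrow> smooth_on S (\<lambda>x. h (f x))"
  unfolding smooth_on_def using times_differentiable_on_bounded_linear_compose by blast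

lemma smooth_on_add:
  "open S \<Longrightarrow> smooth_on S f \<Longrightarrow> smooth_on S g \<Longrightarrow> smooth_on S (\<lambda>x. f x + g x)"
  unfolding smooth_on_def using times_differentiable_on_add by blast

lemma smooth_on_bilinear:
  "open S \<Longrightarrow> bounded_bilinear h \<Longrightarrow> smooth_on S f \<Longrightarrow> smooth_on S g \<Longrightarrow> smooth_on S (\<lambda>x. h (f x) (g x))"
  unfolding smooth_on_def using times_differentiable_on_bilinear by blast

lemma smooth_on_mult:
  fixes f g :: "'e::euclidean_space \<Rightarrow> real"
  shows "open S \<Longrightarrow> smooth_on S f \<Longrightarrow> smooth_on S g \<Longrightarrow> smooth_on S (\<lambda>x. f x * g x)"
  using smooth_on_bilinear[OF _ bounded_bilinear_mult] by blast

lemma smooth_on_compose: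
  fixes g :: "'e::euclidean_space \<Rightarrow> 'f::euclidean_space"
  shows "open S \<Longrightarrow> open T \<Longrightarrow> g ` S \<subseteq> T \<Longrightarrow> smooth_on T f \<Longrightarrow> smooth_on S g \<Longrightarrow> smooth_on S (\<lambda>x. f (g x))"
  unfolding smooth_on_def using times_differentiable_on_compose by blast

lemma smooth_on_differentiable: "smooth_on S f \<Longrightarrow> x \<in> S \<Longrightarrow> f differentiable (at x)"
  unfolding smooth_on_def by (metis times_differentiable_on.simps(2))

lemma smooth_on_has_derivative:
  "smooth_on S f \<Longrightarrow> x \<in> S \<Longrightarrow> (f has_derivative frechet_derivative f (at x)) (at x)"
  using smooth_on_differentiable frechet_derivative_works by blast

lemma smooth_on_frechet_derivative:
  "smooth_on S f \<Longrightarrow> smooth_on S (\<lambda>x. frechet_derivative f (at x) v)"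
  unfolding smooth_on_def by (metis times_differentiable_on.simps(2))

lemma smooth_on_continuous: "smooth_on S f \<Longrightarrow> continuous_on S f"
  unfolding smooth_on_def by (metis times_differentiable_on.simps(1))

lemma line_has_real_derivative:
  fixes f :: "'e::real_normed_vector \<Rightarrow> real"
  assumes "(f has_derivative f') (at (a + t *\<^sub>R v))"
  shows "((\<lambda>t. f (a + t *\<^sub>R v)) has_real_derivative f' v) (at t)"
proof -
  have "((\<lambda>t. a + t *\<^sub>R v) has_derivative (\<lambda>h. h *\<^sub>R v)) (at t)"
    by (auto intro!: derivative_eq_intros)
  from has_derivative_compose[OF this assms]
  have "((\<lambda>t. f (a + t *\<^sub>R v)) has_derivative (\<lambda>h. f' (h *\<^sub>R v))) (at t)" .
  moreover have "f' (h *\<^sub>R v) = f' v * h" for h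
    using linear_scale[OF has_derivative_linear[OF assms]] by simp
  ultimately show ?thesis by (simp add: has_field_derivative_def)
qed

text \<open>One step of the symmetry of second derivatives: the second difference quotient is a mixed second
  derivative at an intermediate point, by two applications of the mean value theorem. The left-hand
  side is symmetric in \<open>v\<close> and \<open>w\<close>, the right-hand side is not visibly so.\<close>

lemma second_difference_mean_value:
  fixes f :: "'e::euclidean_space \<Rightarrow> real"
  assumes S: "\<And>s t. 0 \<le> s \<Longrightarrow> s \<le> h \<Longrightarrow> 0 \<le> t \<Longrightarrow> t \<le> h \<Longrightarrow> x + s *\<^sub>R v + t *\<^sub>R w \<in> S"
    and f: "smooth_on S f" and h: "h > 0"
  shows "\<exists>s t. 0 < s \<and> s < h \<and> 0 < t \<and> t < h \<and>
    f (x + h *\<^sub>R v + h *\<^sub>R w) - f (x + h *\<^sub>R v) - f (x + h *\<^sub>R w) + f x =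
    h * h * frechet_derivative (\<lambda>z. frechet_derivative f (at z) v) (at (x + s *\<^sub>R v + t *\<^sub>R w)) w"
proof -
  define g where "g = (\<lambda>z. frechet_derivative f (at z) v)"
  have g: "smooth_on S g" unfolding g_def by (rule smooth_on_frechet_derivative[OF f])
  have 1: "((\<lambda>s. f (x + s *\<^sub>R v + t *\<^sub>R w)) has_real_derivative g (x + s *\<^sub>R v + t *\<^sub>R w)) (at s)"
    if "0 \<le> s" "s \<le> h" "0 \<le> t" "t \<le> h" for s t
    using line_has_real_derivative[of f _ "x + t *\<^sub>R w" s v] smooth_on_has_derivative[OF f S[OF that]]
    unfolding g_def by (simp add: algebra_simps)
  have "((\<lambda>s. f (x + s *\<^sub>R v + h *\<^sub>R w) - f (x + s *\<^sub>R v)) has_real_derivative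
      g (x + s *\<^sub>R v + h *\<^sub>R w) - g (x + s *\<^sub>R v)) (at s)" if "0 \<le> s" "s \<le> h" for s
    using 1[OF that, of h] 1[OF that, of 0] h by (auto intro: DERIV_diff)
  from MVT2[OF h this] obtain s where s: "0 < s" "s < h"
    "f (x + h *\<^sub>R v + h *\<^sub>R w) - f (x + h *\<^sub>R v) - (f (x + h *\<^sub>R w) - f x) =
     h * (g (x + s *\<^sub>R v + h *\<^sub>R w) - g (x + s *\<^sub>R v))" by auto
  have "((\<lambda>t. g (x + s *\<^sub>R v + t *\<^sub>R w)) has_real_derivative
      frechet_derivative g (at (x + s *\<^sub>R v + t *\<^sub>R w)) w) (at t)" if "0 \<le> t" "t \<le> h" for t
    using line_has_real_derivative[of g _ "x + s *\<^sub>R v" t w] smooth_on_has_derivative[OF g S[of s t]] s that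
    by simp
  from MVT2[OF h this] obtain t where t: "0 < t" "t < h"
    "g (x + s *\<^sub>R v + h *\<^sub>R w) - g (x + s *\<^sub>R v) =
      h * frechet_derivative g (at (x + s *\<^sub>R v + t *\<^sub>R w)) w" by auto
  have "f (x + h *\<^sub>R v + h *\<^sub>R w) - f (x + h *\<^sub>R v) - f (x + h *\<^sub>R w) + f x =
      h * h * frechet_derivative g (at (x + s *\<^sub>R v + t *\<^sub>R w)) w"
    using s(3) t(3) by (simp add: algebra_simps)
  then show ?thesis using s(1,2) t(1,2) unfolding g_def by blast
qed

lemma second_derivative_symmetric:
  fixes f :: "'e::euclidean_space \<Rightarrow> real"
  assumes "open S" "x \<in> S" and f: "smooth_on S f"
  shows "frechet_derivative (\<lambda>z. frechet_derivative f (at z) v) (at x) w =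
    frechet_derivative (\<lambda>z. frechet_derivative f (at z) w) (at x) v"
proof (rule ccontr)
  define a where "a v w z = frechet_derivative (\<lambda>z. frechet_derivative f (at z) v) (at z) w" for v w z
  have cont: "isCont (a v w) x" for v w
    using smooth_on_continuous[OF smooth_on_frechet_derivative[OF smooth_on_frechet_derivative[OF f]]]
      \<open>open S\<close> \<open>x \<in> S\<close> unfolding a_def by (simp add: continuous_on_eq_continuous_at)
  assume "\<not> ?thesis"
  then have ne: "a v w x \<noteq> a w v x" by (simp add: a_def)
  \<comment> \<open>If the two mixed derivatives differ at \<open>x\<close>, then by continuity they have no common value near \<open>x\<close>.\<close>
  define e where "e = \<bar>a v w x - a w v x\<bar> / 2"
  have "e > 0" using ne by (simp add: e_def)
  obtain r where r: "r > 0" "ball x r \<subseteq> S" using assms(1,2) open_contains_ball by blast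
  obtain d1 where d1: "d1 > 0" "\<And>z. dist z x < d1 \<Longrightarrow> dist (a v w z) (a v w x) < e"
    using cont[of v w] \<open>e > 0\<close> unfolding continuous_at_eps_delta by blast
  obtain d2 where d2: "d2 > 0" "\<And>z. dist z x < d2 \<Longrightarrow> dist (a w v z) (a w v x) < e"
    using cont[of w v] \<open>e > 0\<close> unfolding continuous_at_eps_delta by blast
  define d where "d = min r (min d1 d2)"
  \<comment> \<open>This step size keeps the parallelogram spanned by \<open>h v\<close> and \<open>h w\<close> within distance \<open>d\<close> of \<open>x\<close>.\<close>
  define h where "h = d / (norm v + norm w + 1)"
  have d: "d > 0" using r d1 d2 by (simp add: d_def)
  have h: "h > 0" unfolding h_def using d by (intro divide_pos_pos) (auto intro: add_nonneg_pos)
  have hd: "h * (norm v + norm w) < d"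
  proof -
    have "norm v + norm w + 1 > 0" by (auto intro: add_nonneg_pos)
    then have "h * (norm v + norm w + 1) = d" by (simp add: h_def)
    then show ?thesis using h by (simp add: algebra_simps)
  qed
  have near: "dist (x + s *\<^sub>R v + t *\<^sub>R w) x < d" if "0 \<le> s" "s \<le> h" "0 \<le> t" "t \<le> h" for s t
  proof -
    have "dist (x + s *\<^sub>R v + t *\<^sub>R w) x = norm (s *\<^sub>R v + t *\<^sub>R w)" by (simp add: dist_norm)
    also have "\<dots> \<le> norm (s *\<^sub>R v) + norm (t *\<^sub>R w)" by (rule norm_triangle_ineq)
    also have "\<dots> \<le> h * norm v + h * norm w" using that by (auto intro!: add_mono mult_right_mono)
    finally show ?thesis using hd by (simp add: algebra_simps)
  qed
  have inS: "x + s *\<^sub>R v + t *\<^sub>R w \<in> S" if "0 \<le> s" "s \<le> h" "0 \<le> t" "t \<le> h" for s t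
    using near[OF that] r(2) unfolding d_def by (auto simp: dist_commute)
  have inS': "x + t *\<^sub>R w + s *\<^sub>R v \<in> S" if "0 \<le> t" "t \<le> h" "0 \<le> s" "s \<le> h" for s t
    using inS[OF that(3,4,1,2)] by (simp add: algebra_simps)
  obtain s t where st: "0 < s" "s < h" "0 < t" "t < h"
    "f (x + h *\<^sub>R v + h *\<^sub>R w) - f (x + h *\<^sub>R v) - f (x + h *\<^sub>R w) + f x = h * h * a v w (x + s *\<^sub>R v + t *\<^sub>R w)"
    using second_difference_mean_value[OF inS f h] unfolding a_def by blast
  obtain s' t' where st': "0 < s'" "s' < h" "0 < t'" "t' < h"
    "f (x + h *\<^sub>R w + h *\<^sub>R v) - f (x + h *\<^sub>R w) - f (x + h *\<^sub>R v) + f x = h * h * a w v (x + t' *\<^sub>R w + s' *\<^sub>R v)"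
    using second_difference_mean_value[OF inS' f h] unfolding a_def by blast
  have "h * h * a v w (x + s *\<^sub>R v + t *\<^sub>R w) = h * h * a w v (x + t' *\<^sub>R w + s' *\<^sub>R v)"
    using st(5) st'(5) by (simp add: algebra_simps)
  then have eq: "a v w (x + s *\<^sub>R v + t *\<^sub>R w) = a w v (x + s' *\<^sub>R v + t' *\<^sub>R w)" using h by (simp add: algebra_simps)
  have "dist (a v w (x + s *\<^sub>R v + t *\<^sub>R w)) (a v w x) < e"
    using d1(2) near[of s t] st(1-4) unfolding d_def by auto
  moreover have "dist (a w v (x + s' *\<^sub>R v + t' *\<^sub>R w)) (a w v x) < e"
    using d2(2) near[of s' t'] st'(1-4) unfolding d_def by auto
  ultimately have "\<bar>a v w x - a w v x\<bar> < e + e"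
    unfolding eq dist_real_def by linarith
  then show False by (simp add: e_def)
qed

text \<open>The family is closed under differentiation up to linear combinations, so all its members are
  smooth at once; the case \<open>j = 0\<close> is the standard function that is flat at \<open>0\<close>.\<close>

definition flat :: "nat \<Rightarrow> real \<Rightarrow> real" where
  "flat j t = (if t > 0 then exp (- (1 / t)) * (1 / t) ^ j else 0)"

lemma flat_tendsto_0: "(flat j \<longlongrightarrow> 0) (at 0)"
proof -
  have "((\<lambda>t::real. exp (- (1 / t)) * (1 / t) ^ j) \<longlongrightarrow> 0) (at_right 0)"
  proof -
    have "((\<lambda>s::real. s ^ j / exp s) \<longlongrightarrow> 0) at_top" by (rule tendsto_power_div_exp_0)
    from filterlim_compose[OF this filterlim_inverse_at_top_right]
    show ?thesis by (simp add: exp_minus field_simps)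
  qed
  then have "(flat j \<longlongrightarrow> 0) (at_right 0)"
    by (rule Lim_transform_eventually) (auto simp: flat_def eventually_at_right_less intro: eventually_mono[OF eventually_at_right_less])
  moreover have "(flat j \<longlongrightarrow> 0) (at_left 0)"
    by (rule Lim_transform_eventually[OF tendsto_const]) (auto simp: flat_def eventually_at_left_field intro!: exI[of _ "-1"])
  ultimately show ?thesis by (simp add: filterlim_split_at)
qed

lemma flat_has_derivative:
  "(flat j has_real_derivative flat (j + 2) t - real j * flat (j + 1) t) (at t)"
proof (cases t "0::real" rule: linorder_cases)
  case greater
  have "((\<lambda>t. exp (- (1 / t)) * (1 / t) ^ j) has_real_derivative
      flat (j + 2) t - real j * flat (j + 1) t) (at t)"
  proof -
    have inv: "((\<lambda>t. 1 / t) has_real_derivative - ((1 / t) * (1 / t))) (at t)"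
      using greater by (auto intro!: derivative_eq_intros)
    have "real j * (1 / t) ^ (j - 1) * ((1 / t) * (1 / t)) = real j * (1 / t) ^ (j + 1)"
      by (cases j) auto
    then show ?thesis
      using DERIV_mult[OF DERIV_fun_exp[OF DERIV_minus[OF inv]] DERIV_power[OF inv, of j]] greater
      by (simp add: flat_def algebra_simps)
  qed
  then show ?thesis
    by (rule has_field_derivative_transform_within_open[of _ _ _ "{0<..}"]) (use greater in \<open>auto simp: flat_def\<close>)
next
  case less
  have "((\<lambda>t. 0) has_real_derivative flat (j + 2) t - real j * flat (j + 1) t) (at t)"
    using less by (simp add: flat_def)
  then show ?thesis
    by (rule has_field_derivative_transform_within_open[of _ _ _ "{..<0}"]) (use less in \<open>auto simp: flat_def\<close>)
next
  case equal
  have "(flat j h - flat j 0) / h = flat (j + 1) h" for h by (simp add: flat_def)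
  then have "(flat j has_real_derivative 0) (at 0)"
    using flat_tendsto_0[of "j + 1"] by (simp add: DERIV_def)
  then show ?thesis using equal by (simp add: flat_def)
qed

lemma flat_smooth: "smooth_on UNIV (flat j)"
proof -
  have "times_differentiable_on k UNIV (flat j)" for k
  proof (induction k arbitrary: j)
    case 0
    then show ?case
      using flat_has_derivative by (auto intro!: continuous_at_imp_continuous_on DERIV_isCont)
  next
    case (Suc k)
    show ?case
    proof (rule times_differentiable_on_SucI)
      show "(flat j has_derivative (\<lambda>v. (flat (j + 2) t + (- real j) * flat (j + 1) t) * v)) (at t)" for t
        using flat_has_derivative[of j t] by (simp add: has_field_derivative_def)
      have m: "times_differentiable_on k UNIV (\<lambda>t. c * g t)" if "times_differentiable_on k UNIV g"
        for c and g :: "real \<Rightarrow> real"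
        using times_differentiable_on_bounded_linear_compose[OF open_UNIV bounded_linear_mult_right that] .
      show "times_differentiable_on k UNIV (\<lambda>t. (flat (j + 2) t + (- real j) * flat (j + 1) t) * v)" for v
        using m[OF times_differentiable_on_add[OF open_UNIV Suc.IH[of "j + 2"]
            m[OF Suc.IH[of "j + 1"], of "- real j"]], of v]
        by (simp add: mult.commute[of _ v])
    qed simp
  qed
  then show ?thesis by (simp add: smooth_on_def)
qed

text \<open>A composition of two flat functions gives a cutoff without any division by a non-constant
  function: the inner one is constant on one side of \<open>a\<close>, and beyond \<open>b\<close> it makes the argument of the
  outer one nonpositive.\<close>

lemma ex_smooth_cutoff:
  fixes a b :: real
  assumes "a < b"
  obtains g :: "real \<Rightarrow> real" where "smooth_on UNIV g" "\<And>t. t \<le> a \<Longrightarrow> g t = 1" "\<And>t. b \<le> t \<Longrightarrow> g t = 0"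
proof -
  define c where "c = flat 0 (b - a)"
  define C where "C = flat 0 c"
  have c: "c > 0" using assms by (simp add: c_def flat_def)
  then have C: "C > 0" by (simp add: C_def flat_def)
  define g where "g t = inverse C * flat 0 (c + (- 1) * flat 0 (t + - a))" for t
  have lin: "smooth_on UNIV (\<lambda>t::real. t + - a)"
    by (intro smooth_on_add smooth_on_const) (auto intro: smooth_on_bounded_linear bounded_linear_ident)
  have 1: "smooth_on UNIV (\<lambda>t. c + (- 1) * flat 0 (t + - a))"
    by (rule smooth_on_add[OF open_UNIV smooth_on_const
          smooth_on_mult[OF open_UNIV smooth_on_const
            smooth_on_compose[OF open_UNIV open_UNIV subset_UNIV flat_smooth lin]]])
  have "smooth_on UNIV g" unfolding g_def
    by (rule smooth_on_mult[OF open_UNIV smooth_on_const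
            smooth_on_compose[OF open_UNIV open_UNIV subset_UNIV flat_smooth 1]])
  moreover have "g t = 1" if "t \<le> a" for t
  proof -
    have "flat 0 (t + - a) = 0" using that by (simp add: flat_def)
    then show ?thesis using C by (simp add: g_def C_def)
  qed
  moreover have "g t = 0" if "b \<le> t" for t
  proof -
    have "exp (- (1 / (b - a))) \<le> exp (- (1 / (t - a)))"
      using that assms by (simp add: frac_le)
    then have "c \<le> flat 0 (t + - a)" using that assms by (simp add: c_def flat_def)
    then show ?thesis by (simp add: g_def flat_def)
  qed
  ultimately show ?thesis using that by blast
qed

section \<open>Smooth functions on a manifold\<close>

locale manifold =
  fixes A :: "('a::{t2_space, second_countable_topology}, 'm::finite) chart set"
  assumes smooth_str: "smooth_structure A"
begin

lemma atlas_charts: "\<forall>d\<in>A. is_chart d"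
  and atlas_cover: "(\<Union>d\<in>A. fst d) = UNIV"
  and atlas_transition: "\<forall>c\<in>A. \<forall>d\<in>A. smooth_transition c d"
proof -
  note s = smooth_str[unfolded smooth_structure_def]
  show "\<forall>d\<in>A. is_chart d" by (rule conjunct1[OF s])
  show "(\<Union>d\<in>A. fst d) = UNIV" by (rule conjunct1[OF conjunct2[OF s]])
  show "\<forall>c\<in>A. \<forall>d\<in>A. smooth_transition c d" by (rule conjunct1[OF conjunct2[OF conjunct2[OF s]]])
qed

lemma chart_homeo: "d \<in> A \<Longrightarrow> homeomorphism (fst d) (snd d ` fst d) (snd d) (chart_inv d)"
  and chart_open: "d \<in> A \<Longrightarrow> open (fst d)"
  and chart_image_open: "d \<in> A \<Longrightarrow> open (snd d ` fst d)"
  using atlas_charts unfolding is_chart_def by simp_all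

lemma chart_cover: "\<exists>d\<in>A. p \<in> fst d"
  using atlas_cover by (metis UN_iff UNIV_I)

lemma transition_smooth:
  "c \<in> A \<Longrightarrow> d \<in> A \<Longrightarrow> smooth_on (snd c ` (fst c \<inter> fst d)) (\<lambda>x. snd d (chart_inv c x))"
  using atlas_transition unfolding smooth_transition_def comp_def by simp

lemma chart_inv_chart [simp]: "d \<in> A \<Longrightarrow> p \<in> fst d \<Longrightarrow> chart_inv d (snd d p) = p"
  using homeomorphism_apply1[OF chart_homeo] by blast

lemma chart_image_Int_open:
  assumes "d \<in> A" "open W"
  shows "open (snd d ` (fst d \<inter> W))"
proof -
  have "openin (top_of_set (snd d ` fst d)) (snd d ` (fst d \<inter> W))"
    by (rule homeomorphism_imp_open_map[OF chart_homeo[OF \<open>d \<in> A\<close>]]) (rule openin_open_Int[OF \<open>open W\<close>])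
  then show ?thesis using openin_open_trans chart_image_open[OF \<open>d \<in> A\<close>] by blast
qed

lemma smooth_fun_onI:
  assumes "\<And>d. d \<in> A \<Longrightarrow> smooth_on (snd d ` (fst d \<inter> W)) (\<lambda>x. f (chart_inv d x))"
  shows "smooth_fun_on A W f"
  using assms unfolding smooth_fun_on_def comp_def by blast

lemma smooth_fun_onD:
  assumes "smooth_fun_on A W f" "d \<in> A"
  shows "smooth_on (snd d ` (fst d \<inter> W)) (\<lambda>x. f (chart_inv d x))"
  using assms unfolding smooth_fun_on_def comp_def by blast

lemma smooth_fun_on_subset: "smooth_fun_on A W f \<Longrightarrow> V \<subseteq> W \<Longrightarrow> smooth_fun_on A V f"
  unfolding smooth_fun_on_def
  by (meson Int_mono image_mono order_refl smooth_on_subset)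

lemma smooth_fun_on_cong:
  assumes "open W" "\<And>q. q \<in> W \<Longrightarrow> f q = g q" "smooth_fun_on A W f"
  shows "smooth_fun_on A W g"
proof (rule smooth_fun_onI)
  fix d assume d: "d \<in> A"
  show "smooth_on (snd d ` (fst d \<inter> W)) (\<lambda>x. g (chart_inv d x))"
    by (rule smooth_on_cong[OF chart_image_Int_open[OF d assms(1)] _ smooth_fun_onD[OF assms(3) d]])
      (use d assms(2) in auto)
qed

lemma smooth_fun_on_union:
  assumes "open V" "open W" "smooth_fun_on A V f" "smooth_fun_on A W f"
  shows "smooth_fun_on A (V \<union> W) f"
proof (rule smooth_fun_onI)
  fix d assume d: "d \<in> A"
  show "smooth_on (snd d ` (fst d \<inter> (V \<union> W))) (\<lambda>x. f (chart_inv d x))"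
    unfolding Int_Un_distrib image_Un
    by (intro smooth_on_union chart_image_Int_open d smooth_fun_onD assms)
qed

lemma smooth_fun_on_const: "smooth_fun_on A W (\<lambda>_. k)"
  by (rule smooth_fun_onI, rule smooth_on_const)

lemma smooth_fun_on_add:
  "open W \<Longrightarrow> smooth_fun_on A W f \<Longrightarrow> smooth_fun_on A W g \<Longrightarrow> smooth_fun_on A W (\<lambda>q. f q + g q)"
  by (rule smooth_fun_onI, rule smooth_on_add[OF chart_image_Int_open smooth_fun_onD smooth_fun_onD])

lemma smooth_fun_on_mult:
  "open W \<Longrightarrow> smooth_fun_on A W f \<Longrightarrow> smooth_fun_on A W g \<Longrightarrow> smooth_fun_on A W (\<lambda>q. f q * g q)"
  by (rule smooth_fun_onI, rule smooth_on_mult[OF chart_image_Int_open smooth_fun_onD smooth_fun_onD])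

lemma smooth_fun_on_sum:
  assumes "open W" "\<And>i. i \<in> I \<Longrightarrow> smooth_fun_on A W (f i)"
  shows "smooth_fun_on A W (\<lambda>q. \<Sum>i\<in>I. f i q)"
  using assms(2)
  by (induction I rule: infinite_finite_induct)
    (auto intro: smooth_fun_on_const smooth_fun_on_add assms)

lemma smooth_fun_on_coord:
  assumes "c \<in> A"
  shows "smooth_fun_on A (fst c) (coord_fun c u)"
  unfolding coord_fun_def
  by (rule smooth_fun_onI, rule smooth_on_bounded_linear_compose[OF chart_image_Int_open
        bounded_linear_vec_nth transition_smooth]) (rule assms chart_open | assumption)+

lemma smooth_fun_nearI: "open W \<Longrightarrow> p \<in> W \<Longrightarrow> smooth_fun_on A W f \<Longrightarrow> smooth_fun_near A p f"
  unfolding smooth_fun_near_def by blast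

lemma smooth_fun_near_transform:
  assumes f: "smooth_fun_near A p f" and W: "open W" "p \<in> W" and eq: "\<And>q. q \<in> W \<Longrightarrow> f q = g q"
  shows "smooth_fun_near A p g"
proof -
  obtain V where V: "open V" "p \<in> V" "smooth_fun_on A V f"
    using f unfolding smooth_fun_near_def by blast
  have o: "open (V \<inter> W)" using V(1) W(1) by (rule open_Int)
  have "smooth_fun_on A (V \<inter> W) f" by (rule smooth_fun_on_subset[OF V(3) Int_lower1])
  then have g: "smooth_fun_on A (V \<inter> W) g"
    by (rule smooth_fun_on_cong[OF o, rotated]) (rule eq, erule IntD2)
  show ?thesis by (rule smooth_fun_nearI[OF o IntI[OF V(2) W(2)] g])
qed

lemma smooth_fun_near_cong:
  assumes W: "open W" "p \<in> W" and eq: "\<And>q. q \<in> W \<Longrightarrow> f q = g q"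
  shows "smooth_fun_near A p f \<longleftrightarrow> smooth_fun_near A p g"
proof
  assume "smooth_fun_near A p f"
  then show "smooth_fun_near A p g" by (rule smooth_fun_near_transform[OF _ W]) (rule eq)
next
  assume "smooth_fun_near A p g"
  then show "smooth_fun_near A p f" by (rule smooth_fun_near_transform[OF _ W]) (rule eq[symmetric])
qed

lemma smooth_fun_near_common:
  assumes "finite I" "\<And>i. i \<in> I \<Longrightarrow> smooth_fun_near A p (f i)"
  obtains W where "open W" "p \<in> W" "\<And>i. i \<in> I \<Longrightarrow> smooth_fun_on A W (f i)"
proof -
  from assms(2) have "\<forall>i\<in>I. \<exists>W. open W \<and> p \<in> W \<and> smooth_fun_on A W (f i)"
    by (auto simp: smooth_fun_near_def)
  then obtain W where W: "\<And>i. i \<in> I \<Longrightarrow> open (W i) \<and> p \<in> W i \<and> smooth_fun_on A (W i) (f i)" by metis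
  show ?thesis
    by (rule that[of "\<Inter>i\<in>I. W i"]) (use W assms(1) in \<open>auto intro: smooth_fun_on_subset\<close>)
qed

lemma smooth_fun_near_const: "smooth_fun_near A p (\<lambda>_. k)"
  by (rule smooth_fun_nearI[OF open_UNIV UNIV_I smooth_fun_on_const])

lemma smooth_fun_near_add:
  assumes "smooth_fun_near A p f" "smooth_fun_near A p g"
  shows "smooth_fun_near A p (\<lambda>q. f q + g q)"
proof -
  obtain V W where VW: "open V" "p \<in> V" "smooth_fun_on A V f" "open W" "p \<in> W" "smooth_fun_on A W g"
    using assms unfolding smooth_fun_near_def by metis
  have o: "open (V \<inter> W)" using VW by auto
  show ?thesis
    by (rule smooth_fun_nearI[OF o _ smooth_fun_on_add[OF o smooth_fun_on_subset[OF VW(3)]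
            smooth_fun_on_subset[OF VW(6)]]]) (use VW in auto)
qed

lemma smooth_fun_near_mult:
  assumes "smooth_fun_near A p f" "smooth_fun_near A p g"
  shows "smooth_fun_near A p (\<lambda>q. f q * g q)"
proof -
  obtain V W where VW: "open V" "p \<in> V" "smooth_fun_on A V f" "open W" "p \<in> W" "smooth_fun_on A W g"
    using assms unfolding smooth_fun_near_def by metis
  have o: "open (V \<inter> W)" using VW by auto
  show ?thesis
    by (rule smooth_fun_nearI[OF o _ smooth_fun_on_mult[OF o smooth_fun_on_subset[OF VW(3)]
            smooth_fun_on_subset[OF VW(6)]]]) (use VW in auto)
qed

lemma smooth_fun_near_sum:
  assumes "\<And>i. i \<in> I \<Longrightarrow> smooth_fun_near A p (f i)"
  shows "smooth_fun_near A p (\<lambda>q. \<Sum>i\<in>I. f i q)"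
  using assms
  by (induction I rule: infinite_finite_induct) (auto intro: smooth_fun_near_const smooth_fun_near_add)

lemma smooth_fun_near_diff:
  assumes "smooth_fun_near A p f" "smooth_fun_near A p g"
  shows "smooth_fun_near A p (\<lambda>q. f q - g q)"
  using smooth_fun_near_add[OF assms(1) smooth_fun_near_mult[OF smooth_fun_near_const[of _ "-1"] assms(2)]]
  by simp

lemma smooth_fun_near_coord: "c \<in> A \<Longrightarrow> p \<in> fst c \<Longrightarrow> smooth_fun_near A p (coord_fun c u)"
  by (rule smooth_fun_nearI[OF chart_open _ smooth_fun_on_coord])

end

section \<open>Partial derivatives in a chart\<close>

lemma sum_axis [simp]: "(\<Sum>v\<in>UNIV. axis u 1 $ v * h v) = (h u :: real)" for u :: "'m::finite"
proof -
  have "(\<Sum>v\<in>UNIV. axis u 1 $ v * h v) = (\<Sum>v\<in>UNIV. if v = u then h v else 0)"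
    by (rule sum.cong) (auto simp: axis_def)
  then show ?thesis by simp
qed

text \<open>From here on, the calculus in a fixed chart \<open>c\<close> is expressed by the operators \<open>pd u p\<close> on functions
  near \<open>p\<close> and the coordinate functions \<open>x u\<close>, so that the coordinate map itself disappears.\<close>

locale manifold_chart = manifold A
  for A :: "('a::{t2_space, second_countable_topology}, 'm::finite) chart set" +
  fixes c :: "('a, 'm) chart"
  assumes c: "c \<in> A"
begin

abbreviation "pd \<equiv> coord_field A c"
abbreviation "x \<equiv> coord_fun c"

lemmas c_open = chart_open[OF c]
lemmas x_smooth = smooth_fun_on_coord[OF c]

lemma x_smooth_near: "p \<in> fst c \<Longrightarrow> smooth_fun_near A p (x u)"
  by (rule smooth_fun_near_coord[OF c])

lemma smooth_fun_near_local:
  assumes "smooth_fun_near A p f" "p \<in> fst c"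
  obtains W where "open W" "p \<in> W" "W \<subseteq> fst c" "smooth_fun_on A W f"
    "open (snd c ` W)" "smooth_on (snd c ` W) (f \<circ> chart_inv c)"
proof -
  obtain V where V: "open V" "p \<in> V" "smooth_fun_on A V f" using assms unfolding smooth_fun_near_def by blast
  show ?thesis
  proof (rule that[of "fst c \<inter> V"])
    show "open (snd c ` (fst c \<inter> V))" by (rule chart_image_Int_open[OF c V(1)])
    show "smooth_on (snd c ` (fst c \<inter> V)) (f \<circ> chart_inv c)"
      using smooth_fun_onD[OF V(3) c] by (simp add: comp_def)
  qed (use V assms c_open smooth_fun_on_subset[OF V(3)] in auto)
qed

lemma smooth_fun_near_has_derivative:
  assumes "smooth_fun_near A p f" "p \<in> fst c"
  shows "((f \<circ> chart_inv c) has_derivative (\<lambda>z. \<Sum>u\<in>UNIV. z $ u * pd u p f)) (at (snd c p))"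
proof -
  obtain W where W: "open W" "p \<in> W" "smooth_on (snd c ` W) (f \<circ> chart_inv c)"
    using smooth_fun_near_local[OF assms] by metis
  let ?F = "frechet_derivative (f \<circ> chart_inv c) (at (snd c p))"
  have F: "((f \<circ> chart_inv c) has_derivative ?F) (at (snd c p))"
    by (rule smooth_on_has_derivative[OF W(3)]) (use W(2) in auto)
  interpret linear ?F using has_derivative_linear[OF F] .
  have "?F z = (\<Sum>u\<in>UNIV. z $ u * pd u p f)" for z
  proof -
    have "?F z = ?F (\<Sum>u\<in>UNIV. z $ u *\<^sub>R axis u 1)"
      using basis_expansion[of z] by (simp add: scalar_mult_eq_scaleR)
    also have "\<dots> = (\<Sum>u\<in>UNIV. z $ u * ?F (axis u 1))" by (simp add: sum scale)
    finally show ?thesis using assms(1) by (simp add: coord_field_def)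
  qed
  then have "?F = (\<lambda>z. \<Sum>u\<in>UNIV. z $ u * pd u p f)" by auto
  then show ?thesis using F by simp
qed

lemma pd_eqI:
  assumes "smooth_fun_near A p f" "((f \<circ> chart_inv c) has_derivative F) (at (snd c p))"
  shows "pd u p f = F (axis u 1)"
  using assms frechet_derivative_at by (auto simp: coord_field_def)

lemma pd_cong:
  assumes "open W" "p \<in> W" "\<And>q. q \<in> W \<Longrightarrow> f q = g q" "p \<in> fst c"
  shows "pd u p f = pd u p g"
proof (cases "smooth_fun_near A p f")
  case True
  then have g: "smooth_fun_near A p g" using smooth_fun_near_cong[OF assms(1-3)] by simp
  let ?F = "\<lambda>z. \<Sum>u\<in>UNIV. z $ u * pd u p f"
  have "((g \<circ> chart_inv c) has_derivative ?F) (at (snd c p))"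
    by (rule has_derivative_transform_within_open[OF smooth_fun_near_has_derivative[OF True assms(4)]
          chart_image_Int_open[OF c assms(1)]]) (use assms c in auto)
  from pd_eqI[OF g this] show ?thesis by simp
next
  case False
  then show ?thesis using smooth_fun_near_cong[OF assms(1-3)] by (simp add: coord_field_def)
qed

lemma pd_const [simp]: "pd u p (\<lambda>_. k) = 0"
  by (simp add: pd_eqI[OF smooth_fun_near_const, where F = "\<lambda>_. 0"] comp_def)

lemma pd_add:
  assumes "smooth_fun_near A p f" "smooth_fun_near A p g" "p \<in> fst c"
  shows "pd u p (\<lambda>q. f q + g q) = pd u p f + pd u p g"
proof -
  have F: "((f \<circ> chart_inv c) has_derivative (\<lambda>z. \<Sum>u\<in>UNIV. z $ u * pd u p f)) (at (snd c p))"
   and G: "((g \<circ> chart_inv c) has_derivative (\<lambda>z. \<Sum>u\<in>UNIV. z $ u * pd u p g)) (at (snd c p))"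
    using assms by (auto intro: smooth_fun_near_has_derivative)
  have "(((\<lambda>q. f q + g q) \<circ> chart_inv c) has_derivative
     (\<lambda>z. (\<Sum>u\<in>UNIV. z $ u * pd u p f) + (\<Sum>u\<in>UNIV. z $ u * pd u p g))) (at (snd c p))"
    using has_derivative_add[OF F G] by (simp add: comp_def)
  from pd_eqI[OF smooth_fun_near_add[OF assms(1,2)] this] show ?thesis by simp
qed

lemma pd_mult:
  assumes "smooth_fun_near A p f" "smooth_fun_near A p g" "p \<in> fst c"
  shows "pd u p (\<lambda>q. f q * g q) = pd u p f * g p + f p * pd u p g"
proof -
  have F: "((f \<circ> chart_inv c) has_derivative (\<lambda>z. \<Sum>u\<in>UNIV. z $ u * pd u p f)) (at (snd c p))"
   and G: "((g \<circ> chart_inv c) has_derivative (\<lambda>z. \<Sum>u\<in>UNIV. z $ u * pd u p g)) (at (snd c p))"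
    using assms by (auto intro: smooth_fun_near_has_derivative)
  have "(((\<lambda>q. f q * g q) \<circ> chart_inv c) has_derivative
     (\<lambda>z. f p * (\<Sum>u\<in>UNIV. z $ u * pd u p g) + (\<Sum>u\<in>UNIV. z $ u * pd u p f) * g p)) (at (snd c p))"
    using has_derivative_mult[OF F G] assms(3) c by (simp add: comp_def)
  from pd_eqI[OF smooth_fun_near_mult[OF assms(1,2)] this] show ?thesis by simp
qed

lemma pd_sum:
  assumes "\<And>i. i \<in> I \<Longrightarrow> smooth_fun_near A p (f i)" "p \<in> fst c"
  shows "pd u p (\<lambda>q. \<Sum>i\<in>I. f i q) = (\<Sum>i\<in>I. pd u p (f i))"
  using assms(1)
  by (induction I rule: infinite_finite_induct)
    (auto simp: pd_add[OF _ smooth_fun_near_sum assms(2)])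

lemma pd_cmult:
  assumes "smooth_fun_near A p f" "p \<in> fst c"
  shows "pd u p (\<lambda>q. k * f q) = k * pd u p f"
  using pd_mult[OF smooth_fun_near_const assms] by simp

lemma pd_diff:
  assumes "smooth_fun_near A p f" "smooth_fun_near A p g" "p \<in> fst c"
  shows "pd u p (\<lambda>q. f q - g q) = pd u p f - pd u p g"
  using pd_add[OF assms(1) smooth_fun_near_mult[OF smooth_fun_near_const[of _ "-1"] assms(2)] assms(3)]
    pd_cmult[OF assms(2,3), of u "-1"] by simp

lemma pd_coord:
  assumes "p \<in> fst c"
  shows "pd u p (x v) = (if u = v then 1 else 0)"
proof -
  have "((x v \<circ> chart_inv c) has_derivative (\<lambda>z. z $ v)) (at (snd c p))"
    by (rule has_derivative_transform_within_open[OF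
          bounded_linear_imp_has_derivative[OF bounded_linear_vec_nth] chart_image_open[OF c]])
      (use assms c in \<open>auto simp: coord_fun_def\<close>)
  from pd_eqI[OF x_smooth_near[OF assms] this] show ?thesis by (simp add: axis_def)
qed

lemma pd_chart_derivative:
  assumes "smooth_fun_on A W f" "open W" "W \<subseteq> fst c" "q \<in> W"
  shows "pd u q f = frechet_derivative (f \<circ> chart_inv c) (at (snd c q)) (axis u 1)"
  using smooth_fun_nearI[OF assms(2,4,1)] by (simp add: coord_field_def)

text \<open>In another chart \<open>d\<close>, the partial derivative is the derivative in \<open>c\<close> composed with the
  transition map.\<close>

lemma pd_smooth:
  assumes "smooth_fun_on A W f" "open W" "W \<subseteq> fst c"
  shows "smooth_fun_on A W (\<lambda>q. pd u q f)"
proof (rule smooth_fun_onI)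
  fix d assume d: "d \<in> A"
  have eq: "fst c \<inter> W = W" using assms(3) by auto
  have F: "smooth_on (snd c ` W) (\<lambda>y. frechet_derivative (f \<circ> chart_inv c) (at y) (axis u 1))"
    using smooth_on_frechet_derivative[OF smooth_fun_onD[OF assms(1) c]] by (simp add: comp_def eq)
  show "smooth_on (snd d ` (fst d \<inter> W)) (\<lambda>y. pd u (chart_inv d y) f)"
  proof (rule smooth_on_cong)
    show "smooth_on (snd d ` (fst d \<inter> W)) (\<lambda>y. frechet_derivative (f \<circ> chart_inv c)
        (at (snd c (chart_inv d y))) (axis u 1))"
    proof (rule smooth_on_compose[OF _ _ _ F])
      show "open (snd c ` W)" using chart_image_Int_open[OF c assms(2)] eq by simp
      show "smooth_on (snd d ` (fst d \<inter> W)) (\<lambda>y. snd c (chart_inv d y))"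
        by (rule smooth_on_subset[OF transition_smooth[OF d c]]) (use assms(3) in auto)
    qed (use d assms in \<open>auto intro: chart_image_Int_open\<close>)
  qed (use d assms in \<open>auto intro: chart_image_Int_open simp: pd_chart_derivative\<close>)
qed

lemma pd_smooth_near:
  assumes "smooth_fun_near A p f" "p \<in> fst c"
  shows "smooth_fun_near A p (\<lambda>q. pd u q f)"
proof -
  obtain W where "open W" "p \<in> W" "W \<subseteq> fst c" "smooth_fun_on A W f"
    using smooth_fun_near_local[OF assms] by metis
  then show ?thesis by (intro smooth_fun_nearI[OF _ _ pd_smooth])
qed

lemma pd_commute:
  assumes "smooth_fun_near A p f" "p \<in> fst c"
  shows "pd u p (\<lambda>q. pd v q f) = pd v p (\<lambda>q. pd u q f)"
proof -
  obtain W where W: "open W" "p \<in> W" "W \<subseteq> fst c" "smooth_fun_on A W f"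
    "open (snd c ` W)" "smooth_on (snd c ` W) (f \<circ> chart_inv c)"
    using smooth_fun_near_local[OF assms] by metis
  have inv: "chart_inv c (snd c q) = q" if "q \<in> W" for q
    using that W(3) c by auto
  let ?F = "f \<circ> chart_inv c"
  have "pd u p (\<lambda>q. pd v q f) =
      frechet_derivative (\<lambda>y. frechet_derivative ?F (at y) (axis v 1)) (at (snd c p)) (axis u 1)" for u v
  proof (rule pd_eqI[OF pd_smooth_near[OF assms]])
    show "(((\<lambda>q. pd v q f) \<circ> chart_inv c) has_derivative
        frechet_derivative (\<lambda>y. frechet_derivative ?F (at y) (axis v 1)) (at (snd c p))) (at (snd c p))"
      by (rule has_derivative_transform_within_open[OF
            smooth_on_has_derivative[OF smooth_on_frechet_derivative[OF W(6)]] W(5)])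
        (use W(2) in \<open>auto simp: inv pd_chart_derivative[OF W(4,1,3)]\<close>)
  qed
  then show ?thesis
    using second_derivative_symmetric[OF W(5) _ W(6), of "snd c p" "axis v 1" "axis u 1"] W(2) by simp
qed

section \<open>Tangent vectors and covectors in a chart\<close>

text \<open>The chain rule along a curve: its velocity is the combination of the coordinate fields whose
  coefficients are the velocity of the coordinate representation of the curve.\<close>

lemma tangent_vector_components:
  assumes p: "p \<in> fst c" and "v \<in> tangent_space A p"
  obtains z where "v = (\<lambda>f. \<Sum>u\<in>UNIV. z $ u * pd u p f)"
proof -
  from assms(2) obtain \<gamma> where v: "v = velocity A \<gamma>" and \<gamma>0: "\<gamma> 0 = p" and curve: "smooth_curve_near_0 A \<gamma>"
    unfolding tangent_space_def mem_Collect_eq by metis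
  obtain e where e: "e > 0"
    and cont: "continuous_on {-e<..<e} \<gamma>"
    and sm: "\<And>d. d \<in> A \<Longrightarrow> smooth_on {t \<in> {-e<..<e}. \<gamma> t \<in> fst d} (snd d \<circ> \<gamma>)"
    using curve unfolding smooth_curve_near_0_def by metis
  let ?G = "frechet_derivative (snd c \<circ> \<gamma>) (at 0)"
  have G: "((snd c \<circ> \<gamma>) has_derivative ?G) (at 0)"
    by (rule smooth_on_has_derivative[OF sm[OF c]]) (use e \<gamma>0 p in auto)
  have "v f = (\<Sum>u\<in>UNIV. ?G 1 $ u * pd u p f)" for f
  proof (cases "smooth_fun_near A p f")
    case True
    let ?F = "\<lambda>z. \<Sum>u\<in>UNIV. z $ u * pd u p f"
    have F: "((f \<circ> chart_inv c) has_derivative ?F) (at ((snd c \<circ> \<gamma>) 0))"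
      using smooth_fun_near_has_derivative[OF True p] \<gamma>0 by simp
    have "open ({-e<..<e} \<inter> \<gamma> -` fst c)"
      by (rule continuous_open_preimage[OF cont _ c_open]) auto
    then have "((f \<circ> \<gamma>) has_derivative (\<lambda>h. ?F (?G h))) (at 0)"
      by (rule has_derivative_transform_within_open[OF has_derivative_compose[OF G F]])
        (use e \<gamma>0 p c in auto)
    moreover have "(\<lambda>h. ?F (?G h)) = (*) (?F (?G 1))"
    proof
      fix h
      show "?F (?G h) = ?F (?G 1) * h"
        using linear_scale[OF has_derivative_linear[OF G], of h 1]
        by (simp add: sum_distrib_left algebra_simps)
    qed
    ultimately have "((f \<circ> \<gamma>) has_real_derivative ?F (?G 1)) (at 0)"
      unfolding has_field_derivative_def by metis
    then show ?thesis using True \<gamma>0 by (simp add: v velocity_def DERIV_imp_deriv)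
  next
    case False
    then show ?thesis by (simp add: v velocity_def \<gamma>0 coord_field_def)
  qed
  then have "v = (\<lambda>f. \<Sum>u\<in>UNIV. ?G 1 $ u * pd u p f)" by (rule ext)
  then show ?thesis by (rule that)
qed

text \<open>The coordinate line through \<open>p\<close> in direction \<open>z\<close> has this velocity. It leaves the chart in general,
  so only its germ is used.\<close>

lemma combination_in_tangent_space:
  assumes p: "p \<in> fst c"
  shows "(\<lambda>f. \<Sum>u\<in>UNIV. z $ u * pd u p f) \<in> tangent_space A p"
proof -
  define v where v: "v = (\<lambda>f. \<Sum>u\<in>UNIV. z $ u * pd u p f)"
  define l where "l t = snd c p + t *\<^sub>R z" for t
  define \<gamma> where "\<gamma> t = chart_inv c (l t)" for t
  have \<gamma>0: "\<gamma> 0 = p" using p c by (simp add: \<gamma>_def l_def)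
  have l: "smooth_on S l" if "open S" for S
    unfolding l_def
    by (rule smooth_on_add[OF that smooth_on_const smooth_on_bounded_linear[OF that bounded_linear_scaleR_left]])
  have "open (l -` (snd c ` fst c))"
    by (rule continuous_open_vimage[OF chart_image_open[OF c]])
      (use smooth_on_continuous[OF l[OF open_UNIV]] in \<open>auto simp: continuous_on_eq_continuous_at\<close>)
  moreover have "0 \<in> l -` (snd c ` fst c)" using p by (simp add: l_def)
  ultimately obtain e where e: "e > 0" "ball 0 e \<subseteq> l -` (snd c ` fst c)"
    using open_contains_ball by blast
  have le: "l t \<in> snd c ` fst c" if "t \<in> {-e<..<e}" for t
    using e(2) that by (auto simp: ball_def dist_real_def subset_iff)
  have cont: "continuous_on {-e<..<e} \<gamma>"
    unfolding \<gamma>_def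
    by (rule continuous_on_compose2[OF homeomorphism_cont2[OF chart_homeo[OF c]] smooth_on_continuous[OF l]])
      (use le in auto)
  have "smooth_on {t \<in> {-e<..<e}. \<gamma> t \<in> fst d} (snd d \<circ> \<gamma>)" if d: "d \<in> A" for d
  proof -
    have o: "open {t \<in> {-e<..<e}. \<gamma> t \<in> fst d}"
      using continuous_open_preimage[OF cont _ chart_open[OF d]] by (simp add: vimage_def Int_def)
    have "l t \<in> snd c ` (fst c \<inter> fst d)" if "t \<in> {-e<..<e}" "\<gamma> t \<in> fst d" for t
      using le[OF that(1)] that(2) c unfolding \<gamma>_def by auto
    then have "smooth_on {t \<in> {-e<..<e}. \<gamma> t \<in> fst d} (\<lambda>t. snd d (chart_inv c (l t)))"
      by (intro smooth_on_compose[OF o _ _ transition_smooth[OF c d] l[OF o]])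
        (auto intro: chart_image_Int_open c chart_open d)
    then show ?thesis by (simp add: \<gamma>_def comp_def)
  qed
  then have "smooth_curve_near_0 A \<gamma>"
    unfolding smooth_curve_near_0_def by (intro exI[of _ e] conjI ballI e(1) cont)
  then have tangent: "velocity A \<gamma> \<in> tangent_space A p"
    unfolding tangent_space_def mem_Collect_eq by (intro exI[of _ \<gamma>] conjI refl \<gamma>0)
  have "velocity A \<gamma> f = v f" for f
  proof (cases "smooth_fun_near A p f")
    case True
    have "((\<lambda>t. (f \<circ> chart_inv c) (snd c p + t *\<^sub>R z)) has_real_derivative v f) (at 0)"
      unfolding v by (rule line_has_real_derivative)
        (use smooth_fun_near_has_derivative[OF True p] in \<open>simp add: comp_def\<close>)
    then have "((f \<circ> \<gamma>) has_real_derivative v f) (at 0)"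
      by (simp add: \<gamma>_def l_def comp_def)
    then show ?thesis using True by (simp add: velocity_def \<gamma>0 DERIV_imp_deriv)
  next
    case False
    then show ?thesis by (simp add: v velocity_def \<gamma>0 coord_field_def)
  qed
  then have "velocity A \<gamma> = v" by (rule ext)
  with tangent show ?thesis unfolding v by simp
qed

lemma tangent_apply:
  assumes p: "p \<in> fst c" and v: "v \<in> tangent_space A p"
  shows "v f = (\<Sum>u\<in>UNIV. v (x u) * pd u p f)"
proof -
  obtain z where z: "v = (\<lambda>f. \<Sum>u\<in>UNIV. z $ u * pd u p f)"
    using tangent_vector_components[OF assms] .
  have "v (x w) = z $ w" for w by (simp add: z pd_coord[OF p] if_distrib sum.delta cong: if_cong)
  then show ?thesis by (simp add: z)
qed

lemma lincomb_tangent: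
  assumes "p \<in> fst c"
  shows "(\<lambda>f. \<Sum>u\<in>UNIV. a u * pd u p f) \<in> tangent_space A p"
  using combination_in_tangent_space[OF assms, of "\<chi> u. a u"] by simp

lemma pd_tangent:
  assumes "p \<in> fst c"
  shows "pd u p \<in> tangent_space A p"
proof -
  have "(\<lambda>f. \<Sum>v\<in>UNIV. axis u 1 $ v * pd v p f) = pd u p" by (rule ext) simp
  then show ?thesis using combination_in_tangent_space[OF assms, of "axis u 1"] by simp
qed

lemma tangent_comb:
  assumes "p \<in> fst c" "v \<in> tangent_space A p" "w \<in> tangent_space A p"
  shows "(\<lambda>f. a * v f + b * w f) \<in> tangent_space A p"
proof -
  have "(\<lambda>f. a * v f + b * w f) = (\<lambda>f. \<Sum>u\<in>UNIV. (a * v (x u) + b * w (x u)) * pd u p f)"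
    by (rule ext, subst tangent_apply[OF assms(1,2)], subst tangent_apply[OF assms(1,3)])
      (simp add: sum_distrib_left sum.distrib algebra_simps)
  then show ?thesis using lincomb_tangent[OF assms(1)] by simp
qed

lemma tangent_local:
  assumes "p \<in> fst c" "v \<in> tangent_space A p" "open W" "p \<in> W" "\<And>q. q \<in> W \<Longrightarrow> f q = g q"
  shows "v f = v g"
proof -
  have "pd u p f = pd u p g" for u by (rule pd_cong[OF assms(3,4) _ assms(1)]) (rule assms(5))
  then show ?thesis
    by (subst tangent_apply[OF assms(1,2), of f], subst tangent_apply[OF assms(1,2), of g]) simp
qed

lemma differential_cotangent:
  assumes "p \<in> fst c"
  shows "differential A f p \<in> cotangent_space A p"
  unfolding cotangent_space_def differential_def by (simp add: tangent_comb[OF assms])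

text \<open>Covectors are only linear on the tangent space, so the induction also has to carry along that the
  partial sums are tangent vectors.\<close>

lemma cotangent_lincomb:
  assumes p: "p \<in> fst c" and \<alpha>: "\<alpha> \<in> cotangent_space A p" and U: "finite U"
  shows "(\<lambda>f. \<Sum>u\<in>U. a u * pd u p f) \<in> tangent_space A p \<and>
    \<alpha> (\<lambda>f. \<Sum>u\<in>U. a u * pd u p f) = (\<Sum>u\<in>U. a u * \<alpha> (pd u p))"
  using U
proof (induction U)
  case empty
  have lin: "\<alpha> (\<lambda>f. a * v f + b * w f) = a * \<alpha> v + b * \<alpha> w"
    if "v \<in> tangent_space A p" "w \<in> tangent_space A p" for v w a b
    using \<alpha> that unfolding cotangent_space_def by blast
  obtain u :: 'm where True by simp
  show ?case
    using lincomb_tangent[OF p, of "\<lambda>_. 0"] lin[OF pd_tangent[OF p] pd_tangent[OF p], of 0 u 0 u]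
    by simp
next
  case (insert u U)
  have lin: "\<alpha> (\<lambda>f. a * v f + b * w f) = a * \<alpha> v + b * \<alpha> w"
    if "v \<in> tangent_space A p" "w \<in> tangent_space A p" for v w a b
    using \<alpha> that unfolding cotangent_space_def by blast
  show ?case
    using lin[OF pd_tangent[OF p] conjunct1[OF insert.IH], of "a u" u 1]
      tangent_comb[OF p pd_tangent[OF p] conjunct1[OF insert.IH], of "a u" u 1] insert
    by simp
qed

lemma cotangent_apply:
  assumes p: "p \<in> fst c" and \<alpha>: "\<alpha> \<in> cotangent_space A p" and v: "v \<in> tangent_space A p"
  shows "\<alpha> v = (\<Sum>u\<in>UNIV. v (x u) * \<alpha> (pd u p))"
proof -
  have "v = (\<lambda>f. \<Sum>u\<in>UNIV. v (x u) * pd u p f)" by (rule ext) (rule tangent_apply[OF p v])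
  then have "\<alpha> v = \<alpha> (\<lambda>f. \<Sum>u\<in>UNIV. v (x u) * pd u p f)" by simp
  then show ?thesis using cotangent_lincomb[OF p \<alpha>, of UNIV "\<lambda>u. v (x u)"] by simp
qed

lemma cotangent_outside:
  "\<alpha> \<in> cotangent_space A p \<Longrightarrow> v \<notin> tangent_space A p \<Longrightarrow> \<alpha> v = 0"
  unfolding cotangent_space_def by blast

lemma cotangent_eqI:
  assumes "p \<in> fst c" "\<alpha> \<in> cotangent_space A p" "\<beta> \<in> cotangent_space A p"
    "\<And>u. \<alpha> (pd u p) = \<beta> (pd u p)"
  shows "\<alpha> = \<beta>"
proof
  fix v show "\<alpha> v = \<beta> v"
  proof (cases "v \<in> tangent_space A p")
    case True
    then show ?thesis by (simp add: cotangent_apply[OF assms(1,2)] cotangent_apply[OF assms(1,3)] assms(4))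
  next
    case False
    then show ?thesis using cotangent_outside assms(2,3) by metis
  qed
qed

lemma differential_pd [simp]: "p \<in> fst c \<Longrightarrow> differential A f p (pd u p) = pd u p f"
  by (simp add: differential_def pd_tangent)

lemma cotangent_comb:
  assumes "\<beta> \<in> cotangent_space A p" "\<gamma> \<in> cotangent_space A p"
  shows "(\<lambda>v. a * \<beta> v + b * \<gamma> v) \<in> cotangent_space A p"
  using assms unfolding cotangent_space_def by (simp add: algebra_simps)

lemma cotangent_zero: "(\<lambda>_. 0) \<in> cotangent_space A p"
  unfolding cotangent_space_def by simp

lemma cotangent_sum:
  assumes "\<And>k. k \<in> K \<Longrightarrow> \<beta> k \<in> cotangent_space A p"
  shows "(\<lambda>v. \<Sum>k\<in>K. a k * \<beta> k v) \<in> cotangent_space A p"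
  using assms
proof (induction K rule: infinite_finite_induct)
  case (insert k K)
  then show ?case using cotangent_comb[of "\<beta> k" p "\<lambda>v. \<Sum>k\<in>K. a k * \<beta> k v" "a k" 1] by simp
qed (auto simp: cotangent_zero)

abbreviation "dx \<equiv> \<lambda>u. differential A (x u)"

lemma cotangent_rep:
  assumes p: "p \<in> fst c" and \<alpha>: "\<alpha> \<in> cotangent_space A p"
  shows "\<alpha> = (\<lambda>v. \<Sum>u\<in>UNIV. \<alpha> (pd u p) * dx u p v)"
  by (rule cotangent_eqI[OF p \<alpha> cotangent_sum])
    (auto simp: p pd_coord differential_cotangent if_distrib sum.delta cong: if_cong)

lemma differential_rep:
  assumes p: "p \<in> fst c"
  shows "differential A f p = (\<lambda>v. \<Sum>u\<in>UNIV. pd u p f * dx u p v)"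
  using cotangent_rep[OF p differential_cotangent[OF p, of f]] p by simp

lemma differential_cong:
  assumes "open W" "p \<in> W" "\<And>q. q \<in> W \<Longrightarrow> f q = g q" "p \<in> fst c"
  shows "differential A f p = differential A g p"
proof (rule ext)
  fix v
  show "differential A f p v = differential A g p v"
    unfolding differential_def
    using tangent_local[OF assms(4) _ assms(1,2), of v f g] assms(3) by auto
qed

lemma differential_zero:
  assumes "p \<in> fst c" "\<And>u. pd u p f = 0"
  shows "differential A f p = (\<lambda>_. 0)"
  by (subst differential_rep[OF assms(1)]) (simp add: assms(2))

text \<open>The coefficients are the components of the covector \<open>\<alpha>\<close> at the fixed point \<open>p\<close>, while the
  argument ranges over the chart. So the function has constant partial derivatives and the
  differential \<open>\<alpha>\<close> at \<open>p\<close>.\<close>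

definition lin :: "'a \<Rightarrow> 'a cotangent \<Rightarrow> 'a \<Rightarrow> real" where
  "lin p \<alpha> = (\<lambda>q. \<Sum>u\<in>UNIV. \<alpha> (pd u p) * x u q)"

lemma lin_smooth: "smooth_fun_on A (fst c) (lin p \<alpha>)"
  unfolding lin_def
  by (intro smooth_fun_on_sum smooth_fun_on_mult smooth_fun_on_const x_smooth c_open)

lemma lin_smooth_near: "q \<in> fst c \<Longrightarrow> smooth_fun_near A q (lin p \<alpha>)"
  by (rule smooth_fun_nearI[OF c_open _ lin_smooth])

lemma pd_lin:
  assumes "q \<in> fst c"
  shows "pd u q (lin p \<alpha>) = \<alpha> (pd u p)"
proof -
  have "pd u q (lin p \<alpha>) = (\<Sum>v\<in>UNIV. \<alpha> (pd v p) * pd u q (x v))"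
    unfolding lin_def
    by (subst pd_sum) (auto simp: assms pd_cmult x_smooth_near smooth_fun_near_mult smooth_fun_near_const)
  then show ?thesis by (simp add: pd_coord[OF assms] if_distrib sum.delta cong: if_cong)
qed

lemma differential_lin:
  "p \<in> fst c \<Longrightarrow> \<alpha> \<in> cotangent_space A p \<Longrightarrow> differential A (lin p \<alpha>) p = \<alpha>"
  by (rule cotangent_eqI) (auto simp: differential_cotangent pd_lin)

lemma pd_pd_lin:
  assumes "q \<in> fst c"
  shows "pd v q (\<lambda>q'. pd u q' (lin p \<alpha>)) = 0"
  using pd_cong[OF c_open assms, of "\<lambda>q'. pd u q' (lin p \<alpha>)" "\<lambda>_. \<alpha> (pd u p)" v] assms
  by (simp add: pd_lin)

lemma lin_comb: "lin p (\<lambda>v. a * \<beta> v + b * \<gamma> v) = (\<lambda>q. a * lin p \<beta> q + b * lin p \<gamma> q)"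
  by (rule ext) (simp add: lin_def algebra_simps sum.distrib sum_distrib_left)

section \<open>Extending functions from a chart to the manifold\<close>

text \<open>The cutoff is supported in the preimage of a closed ball, which is compact and hence closed because
  the manifold is a Hausdorff space. So extension by zero is smooth.\<close>

lemma extend_smooth_fun:
  assumes f: "smooth_fun_on A (fst c) f" and p: "p \<in> fst c"
  obtains g W where "smooth_fun_on A UNIV g" "open W" "p \<in> W" "\<And>q. q \<in> W \<Longrightarrow> g q = f q"
proof -
  let ?x = "snd c p"
  obtain r where r: "r > 0" "cball ?x r \<subseteq> snd c ` fst c"
    using chart_image_open[OF c] p open_contains_cball by blast
  have "r\<^sup>2 / 4 < r\<^sup>2" using r by simp
  then obtain h :: "real \<Rightarrow> real" where h: "smooth_on UNIV h" "\<And>t. t \<le> r\<^sup>2 / 4 \<Longrightarrow> h t = 1"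
    "\<And>t. r\<^sup>2 \<le> t \<Longrightarrow> h t = 0" using ex_smooth_cutoff by blast
  define \<psi> where "\<psi> y = h ((y + - ?x) \<bullet> (y + - ?x))" for y
  have l: "smooth_on UNIV (\<lambda>y::real^'m. y + - ?x)"
    by (rule smooth_on_add[OF open_UNIV smooth_on_bounded_linear[OF open_UNIV bounded_linear_ident] smooth_on_const])
  have \<psi>: "smooth_on UNIV \<psi>" unfolding \<psi>_def
    by (rule smooth_on_compose[OF open_UNIV open_UNIV subset_UNIV h(1)
          smooth_on_bilinear[OF open_UNIV bounded_bilinear_inner l l]])
  have norm: "(y + - ?x) \<bullet> (y + - ?x) = (dist y ?x)\<^sup>2" for y
    by (simp add: dist_norm power2_norm_eq_inner)
  define K where "K = chart_inv c ` cball ?x r"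
  have "compact K" unfolding K_def
    by (rule compact_continuous_image[OF continuous_on_subset[OF homeomorphism_cont2[OF chart_homeo[OF c]] r(2)]])
      simp
  then have K: "open (- K)" using compact_imp_closed by blast
  have KU: "- K \<union> fst c = UNIV" using r(2) c by (auto simp: K_def)
  define g where "g q = (if q \<in> fst c then \<psi> (snd c q) * f q else 0)" for q
  have "smooth_fun_on A (fst c) (\<lambda>q. \<psi> (snd c q))"
  proof (rule smooth_fun_onI)
    fix d assume d: "d \<in> A"
    show "smooth_on (snd d ` (fst d \<inter> fst c)) (\<lambda>y. \<psi> (snd c (chart_inv d y)))"
      by (rule smooth_on_compose[OF chart_image_Int_open[OF d c_open] open_UNIV subset_UNIV \<psi> transition_smooth[OF d c]])
  qed
  from smooth_fun_on_mult[OF c_open this f] have "smooth_fun_on A (fst c) g"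
    by (rule smooth_fun_on_cong[OF c_open, rotated]) (simp add: g_def)
  moreover have "smooth_fun_on A (- K) g"
  proof (rule smooth_fun_on_cong[OF K _ smooth_fun_on_const])
    fix q assume q: "q \<in> - K"
    show "0 = g q"
    proof (cases "q \<in> fst c")
      case True
      then have "snd c q \<notin> cball ?x r" using q c unfolding K_def by (metis Compl_iff chart_inv_chart image_eqI)
      then have "r \<le> dist (snd c q) ?x" by (simp add: dist_commute)
      then have "r\<^sup>2 \<le> (dist (snd c q) ?x)\<^sup>2" using r(1) by (intro power_mono) auto
      then show ?thesis using h(3) by (simp add: g_def \<psi>_def norm del: add_uminus_conv_diff)
    qed (simp add: g_def)
  qed
  ultimately have g: "smooth_fun_on A UNIV g"
    using smooth_fun_on_union[OF K c_open] KU by metis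
  define W where "W = fst c \<inter> snd c -` ball ?x (r / 2)"
  have "open W" unfolding W_def
    by (rule continuous_open_preimage[OF homeomorphism_cont1[OF chart_homeo[OF c]] c_open]) simp
  moreover have "p \<in> W" using p r by (simp add: W_def)
  moreover have "g q = f q" if "q \<in> W" for q
  proof -
    have "dist (snd c q) ?x \<le> r / 2" using that by (simp add: W_def dist_commute)
    then have "(dist (snd c q) ?x)\<^sup>2 \<le> (r / 2)\<^sup>2" by (intro power_mono) auto
    then show ?thesis using h(2) that
      by (simp add: g_def \<psi>_def norm W_def power_divide del: add_uminus_conv_diff)
  qed
  ultimately show ?thesis using that g by metis
qed

section \<open>Multivectors at a point\<close>

lemma mv_zero: "T \<in> multivectors A n p \<Longrightarrow> i < n \<Longrightarrow> \<alpha> i \<notin> cotangent_space A p \<Longrightarrow> T \<alpha> = 0"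
  unfolding multivectors_def mem_Collect_eq by metis

lemma mv_cong: "T \<in> multivectors A n p \<Longrightarrow> (\<And>i. i < n \<Longrightarrow> \<alpha> i = \<beta> i) \<Longrightarrow> T \<alpha> = T \<beta>"
  unfolding multivectors_def mem_Collect_eq by metis

lemma mv_lin:
  assumes T: "T \<in> multivectors A n p" and "i < n" "\<beta> \<in> cotangent_space A p" "\<gamma> \<in> cotangent_space A p"
  shows "T (\<alpha>(i := (\<lambda>v. a * \<beta> v + b * \<gamma> v))) = a * T (\<alpha>(i := \<beta>)) + b * T (\<alpha>(i := \<gamma>))"
  using conjunct1[OF conjunct2[OF conjunct2[OF T[unfolded multivectors_def mem_Collect_eq]]]] assms(2-4)
  by simp

lemma mv_perm:
  assumes T: "T \<in> multivectors A n p" and "\<sigma> permutes {..<n}"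
  shows "T (\<alpha> \<circ> \<sigma>) = of_int (sign \<sigma>) * T \<alpha>"
  using conjunct2[OF conjunct2[OF conjunct2[OF T[unfolded multivectors_def mem_Collect_eq]]]] assms(2)
  by simp

lemma mv_zero_slot:
  assumes "T \<in> multivectors A n p" "i < n"
  shows "T (\<alpha>(i := (\<lambda>_. 0))) = 0"
  using mv_lin[OF assms cotangent_zero cotangent_zero, of \<alpha> 0 0] by simp

lemma mv_sum:
  assumes T: "T \<in> multivectors A n p" and i: "i < n"
    and \<beta>: "\<And>k. k \<in> K \<Longrightarrow> \<beta> k \<in> cotangent_space A p"
  shows "T (\<alpha>(i := (\<lambda>v. \<Sum>k\<in>K. a k * \<beta> k v))) = (\<Sum>k\<in>K. a k * T (\<alpha>(i := \<beta> k)))"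
  using \<beta>
proof (induction K rule: infinite_finite_induct)
  case (insert k K)
  have "T (\<alpha>(i := (\<lambda>v. a k * \<beta> k v + 1 * (\<Sum>k\<in>K. a k * \<beta> k v)))) =
      a k * T (\<alpha>(i := \<beta> k)) + 1 * T (\<alpha>(i := (\<lambda>v. \<Sum>k\<in>K. a k * \<beta> k v)))"
    by (rule mv_lin[OF T i _ cotangent_sum]) (use insert.prems in auto)
  also have "T (\<alpha>(i := (\<lambda>v. \<Sum>k\<in>K. a k * \<beta> k v))) = (\<Sum>k\<in>K. a k * T (\<alpha>(i := \<beta> k)))"
    by (rule insert.IH) (use insert.prems in auto)
  finally show ?case unfolding sum.insert[OF insert.hyps] mult_1 .
qed (auto simp: mv_zero_slot[OF T i])

end

section \<open>Alternating sums over permutations\<close>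

definition alt_sum :: "nat \<Rightarrow> ((nat \<Rightarrow> nat) \<Rightarrow> real) \<Rightarrow> real" where
  "alt_sum N F = (\<Sum>\<sigma> | \<sigma> permutes {..<N}. of_int (sign \<sigma>) * F \<sigma>)"

text \<open>\<open>shift_perm k \<tau>\<close> lets \<open>\<tau>\<close> act on the numbers from \<open>k\<close> on, and \<open>block_rot k l\<close> exchanges a block of
  length \<open>l\<close> with the block of length \<open>k\<close> that follows it.\<close>

definition shift_perm :: "nat \<Rightarrow> (nat \<Rightarrow> nat) \<Rightarrow> nat \<Rightarrow> nat" where
  "shift_perm k \<tau> i = (if i < k then i else k + \<tau> (i - k))"

definition block_rot :: "nat \<Rightarrow> nat \<Rightarrow> nat \<Rightarrow> nat" where
  "block_rot k l i = (if i < l then i + k else if i < l + k then i - l else i)"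

lemma sign_mult: "\<sigma> permutes {..<N::nat} \<Longrightarrow> \<tau> permutes {..<N} \<Longrightarrow> sign (\<sigma> \<circ> \<tau>) = sign \<sigma> * sign \<tau>"
  by (meson finite_lessThan permutation_permutes sign_compose)

lemma shift_perm_comp: "shift_perm k (\<sigma> \<circ> \<tau>) = shift_perm k \<sigma> \<circ> shift_perm k \<tau>"
  by (auto simp: shift_perm_def)

lemma shift_perm_transpose: "shift_perm k (Transposition.transpose a b) = Transposition.transpose (k + a) (k + b)"
  by (rule ext) (auto simp: shift_perm_def Transposition.transpose_def)

lemma shift_perm_id: "shift_perm k id = id"
  by (rule ext) (auto simp: shift_perm_def)

lemma id_permutes_sign: "id permutes S \<and> sign id = 1"
  using permutes_id sign_id by blast

lemma shift_perm_permutes_sign: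
  assumes "\<tau> permutes {..<l}"
  shows "shift_perm k \<tau> permutes {..<k + l} \<and> sign (shift_perm k \<tau>) = sign \<tau>"
  using assms finite_lessThan
proof (induction rule: permutes_induct)
  case id
  show ?case unfolding shift_perm_id using permutes_id by blast
next
  case (swap a b \<tau>)
  have t: "Transposition.transpose (k + a) (k + b) permutes {..<k + l}" "Transposition.transpose a b permutes {..<l}"
    using swap by (auto intro: permutes_swap_id)
  note IH = conjunct1[OF swap.IH] conjunct2[OF swap.IH]
  have "sign (Transposition.transpose (k + a) (k + b)) = sign (Transposition.transpose a b)"
    by (simp add: sign_swap_id)
  then have "sign (Transposition.transpose (k + a) (k + b) \<circ> shift_perm k \<tau>) = sign (Transposition.transpose a b \<circ> \<tau>)"
    unfolding sign_mult[OF t(1) IH(1)] sign_mult[OF t(2) swap.hyps(4)] IH(2) by simp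
  then show ?case
    unfolding shift_perm_comp shift_perm_transpose by (rule conjI[OF permutes_compose[OF IH(1) t(1)]])
qed

lemmas shift_perm_permutes = conjunct1[OF shift_perm_permutes_sign]
lemmas sign_shift_perm = conjunct2[OF shift_perm_permutes_sign]

text \<open>A rotation is built up by letting the block of length \<open>k\<close> pass the other entries one by one, each of
  which is a sequence of adjacent transpositions. This yields the sign \<open>(-1) ^ (k * l)\<close>.\<close>

lemma block_rot_1_Suc: "block_rot (Suc k) 1 = Transposition.transpose k (Suc k) \<circ> block_rot k 1"
  by (rule ext) (auto simp: block_rot_def Transposition.transpose_def)

lemma block_rot_Suc: "block_rot k (Suc l) = block_rot k l \<circ> shift_perm l (block_rot k 1)"
  by (rule ext) (auto simp: block_rot_def shift_perm_def)

lemma block_rot_1: "block_rot k 1 permutes {..<k + 1} \<and> sign (block_rot k 1) = (-1) ^ k"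
proof (induction k)
  case 0
  have id: "block_rot 0 1 = id" by (rule ext) (auto simp: block_rot_def)
  show ?case unfolding id power_0 by (rule id_permutes_sign)
next
  case (Suc k)
  have t: "Transposition.transpose k (Suc k) permutes {..<Suc k + 1}" by (rule permutes_swap_id) auto
  have r: "block_rot k 1 permutes {..<Suc k + 1}"
    using permutes_subset[OF conjunct1[OF Suc.IH]] by auto
  show ?case
    unfolding block_rot_1_Suc sign_mult[OF t r]
    by (rule conjI[OF permutes_compose[OF r t]]) (use Suc.IH in \<open>simp add: sign_swap_id\<close>)
qed

lemma block_rot: "block_rot k l permutes {..<l + k} \<and> sign (block_rot k l) = (-1) ^ (k * l)"
proof (induction l)
  case 0
  have id: "block_rot k 0 = id" by (rule ext) (auto simp: block_rot_def)
  show ?case unfolding id mult_0_right power_0 by (rule id_permutes_sign)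
next
  case (Suc l)
  have t: "shift_perm l (block_rot k 1) permutes {..<Suc l + k}"
    using shift_perm_permutes[OF conjunct1[OF block_rot_1[of k]], of l] by (simp add: add_ac)
  have r: "block_rot k l permutes {..<Suc l + k}"
    using permutes_subset[OF conjunct1[OF Suc.IH]] by auto
  have "sign (block_rot k (Suc l)) = (-1) ^ (k * l) * (-1) ^ k"
    unfolding block_rot_Suc sign_mult[OF r t]
    using Suc.IH block_rot_1[of k] sign_shift_perm[OF conjunct1[OF block_rot_1]] by simp
  moreover have "block_rot k (Suc l) permutes {..<Suc l + k}"
    unfolding block_rot_Suc by (rule permutes_compose[OF t r])
  ultimately show ?case by (simp add: power_add)
qed

lemmas block_rot_permutes = conjunct1[OF block_rot]
lemmas sign_block_rot = conjunct2[OF block_rot]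

lemma alt_sum_cong:
  assumes "\<And>\<sigma>. \<sigma> permutes {..<N} \<Longrightarrow> F \<sigma> = G \<sigma>"
  shows "alt_sum N F = alt_sum N G"
  unfolding alt_sum_def by (rule sum.cong) (auto simp: assms)

lemma alt_sum_compose:
  assumes \<tau>: "\<tau> permutes {..<N}"
  shows "alt_sum N F = of_int (sign \<tau>) * alt_sum N (\<lambda>\<sigma>. F (\<sigma> \<circ> \<tau>))"
proof -
  have "alt_sum N F = (\<Sum>\<sigma> | \<sigma> permutes {..<N}. of_int (sign (\<sigma> \<circ> \<tau>)) * F (\<sigma> \<circ> \<tau>))"
    unfolding alt_sum_def by (rule sum_permutations_compose_right[OF \<tau>])
  also have "\<dots> = (\<Sum>\<sigma> | \<sigma> permutes {..<N}. of_int (sign \<tau>) * (of_int (sign \<sigma>) * F (\<sigma> \<circ> \<tau>)))"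
    by (rule sum.cong) (auto simp: sign_mult[OF _ \<tau>])
  finally show ?thesis by (simp add: alt_sum_def sum_distrib_left)
qed

lemma alt_sum_sum: "alt_sum N (\<lambda>\<sigma>. \<Sum>i\<in>I. F i \<sigma>) = (\<Sum>i\<in>I. alt_sum N (F i))"
  unfolding alt_sum_def sum_distrib_left by (rule sum.swap)

lemma alt_sum_cmult: "alt_sum N (\<lambda>\<sigma>. k * F \<sigma>) = k * alt_sum N F"
  unfolding alt_sum_def sum_distrib_left by (rule sum.cong) auto

lemma alt_sum_add: "alt_sum N (\<lambda>\<sigma>. F \<sigma> + G \<sigma>) = alt_sum N F + alt_sum N G"
  unfolding alt_sum_def by (simp add: distrib_left sum.distrib)

lemma alt_sum_swap: "alt_sum N (\<lambda>\<sigma>. alt_sum M (F \<sigma>)) = alt_sum M (\<lambda>\<tau>. alt_sum N (\<lambda>\<sigma>. F \<sigma> \<tau>))"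
  unfolding alt_sum_def sum_distrib_left by (subst sum.swap) (simp add: mult_ac)

lemma stabilizer_eq:
  "{\<sigma>. \<sigma> permutes {..<Suc N} \<and> \<sigma> 0 = 0} = shift_perm 1 ` {\<tau>. \<tau> permutes {..<N}}"
proof (rule Set.set_eqI, rule iffI)
  fix \<sigma> assume "\<sigma> \<in> {\<sigma>. \<sigma> permutes {..<Suc N} \<and> \<sigma> 0 = 0}"
  then have \<sigma>: "\<sigma> permutes {..<Suc N}" and 0: "\<sigma> 0 = 0" by auto
  define \<tau> where "\<tau> i = \<sigma> (Suc i) - 1" for i
  have pos: "\<sigma> (Suc i) > 0" for i
    using permutes_inj[OF \<sigma>] 0 by (metis gr0I inj_eq nat.distinct(1))
  have "\<tau> permutes {..<N}"
  proof (rule bij_imp_permutes)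
    have inj: "inj_on \<tau> {..<N}"
    proof (rule inj_onI)
      fix i j assume "\<tau> i = \<tau> j"
      then have "\<sigma> (Suc i) = \<sigma> (Suc j)" using pos[of i] pos[of j] by (simp add: \<tau>_def)
      then show "i = j" using permutes_inj[OF \<sigma>] by (simp add: inj_eq)
    qed
    moreover have "\<tau> ` {..<N} \<subseteq> {..<N}"
    proof
      fix j assume "j \<in> \<tau> ` {..<N}"
      then obtain i where i: "i < N" "j = \<tau> i" by auto
      then have "\<sigma> (Suc i) < Suc N" using permutes_in_image[OF \<sigma>, of "Suc i"] by simp
      then show "j \<in> {..<N}" using pos[of i] i by (simp add: \<tau>_def)
    qed
    ultimately show "bij_betw \<tau> {..<N} {..<N}"
      by (simp add: bij_betw_def endo_inj_surj)
  next
    fix i assume "i \<notin> {..<N}"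
    then show "\<tau> i = i" using permutes_not_in[OF \<sigma>, of "Suc i"] by (simp add: \<tau>_def)
  qed
  moreover have "shift_perm 1 \<tau> = \<sigma>"
  proof
    fix i show "shift_perm 1 \<tau> i = \<sigma> i"
      using pos[of "i - 1"] 0 by (cases i) (auto simp: shift_perm_def \<tau>_def)
  qed
  ultimately show "\<sigma> \<in> shift_perm 1 ` {\<tau>. \<tau> permutes {..<N}}" by blast
next
  fix \<sigma> assume "\<sigma> \<in> shift_perm 1 ` {\<tau>. \<tau> permutes {..<N}}"
  then show "\<sigma> \<in> {\<sigma>. \<sigma> permutes {..<Suc N} \<and> \<sigma> 0 = 0}"
    using shift_perm_permutes[of _ N 1] by (auto simp: shift_perm_def)
qed

lemma inj_shift_perm: "inj (shift_perm k)"
proof (rule injI)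
  fix \<sigma> \<tau> assume eq: "shift_perm k \<sigma> = shift_perm k \<tau>"
  show "\<sigma> = \<tau>"
  proof
    fix i show "\<sigma> i = \<tau> i" using fun_cong[OF eq, of "k + i"] by (simp add: shift_perm_def)
  qed
qed

lemma alt_sum_stabilizer:
  "alt_sum (Suc N) (\<lambda>\<sigma>. if \<sigma> 0 = 0 then F \<sigma> else 0) = alt_sum N (\<lambda>\<tau>. F (shift_perm 1 \<tau>))"
proof -
  have "alt_sum (Suc N) (\<lambda>\<sigma>. if \<sigma> 0 = 0 then F \<sigma> else 0) =
      (\<Sum>\<sigma> | \<sigma> permutes {..<Suc N} \<and> \<sigma> 0 = 0. of_int (sign \<sigma>) * F \<sigma>)"
    unfolding alt_sum_def
    by (rule sum.mono_neutral_cong_right) (auto simp: finite_permutations)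
  also have "\<dots> = (\<Sum>\<tau> | \<tau> permutes {..<N}. of_int (sign (shift_perm 1 \<tau>)) * F (shift_perm 1 \<tau>))"
    unfolding stabilizer_eq by (subst sum.reindex) (auto intro: inj_on_subset[OF inj_shift_perm])
  also have "\<dots> = alt_sum N (\<lambda>\<tau>. F (shift_perm 1 \<tau>))"
    unfolding alt_sum_def by (rule sum.cong) (auto simp: sign_shift_perm)
  finally show ?thesis .
qed

text \<open>Averaging over the stabilizer of \<open>0\<close>: composing with its elements does not change the alternating
  sum up to sign, so it suffices that the sum over each coset vanishes.\<close>

lemma alt_sum_eq_0_if_stabilizer:
  assumes "\<And>\<sigma>. \<sigma> permutes {..<Suc N} \<Longrightarrow> alt_sum N (\<lambda>\<tau>. F (\<sigma> \<circ> shift_perm 1 \<tau>)) = 0"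
  shows "alt_sum (Suc N) F = 0"
proof -
  have 1: "alt_sum (Suc N) F = of_int (sign \<tau>) * alt_sum (Suc N) (\<lambda>\<sigma>. F (\<sigma> \<circ> shift_perm 1 \<tau>))"
    if "\<tau> permutes {..<N}" for \<tau>
    using alt_sum_compose[of "shift_perm 1 \<tau>" "Suc N" F] shift_perm_permutes[OF that, of 1]
      sign_shift_perm[OF that, of 1] by simp
  have "fact N * alt_sum (Suc N) F = (\<Sum>\<tau> | \<tau> permutes {..<N}. alt_sum (Suc N) F)"
    by (simp add: card_permutations)
  also have "\<dots> = alt_sum N (\<lambda>\<tau>. alt_sum (Suc N) (\<lambda>\<sigma>. F (\<sigma> \<circ> shift_perm 1 \<tau>)))"
    unfolding alt_sum_def[of N] using 1 by (intro sum.cong) auto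
  also have "\<dots> = alt_sum (Suc N) (\<lambda>\<sigma>. alt_sum N (\<lambda>\<tau>. F (\<sigma> \<circ> shift_perm 1 \<tau>)))"
    by (rule alt_sum_swap)
  also have "\<dots> = alt_sum (Suc N) (\<lambda>\<sigma>. 0)"
    by (rule alt_sum_cong) (rule assms)
  finally show ?thesis by (simp add: alt_sum_def)
qed

lemma prod_lessThan_skip:
  assumes "i < Suc N"
  shows "(\<Prod>j<Suc N. h j) = h i * (\<Prod>s<N. h (skip i s) :: real)"
proof -
  have inj: "inj_on (skip i) {..<N}" by (auto simp: inj_on_def skip_def split: if_splits)
  have eq: "{..<Suc N} = insert i (skip i ` {..<N})"
  proof (rule Set.set_eqI)
    fix j
    have "j \<in> skip i ` {..<N}" if "j < Suc N" "j \<noteq> i"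
      by (rule image_eqI[of _ _ "if j < i then j else j - 1"]) (use that assms in \<open>auto simp: skip_def\<close>)
    then show "j \<in> {..<Suc N} \<longleftrightarrow> j \<in> insert i (skip i ` {..<N})"
      using assms by (auto simp: skip_def)
  qed
  have "i \<notin> skip i ` {..<N}" by (auto simp: skip_def)
  then show ?thesis unfolding eq using inj by (simp add: prod.reindex)
qed

text \<open>The permutations are sorted by the position \<open>i\<close> that they map to \<open>0\<close>. Rotating this position to the
  front costs the sign \<open>(-1) ^ i\<close> and leaves a permutation that fixes \<open>0\<close>.\<close>

lemma laplace_expansion_first:
  "alt_sum (Suc N) (\<lambda>\<tau>. \<Prod>i<Suc N. a (\<tau> i) i) =
    (\<Sum>i<Suc N. (-1) ^ i * a 0 i * alt_sum N (\<lambda>\<rho>. \<Prod>s<N. a (Suc (\<rho> s)) (skip i s)))"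
proof -
  let ?G = "\<lambda>\<tau>. \<Prod>i<Suc N. a (\<tau> i) i"
  have "alt_sum (Suc N) ?G = alt_sum (Suc N) (\<lambda>\<tau>. \<Sum>i<Suc N. if \<tau> i = 0 then ?G \<tau> else 0)"
  proof (rule alt_sum_cong)
    fix \<tau> assume \<tau>: "\<tau> permutes {..<Suc N}"
    have "\<tau> i = 0 \<longleftrightarrow> i = inv \<tau> 0" for i
      using permutes_inv_eq[OF \<tau>] by metis
    moreover have "inv \<tau> 0 < Suc N" using permutes_in_image[OF permutes_inv[OF \<tau>], of 0] by simp
    ultimately show "?G \<tau> = (\<Sum>i<Suc N. if \<tau> i = 0 then ?G \<tau> else 0)"
      by (simp del: prod.lessThan_Suc sum.lessThan_Suc)
  qed
  also have "\<dots> = (\<Sum>i<Suc N. alt_sum (Suc N) (\<lambda>\<tau>. if \<tau> i = 0 then ?G \<tau> else 0))"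
    by (rule alt_sum_sum)
  also have "\<dots> = (\<Sum>i<Suc N. (-1) ^ i * a 0 i * alt_sum N (\<lambda>\<rho>. \<Prod>s<N. a (Suc (\<rho> s)) (skip i s)))"
  proof (rule sum.cong)
    fix i assume "i \<in> {..<Suc N}"
    then have i: "i < Suc N" by simp
    let ?\<kappa> = "block_rot 1 i"
    have \<kappa>: "?\<kappa> permutes {..<Suc N}"
      using permutes_subset[OF block_rot_permutes[of 1 i]] i by auto
    have \<kappa>i: "?\<kappa> i = 0" and \<kappa>s: "?\<kappa> (skip i s) = Suc s" for s
      by (auto simp: block_rot_def skip_def)
    have "alt_sum (Suc N) (\<lambda>\<tau>. if \<tau> i = 0 then ?G \<tau> else 0) =
        (-1) ^ i * alt_sum (Suc N) (\<lambda>\<sigma>. if \<sigma> 0 = 0 then ?G (\<sigma> \<circ> ?\<kappa>) else 0)"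
      by (subst alt_sum_compose[OF \<kappa>]) (simp add: \<kappa>i[unfolded One_nat_def] sign_block_rot del: prod.lessThan_Suc)
    also have "\<dots> = (-1) ^ i * alt_sum N (\<lambda>\<rho>. ?G (shift_perm 1 \<rho> \<circ> ?\<kappa>))"
      by (simp only: alt_sum_stabilizer)
    also have "\<dots> = (-1) ^ i * alt_sum N (\<lambda>\<rho>. a 0 i * (\<Prod>s<N. a (Suc (\<rho> s)) (skip i s)))"
      by (simp only: prod_lessThan_skip[OF i] comp_apply \<kappa>i \<kappa>s) (simp add: shift_perm_def)
    finally show "alt_sum (Suc N) (\<lambda>\<tau>. if \<tau> i = 0 then ?G \<tau> else 0) =
        (-1) ^ i * a 0 i * alt_sum N (\<lambda>\<rho>. \<Prod>s<N. a (Suc (\<rho> s)) (skip i s))"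
      by (simp add: alt_sum_cmult)
  qed simp
  finally show ?thesis .
qed

text \<open>Each pair of permutations of the two blocks is absorbed into \<open>\<sigma>\<close>, and there are
  \<open>fact k * fact l\<close> such pairs. This is the reason for the normalization of the exterior product.\<close>

lemma alt_sum_block_product:
  "alt_sum (k + l) (\<lambda>\<sigma>. alt_sum k (\<lambda>\<tau>. \<Prod>i<k. f i (\<sigma> (\<tau> i))) * alt_sum l (\<lambda>\<rho>. \<Prod>i<l. g i (\<sigma> (k + \<rho> i)))) =
    fact k * fact l * alt_sum (k + l) (\<lambda>\<sigma>. (\<Prod>i<k. f i (\<sigma> i)) * (\<Prod>i<l. g i (\<sigma> (k + i))))"
proof -
  define H where "H \<sigma> = (\<Prod>i<k. f i (\<sigma> i)) * (\<Prod>i<l. g i (\<sigma> (k + i)))" for \<sigma> :: "nat \<Rightarrow> nat"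
  have H: "alt_sum (k + l) H = of_int (sign \<tau>) * (of_int (sign \<rho>) * alt_sum (k + l) (\<lambda>\<sigma>.
      (\<Prod>i<k. f i (\<sigma> (\<tau> i))) * (\<Prod>i<l. g i (\<sigma> (k + \<rho> i)))))"
    if \<tau>: "\<tau> permutes {..<k}" and \<rho>: "\<rho> permutes {..<l}" for \<tau> \<rho>
  proof -
    have \<tau>': "\<tau> permutes {..<k + l}" using permutes_subset[OF \<tau>] by auto
    note \<rho>' = shift_perm_permutes[OF \<rho>, of k]
    have 1: "(shift_perm k \<rho> \<circ> \<tau>) i = \<tau> i" if "i < k" for i
      using permutes_in_image[OF \<tau>, of i] that by (simp add: shift_perm_def)
    have 2: "(shift_perm k \<rho> \<circ> \<tau>) (k + i) = k + \<rho> i" for i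
      using permutes_not_in[OF \<tau>, of "k + i"] by (simp add: shift_perm_def)
    have "H (\<sigma> \<circ> (shift_perm k \<rho> \<circ> \<tau>)) = (\<Prod>i<k. f i (\<sigma> (\<tau> i))) * (\<Prod>i<l. g i (\<sigma> (k + \<rho> i)))" for \<sigma>
      unfolding H_def by (intro arg_cong2[where f = "(*)"] prod.cong refl) (use 1 2 in auto)
    then show ?thesis
      using alt_sum_compose[OF permutes_compose[OF \<tau>' \<rho>'], of H] sign_shift_perm[OF \<rho>, of k]
      by (simp add: sign_mult[OF \<rho>' \<tau>'])
  qed
  have "fact k * fact l * alt_sum (k + l) H =
      (\<Sum>\<tau> | \<tau> permutes {..<k}. \<Sum>\<rho> | \<rho> permutes {..<l}. alt_sum (k + l) H)"
    by (simp add: card_permutations)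
  also have "\<dots> = alt_sum k (\<lambda>\<tau>. alt_sum l (\<lambda>\<rho>. alt_sum (k + l) (\<lambda>\<sigma>.
      (\<Prod>i<k. f i (\<sigma> (\<tau> i))) * (\<Prod>i<l. g i (\<sigma> (k + \<rho> i))))))"
    unfolding alt_sum_def[of k] alt_sum_def[of l] sum_distrib_left
    by (intro sum.cong) (auto simp: H[symmetric])
  also have "\<dots> = alt_sum (k + l) (\<lambda>\<sigma>. alt_sum k (\<lambda>\<tau>. alt_sum l (\<lambda>\<rho>.
      (\<Prod>i<k. f i (\<sigma> (\<tau> i))) * (\<Prod>i<l. g i (\<sigma> (k + \<rho> i))))))"
    by (simp only: alt_sum_swap[of "k + l" k] alt_sum_swap[of "k + l" l])
  also have "\<dots> = alt_sum (k + l) (\<lambda>\<sigma>. alt_sum k (\<lambda>\<tau>. \<Prod>i<k. f i (\<sigma> (\<tau> i))) *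
      alt_sum l (\<lambda>\<rho>. \<Prod>i<l. g i (\<sigma> (k + \<rho> i))))"
    by (simp only: alt_sum_cmult mult.commute[of "prod _ _" "alt_sum _ _"] mult.commute[of "alt_sum k _" "alt_sum l _"])
  finally show ?thesis unfolding H_def by (rule sym)
qed

section \<open>Exterior products\<close>

lemma wedge_alt_sum:
  "wedge k l S T \<alpha> = alt_sum (k + l) (\<lambda>\<sigma>. S (\<lambda>i. \<alpha> (\<sigma> i)) * T (\<lambda>i. \<alpha> (\<sigma> (k + i)))) / (fact k * fact l)"
  by (simp add: wedge_def alt_sum_def mult.assoc)

lemma wedge_vectors_alt_sum:
  "wedge_vectors A k p X \<alpha> = (if \<forall>i<k. \<alpha> i \<in> cotangent_space A p
     then alt_sum k (\<lambda>\<sigma>. \<Prod>i<k. \<alpha> (\<sigma> i) (X i)) else 0)"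
  unfolding wedge_vectors_def alt_sum_def ..

lemma wedge_vectors_cong:
  "(\<And>i. i < k \<Longrightarrow> X i = Y i) \<Longrightarrow> wedge_vectors A k p X = wedge_vectors A k p Y"
  by (rule ext) (auto simp: wedge_vectors_def intro!: sum.cong prod.cong)

lemma wedge_vectors_permute:
  assumes \<pi>: "\<pi> permutes {..<k}"
  shows "wedge_vectors A k p (X \<circ> \<pi>) \<alpha> = of_int (sign \<pi>) * wedge_vectors A k p X \<alpha>"
proof -
  have "alt_sum k (\<lambda>\<sigma>. \<Prod>i<k. \<alpha> (\<sigma> i) (X (\<pi> i))) =
      of_int (sign \<pi>) * alt_sum k (\<lambda>\<sigma>. \<Prod>i<k. \<alpha> (\<sigma> (\<pi> i)) (X (\<pi> i)))"
    by (subst alt_sum_compose[OF \<pi>]) simp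
  also have "(\<lambda>\<sigma>. \<Prod>i<k. \<alpha> (\<sigma> (\<pi> i)) (X (\<pi> i))) = (\<lambda>\<sigma>. \<Prod>i<k. \<alpha> (\<sigma> i) (X i))"
    using prod.permute[OF \<pi>, of "\<lambda>i. \<alpha> (_ i) (X i)"] by (simp add: comp_def)
  finally show ?thesis by (auto simp: wedge_vectors_alt_sum)
qed

lemma wedge_zero:
  assumes S: "\<And>\<alpha> i. i < k \<Longrightarrow> \<alpha> i \<notin> C \<Longrightarrow> S \<alpha> = 0" and T: "\<And>\<alpha> i. i < l \<Longrightarrow> \<alpha> i \<notin> C \<Longrightarrow> T \<alpha> = 0"
    and i: "i < k + l" "\<alpha> i \<notin> C"
  shows "wedge k l S T \<alpha> = 0"
proof -
  have "S (\<lambda>i. \<alpha> (\<sigma> i)) * T (\<lambda>i. \<alpha> (\<sigma> (k + i))) = 0" if \<sigma>: "\<sigma> permutes {..<k + l}" for \<sigma>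
  proof -
    obtain j where j: "j < k + l" "\<sigma> j = i"
      using permutes_image[OF \<sigma>] i(1) by (metis image_iff lessThan_iff)
    show ?thesis
    proof (cases "j < k")
      case True
      then have "S (\<lambda>i. \<alpha> (\<sigma> i)) = 0" by (rule S) (simp add: j i)
      then show ?thesis by simp
    next
      case False
      have "T (\<lambda>i. \<alpha> (\<sigma> (k + i))) = 0" by (rule T[of "j - k"]) (use False j i in auto)
      then show ?thesis by simp
    qed
  qed
  then have "alt_sum (k + l) (\<lambda>\<sigma>. S (\<lambda>i. \<alpha> (\<sigma> i)) * T (\<lambda>i. \<alpha> (\<sigma> (k + i)))) = alt_sum (k + l) (\<lambda>_. 0)"
    by (rule alt_sum_cong)
  then show ?thesis by (simp add: wedge_alt_sum alt_sum_def)
qed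

lemma wedge_commute:
  assumes S: "\<And>\<alpha> \<beta>. (\<And>i. i < k \<Longrightarrow> \<alpha> i = \<beta> i) \<Longrightarrow> S \<alpha> = S \<beta>"
    and T: "\<And>\<alpha> \<beta>. (\<And>i. i < l \<Longrightarrow> \<alpha> i = \<beta> i) \<Longrightarrow> T \<alpha> = T \<beta>"
  shows "wedge k l S T \<alpha> = (-1) ^ (k * l) * wedge l k T S \<alpha>"
proof -
  let ?\<pi> = "block_rot l k"
  have "S (\<lambda>i. \<alpha> ((\<sigma> \<circ> ?\<pi>) i)) = S (\<lambda>i. \<alpha> (\<sigma> (l + i)))" for \<sigma>
    by (rule S) (simp add: block_rot_def add.commute)
  moreover have "T (\<lambda>i. \<alpha> ((\<sigma> \<circ> ?\<pi>) (k + i))) = T (\<lambda>i. \<alpha> (\<sigma> i))" for \<sigma>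
    by (rule T) (simp add: block_rot_def)
  ultimately have "alt_sum (k + l) (\<lambda>\<sigma>. S (\<lambda>i. \<alpha> (\<sigma> i)) * T (\<lambda>i. \<alpha> (\<sigma> (k + i)))) =
      (-1) ^ (k * l) * alt_sum (l + k) (\<lambda>\<sigma>. T (\<lambda>i. \<alpha> (\<sigma> i)) * S (\<lambda>i. \<alpha> (\<sigma> (l + i))))"
    by (subst alt_sum_compose[OF block_rot_permutes[of l k]]) (simp add: sign_block_rot mult.commute add.commute)
  then show ?thesis by (simp add: wedge_alt_sum mult.commute)
qed

lemma wedge_cong:
  assumes S: "\<And>\<alpha> \<beta>. (\<And>i. i < k \<Longrightarrow> \<alpha> i = \<beta> i) \<Longrightarrow> S \<alpha> = S \<beta>"
    and T: "\<And>\<alpha> \<beta>. (\<And>i. i < l \<Longrightarrow> \<alpha> i = \<beta> i) \<Longrightarrow> T \<alpha> = T \<beta>"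
    and eq: "\<And>i. i < k + l \<Longrightarrow> \<alpha> i = \<beta> i"
  shows "wedge k l S T \<alpha> = wedge k l S T \<beta>"
proof -
  have "S (\<lambda>i. \<alpha> (\<sigma> i)) * T (\<lambda>i. \<alpha> (\<sigma> (k + i))) = S (\<lambda>i. \<beta> (\<sigma> i)) * T (\<lambda>i. \<beta> (\<sigma> (k + i)))"
    if \<sigma>: "\<sigma> permutes {..<k + l}" for \<sigma>
  proof -
    have e: "\<alpha> (\<sigma> i) = \<beta> (\<sigma> i)" if "i < k + l" for i
      using permutes_in_image[OF \<sigma>, of i] that eq by auto
    have "S (\<lambda>i. \<alpha> (\<sigma> i)) = S (\<lambda>i. \<beta> (\<sigma> i))" by (rule S) (simp add: e)
    moreover have "T (\<lambda>i. \<alpha> (\<sigma> (k + i))) = T (\<lambda>i. \<beta> (\<sigma> (k + i)))" by (rule T) (simp add: e)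
    ultimately show ?thesis by simp
  qed
  then have "alt_sum (k + l) (\<lambda>\<sigma>. S (\<lambda>i. \<alpha> (\<sigma> i)) * T (\<lambda>i. \<alpha> (\<sigma> (k + i)))) =
      alt_sum (k + l) (\<lambda>\<sigma>. S (\<lambda>i. \<beta> (\<sigma> i)) * T (\<lambda>i. \<beta> (\<sigma> (k + i))))"
    by (rule alt_sum_cong)
  then show ?thesis unfolding wedge_alt_sum by (rule arg_cong)
qed

lemma wedge_sum_left: "wedge k l (\<lambda>\<beta>. \<Sum>i\<in>I. a i * S i \<beta>) T \<alpha> = (\<Sum>i\<in>I. a i * wedge k l (S i) T \<alpha>)"
  by (simp add: wedge_alt_sum sum_distrib_right alt_sum_sum alt_sum_cmult mult.assoc sum_divide_distrib)

lemma wedge_sum_right: "wedge k l S (\<lambda>\<beta>. \<Sum>i\<in>I. a i * T i \<beta>) \<alpha> = (\<Sum>i\<in>I. a i * wedge k l S (T i) \<alpha>)"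
  by (simp add: wedge_alt_sum sum_distrib_left alt_sum_sum alt_sum_cmult mult.left_commute sum_divide_distrib)

lemma wedge_sum_sum:
  "wedge k l (\<lambda>\<beta>. \<Sum>a\<in>I. r a * S a \<beta>) (\<lambda>\<beta>. \<Sum>b\<in>J. s b * T b \<beta>) \<alpha> =
    (\<Sum>a\<in>I. r a * (\<Sum>b\<in>J. s b * wedge k l (S a) (T b) \<alpha>))"
  by (simp only: wedge_sum_left wedge_sum_right)

lemma wedge_wedge_vectors:
  "wedge k l (wedge_vectors A k p X) (wedge_vectors A l p Y) \<alpha> =
    wedge_vectors A (k + l) p (\<lambda>s. if s < k then X s else Y (s - k)) \<alpha>"
proof (cases "\<forall>i<k + l. \<alpha> i \<in> cotangent_space A p")
  case True
  have split: "(\<Prod>i<k + l. h i) = (\<Prod>i<k. h i) * (\<Prod>i<l. h (k + i))" for h :: "nat \<Rightarrow> real"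
    by (induction l) (simp_all add: mult.assoc)
  have cot: "\<alpha> (\<sigma> i) \<in> cotangent_space A p" if "\<sigma> permutes {..<k + l}" "i < k + l" for \<sigma> i
    using True permutes_in_image[OF that(1), of i] that(2) by auto
  have "alt_sum (k + l) (\<lambda>\<sigma>. wedge_vectors A k p X (\<lambda>i. \<alpha> (\<sigma> i)) * wedge_vectors A l p Y (\<lambda>i. \<alpha> (\<sigma> (k + i)))) =
      alt_sum (k + l) (\<lambda>\<sigma>. alt_sum k (\<lambda>\<tau>. \<Prod>i<k. \<alpha> (\<sigma> (\<tau> i)) (X i)) *
        alt_sum l (\<lambda>\<rho>. \<Prod>i<l. \<alpha> (\<sigma> (k + \<rho> i)) (Y i)))"
    by (rule alt_sum_cong) (simp add: wedge_vectors_alt_sum cot)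
  also have "\<dots> = fact k * fact l * alt_sum (k + l) (\<lambda>\<sigma>. (\<Prod>i<k. \<alpha> (\<sigma> i) (X i)) * (\<Prod>i<l. \<alpha> (\<sigma> (k + i)) (Y i)))"
    by (rule alt_sum_block_product[of k l "\<lambda>i j. \<alpha> j (X i)" "\<lambda>i j. \<alpha> j (Y i)"])
  also have "(\<lambda>\<sigma>. (\<Prod>i<k. \<alpha> (\<sigma> i) (X i)) * (\<Prod>i<l. \<alpha> (\<sigma> (k + i)) (Y i))) =
      (\<lambda>\<sigma>. \<Prod>i<k + l. \<alpha> (\<sigma> i) (if i < k then X i else Y (i - k)))"
    by (simp add: split)
  finally show ?thesis using True by (simp add: wedge_alt_sum wedge_vectors_alt_sum)
next
  case False
  then obtain i where i: "i < k + l" "\<alpha> i \<notin> cotangent_space A p" by blast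
  have "wedge k l (wedge_vectors A k p X) (wedge_vectors A l p Y) \<alpha> = 0"
    by (rule wedge_zero[where C = "cotangent_space A p" and i = i]) (use i in \<open>auto simp: wedge_vectors_alt_sum\<close>)
  then show ?thesis using False by (auto simp: wedge_vectors_alt_sum)
qed

text \<open>Moves the \<open>j\<close>-th factor to the front, which is the form of the terms of the Schouten bracket.\<close>

lemma wedge_vectors_update:
  assumes "j < k"
  shows "wedge_vectors A k p (Y(j := Z)) \<alpha> =
    (-1) ^ j * wedge_vectors A k p (\<lambda>s. if s = 0 then Z else Y (skip j (s - 1))) \<alpha>"
proof -
  have "Y(j := Z) = (\<lambda>s. if s = 0 then Z else Y (skip j (s - 1))) \<circ> block_rot 1 j"
    by (rule ext) (auto simp: block_rot_def skip_def)
  moreover have "block_rot 1 j permutes {..<k}"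
    using permutes_subset[OF block_rot_permutes[of 1 j], of "{..<k}"] assms by auto
  ultimately show ?thesis by (simp add: wedge_vectors_permute sign_block_rot del: fun_upd_apply)
qed

text \<open>The exchange of two blocks of length \<open>n - 1\<close> has the sign of \<open>(n - 1) * (n - 1)\<close>, which has the
  parity of \<open>n - 1\<close>.\<close>

lemma wedge_vectors_swap_blocks:
  assumes "n > 0"
  shows "wedge_vectors A (2 * n - 1) p (\<lambda>s. if s = 0 then Z else if s < n then X (s - 1) else Y (s - n)) \<alpha> =
    (-1) ^ (n - 1) *
    wedge_vectors A (2 * n - 1) p (\<lambda>s. if s = 0 then Z else if s < n then Y (s - 1) else X (s - n)) \<alpha>"
proof -
  let ?\<pi> = "shift_perm 1 (block_rot (n - 1) (n - 1))"
  let ?V = "\<lambda>X Y s. if s = 0 then Z else if s < n then X (s - 1) else Y (s - n)"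
  have "1 + ((n - 1) + (n - 1)) = 2 * n - 1" using assms by simp
  then have \<pi>: "?\<pi> permutes {..<2 * n - 1}"
    using shift_perm_permutes[OF block_rot_permutes[of "n - 1" "n - 1"], of 1] by metis
  have "((-1) ^ ((n - 1) * (n - 1)) :: int) = (-1) ^ (n - 1)" by (simp add: power_mult minus_one_power_iff)
  then have s: "sign ?\<pi> = (-1) ^ (n - 1)"
    by (simp add: sign_shift_perm[OF block_rot_permutes] sign_block_rot)
  have "wedge_vectors A (2 * n - 1) p (?V X Y) = wedge_vectors A (2 * n - 1) p (?V Y X \<circ> ?\<pi>)"
    by (rule wedge_vectors_cong) (use assms in \<open>auto simp: shift_perm_def block_rot_def\<close>)
  then have "wedge_vectors A (2 * n - 1) p (?V X Y) \<alpha> =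
      of_int (sign ?\<pi>) * wedge_vectors A (2 * n - 1) p (?V Y X) \<alpha>"
    by (simp only: wedge_vectors_permute[OF \<pi>])
  then show ?thesis unfolding s by simp
qed

text \<open>The contraction of a determinant with a covector is its Laplace expansion in that covector.\<close>

lemma contract_wedge_vectors:
  assumes "\<beta> \<in> cotangent_space A p"
  shows "contract \<beta> (wedge_vectors A (Suc N) p X) \<alpha> =
    (\<Sum>i<Suc N. (-1) ^ i * \<beta> (X i) * wedge_vectors A N p (\<lambda>s. X (skip i s)) \<alpha>)"
proof (cases "\<forall>i<N. \<alpha> i \<in> cotangent_space A p")
  case True
  then have "\<forall>i<Suc N. case_nat \<beta> \<alpha> i \<in> cotangent_space A p"
    using assms by (auto simp: less_Suc_eq_0_disj)
  then have "contract \<beta> (wedge_vectors A (Suc N) p X) \<alpha> =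
      alt_sum (Suc N) (\<lambda>\<tau>. \<Prod>i<Suc N. case_nat \<beta> \<alpha> (\<tau> i) (X i))"
    by (simp add: contract_def wedge_vectors_alt_sum del: prod.lessThan_Suc)
  also have "\<dots> = (\<Sum>i<Suc N. (-1) ^ i * \<beta> (X i) * wedge_vectors A N p (\<lambda>s. X (skip i s)) \<alpha>)"
    unfolding laplace_expansion_first[of N "\<lambda>j i. case_nat \<beta> \<alpha> j (X i)"]
    using True by (simp add: wedge_vectors_alt_sum del: sum.lessThan_Suc)
  finally show ?thesis .
next
  case False
  then have "\<not> (\<forall>i<Suc N. case_nat \<beta> \<alpha> i \<in> cotangent_space A p)" by force
  then show ?thesis using False
    by (simp only: contract_def wedge_vectors_alt_sum if_False) simp
qed

lemma wedge_vectors_first_linear: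
  assumes lin: "\<And>k. k < M \<Longrightarrow> \<alpha> k Z = (\<Sum>u\<in>U. a u * \<alpha> k (V u) - b u * \<alpha> k (V' u))" and M: "M > 0"
  shows "wedge_vectors A M p (\<lambda>s. if s = 0 then Z else F s) \<alpha> =
    (\<Sum>u\<in>U. a u * wedge_vectors A M p (\<lambda>s. if s = 0 then V u else F s) \<alpha> -
      b u * wedge_vectors A M p (\<lambda>s. if s = 0 then V' u else F s) \<alpha>)"
proof (cases "\<forall>i<M. \<alpha> i \<in> cotangent_space A p")
  case True
  obtain m where m: "M = Suc m" using M by (cases M) auto
  have split: "(\<Prod>i<M. \<alpha> (\<sigma> i) (if i = 0 then Y else F i)) = \<alpha> (\<sigma> 0) Y * (\<Prod>i<m. \<alpha> (\<sigma> (Suc i)) (F (Suc i)))"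
    for \<sigma> Y unfolding m by (subst prod.lessThan_Suc_shift) simp
  let ?R = "\<lambda>\<sigma>. \<Prod>i<m. \<alpha> (\<sigma> (Suc i)) (F (Suc i))"
  have "alt_sum M (\<lambda>\<sigma>. \<alpha> (\<sigma> 0) Z * ?R \<sigma>) =
      alt_sum M (\<lambda>\<sigma>. \<Sum>u\<in>U. a u * (\<alpha> (\<sigma> 0) (V u) * ?R \<sigma>) + (- b u) * (\<alpha> (\<sigma> 0) (V' u) * ?R \<sigma>))"
  proof (rule alt_sum_cong)
    fix \<sigma> assume "\<sigma> permutes {..<M}"
    then have "\<sigma> 0 < M" using permutes_in_image[of \<sigma> "{..<M}" 0] M by simp
    then show "\<alpha> (\<sigma> 0) Z * ?R \<sigma> =
        (\<Sum>u\<in>U. a u * (\<alpha> (\<sigma> 0) (V u) * ?R \<sigma>) + (- b u) * (\<alpha> (\<sigma> 0) (V' u) * ?R \<sigma>))"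
      by (simp add: lin sum_distrib_right left_diff_distrib mult.assoc)
  qed
  also have "\<dots> = (\<Sum>u\<in>U. a u * alt_sum M (\<lambda>\<sigma>. \<alpha> (\<sigma> 0) (V u) * ?R \<sigma>) -
      b u * alt_sum M (\<lambda>\<sigma>. \<alpha> (\<sigma> 0) (V' u) * ?R \<sigma>))"
    by (simp only: alt_sum_sum alt_sum_add alt_sum_cmult) simp
  finally show ?thesis unfolding wedge_vectors_alt_sum if_P[OF True] split .
next
  case False
  then show ?thesis unfolding wedge_vectors_alt_sum if_not_P[OF False] by simp
qed

section \<open>The Lie derivative along a coordinate field\<close>

locale multivector_chart = manifold_chart A c
  for A :: "('a::{t2_space, second_countable_topology}, 'm::finite) chart set" and c +
  fixes n :: nat and P :: "'a \<Rightarrow> 'a multivector"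
  assumes P: "multivector_field A n P"
begin

lemma P_mv: "P q \<in> multivectors A n q"
  using P unfolding multivector_field_def by blast

lemma bracket_smooth:
  "open V \<Longrightarrow> (\<And>i. i < n \<Longrightarrow> smooth_fun_on A V (f i)) \<Longrightarrow> smooth_fun_on A V (nary_bracket A P f)"
  using P unfolding multivector_field_def nary_bracket_def by blast

lemma bracket_smooth_near:
  assumes "\<And>i. i < n \<Longrightarrow> smooth_fun_near A p (f i)"
  shows "smooth_fun_near A p (nary_bracket A P f)"
proof -
  obtain W where W: "open W" "p \<in> W" "\<And>i. i \<in> {..<n} \<Longrightarrow> smooth_fun_on A W (f i)"
    using smooth_fun_near_common[of "{..<n}" p f] assms by auto
  show ?thesis by (rule smooth_fun_nearI[OF W(1,2) bracket_smooth[OF W(1)]]) (use W(3) in auto)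
qed

lemma bracket_cong:
  "(\<And>i. i < n \<Longrightarrow> f i = g i) \<Longrightarrow> nary_bracket A P f = nary_bracket A P g"
  unfolding nary_bracket_def by (rule ext, rule mv_cong[OF P_mv]) simp

lemma differential_upd:
  "(\<lambda>j. differential A ((f(i := g)) j) q) = (\<lambda>j. differential A (f j) q)(i := differential A g q)"
  by auto

lemma differential_comb:
  assumes "q \<in> fst c" "smooth_fun_near A q g" "smooth_fun_near A q h"
  shows "differential A (\<lambda>q. a * g q + b * h q) q =
    (\<lambda>v. a * differential A g q v + b * differential A h q v)"
proof (rule cotangent_eqI[OF assms(1)])
  fix u
  have "pd u q (\<lambda>q. a * g q + b * h q) = a * pd u q g + b * pd u q h"
    using assms by (simp add: pd_add pd_cmult smooth_fun_near_mult smooth_fun_near_const)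
  then show "differential A (\<lambda>q. a * g q + b * h q) q (pd u q) =
      a * differential A g q (pd u q) + b * differential A h q (pd u q)"
    using assms(1) by simp
qed (auto intro: differential_cotangent cotangent_comb assms(1))

lemma bracket_comb:
  assumes "q \<in> fst c" "i < n" "smooth_fun_near A q g" "smooth_fun_near A q h"
  shows "nary_bracket A P (f(i := (\<lambda>q. a * g q + b * h q))) q =
    a * nary_bracket A P (f(i := g)) q + b * nary_bracket A P (f(i := h)) q"
  unfolding nary_bracket_def differential_upd differential_comb[OF assms(1,3,4)]
  by (rule mv_lin[OF P_mv assms(2)]) (auto intro: differential_cotangent assms(1))

text \<open>Applied at all \<open>q\<close> near \<open>p\<close>, this exhibits the dependence of the bracket on first derivatives of
  \<open>f i\<close> as a product that can be differentiated.\<close>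

lemma bracket_expand:
  assumes "q \<in> fst c" "i < n"
  shows "nary_bracket A P f q = (\<Sum>v\<in>UNIV. pd v q (f i) * nary_bracket A P (f(i := x v)) q)"
proof -
  have "nary_bracket A P f q = P q ((\<lambda>j. differential A (f j) q)(i := (\<lambda>w. \<Sum>v\<in>UNIV. pd v q (f i) * dx v q w)))"
    unfolding nary_bracket_def differential_rep[OF assms(1), of "f i", symmetric] by (simp add: fun_upd_idem)
  then show ?thesis
    unfolding nary_bracket_def differential_upd
    by (simp only: mv_sum[OF P_mv assms(2) differential_cotangent[OF assms(1)]])
qed

text \<open>The right-hand side of the Leibniz rule that characterizes the Lie derivative. That it comes from a
  multivector means that it depends on the functions through their differentials at \<open>p\<close> only.\<close>

definition lie_form :: "'a \<Rightarrow> 'm \<Rightarrow> (nat \<Rightarrow> 'a \<Rightarrow> real) \<Rightarrow> real" where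
  "lie_form p u f = pd u p (nary_bracket A P f) -
    (\<Sum>i<n. P p ((\<lambda>j. differential A (f j) p)(i := differential A (\<lambda>q. pd u q (f i)) p)))"

text \<open>The tensoriality of the Lie derivative: if \<open>df\<^sub>i\<close> vanishes at \<open>p\<close>, then differentiating the bracket
  only sees the second derivatives of \<open>f\<^sub>i\<close>, and these are exactly what the \<open>i\<close>-th correction term
  removes. The other correction terms contain \<open>df\<^sub>i\<close>. The symmetry of second derivatives is used in
  this step.\<close>

lemma lie_form_zero:
  assumes p: "p \<in> fst c" and f: "\<And>j. j < n \<Longrightarrow> smooth_fun_near A p (f j)"
    and i: "i < n" and 0: "\<And>v. pd v p (f i) = 0"
  shows "lie_form p u f = 0"
proof -
  let ?d = "\<lambda>j. differential A (f j) p"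
  let ?B = "\<lambda>v. nary_bracket A P (f(i := x v))"
  have B: "smooth_fun_near A p (?B v)" for v
    by (rule bracket_smooth_near) (use f x_smooth_near[OF p] in auto)
  have di: "?d i = (\<lambda>_. 0)" by (rule differential_zero[OF p 0])
  have "pd u p (nary_bracket A P f) = pd u p (\<lambda>q. \<Sum>v\<in>UNIV. pd v q (f i) * ?B v q)"
    by (rule pd_cong[OF c_open p _ p]) (rule bracket_expand[OF _ i])
  also have "\<dots> = (\<Sum>v\<in>UNIV. pd u p (\<lambda>q. pd v q (f i)) * ?B v p)"
    using B pd_smooth_near[OF f[OF i] p]
    by (subst pd_sum) (auto simp: p pd_mult 0 smooth_fun_near_mult)
  also have "\<dots> = (\<Sum>v\<in>UNIV. pd v p (\<lambda>q. pd u q (f i)) * P p (?d(i := dx v p)))"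
    unfolding nary_bracket_def differential_upd by (simp only: pd_commute[OF f[OF i] p])
  also have "\<dots> = P p (?d(i := differential A (\<lambda>q. pd u q (f i)) p))"
    by (simp only: differential_rep[OF p, of "\<lambda>q. pd u q (f i)"]
        mv_sum[OF P_mv i differential_cotangent[OF p]])
  finally have 1: "pd u p (nary_bracket A P f) = P p (?d(i := differential A (\<lambda>q. pd u q (f i)) p))" .
  have "P p (?d(k := differential A (\<lambda>q. pd u q (f k)) p)) = 0" if "k < n" "k \<noteq> i" for k
  proof -
    have "?d(k := differential A (\<lambda>q. pd u q (f k)) p) =
        (?d(k := differential A (\<lambda>q. pd u q (f k)) p))(i := (\<lambda>_. 0))"
      using that(2) di by (auto simp: fun_eq_iff)
    then show ?thesis using mv_zero_slot[OF P_mv i] by metis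
  qed
  then have "(\<Sum>k<n. P p (?d(k := differential A (\<lambda>q. pd u q (f k)) p))) =
      (\<Sum>k<n. if k = i then P p (?d(i := differential A (\<lambda>q. pd u q (f i)) p)) else 0)"
    by (intro sum.cong) auto
  then show ?thesis using 1 i unfolding lie_form_def by simp
qed

lemma lie_form_diff:
  assumes p: "p \<in> fst c" and f: "\<And>j. j < n \<Longrightarrow> smooth_fun_near A p (f j)"
    and i: "i < n" and g: "smooth_fun_near A p g" and h: "smooth_fun_near A p h"
  shows "lie_form p u (f(i := (\<lambda>q. 1 * g q + (-1) * h q))) =
    lie_form p u (f(i := g)) - lie_form p u (f(i := h))"
proof -
  let ?gh = "\<lambda>q. 1 * g q + (-1) * h q"
  obtain W where W: "open W" "p \<in> W" "W \<subseteq> fst c" "smooth_fun_on A W g" "smooth_fun_on A W h"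
  proof -
    obtain V where V: "open V" "p \<in> V" "V \<subseteq> fst c" "smooth_fun_on A V g" using smooth_fun_near_local[OF g p] by metis
    obtain V' where V': "open V'" "p \<in> V'" "smooth_fun_on A V' h" using h unfolding smooth_fun_near_def by metis
    show ?thesis
      by (rule that[of "V \<inter> V'"]) (use V V' smooth_fun_on_subset in \<open>auto\<close>)
  qed
  have gq: "smooth_fun_near A q g" and hq: "smooth_fun_near A q h" if "q \<in> W" for q
    using smooth_fun_nearI[OF W(1) that] W(4,5) by auto
  have "pd u p (nary_bracket A P (f(i := ?gh))) =
      pd u p (\<lambda>q. 1 * nary_bracket A P (f(i := g)) q + (-1) * nary_bracket A P (f(i := h)) q)"
    by (rule pd_cong[OF W(1,2) _ p], rule bracket_comb[OF _ i]) (use W(3) gq hq in auto)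
  also have "\<dots> = pd u p (nary_bracket A P (f(i := g))) - pd u p (nary_bracket A P (f(i := h)))"
    using pd_diff[OF bracket_smooth_near bracket_smooth_near p, of "f(i := g)" "f(i := h)" u] f g h by simp
  finally have 1: "pd u p (nary_bracket A P (f(i := ?gh))) =
      pd u p (nary_bracket A P (f(i := g))) - pd u p (nary_bracket A P (f(i := h)))" .
  let ?d = "\<lambda>j. differential A (f j) p"
  let ?t = "\<lambda>g k. P p ((\<lambda>j. differential A ((f(i := g)) j) p)
      (k := differential A (\<lambda>q. pd u q ((f(i := g)) k)) p))"
  have 2: "?t ?gh k = ?t g k - ?t h k" if "k < n" for k
  proof (cases "k = i")
    case True
    have "differential A (\<lambda>q. pd u q ?gh) p = differential A (\<lambda>q. 1 * pd u q g + (-1) * pd u q h) p"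
    proof (rule differential_cong[OF W(1,2) _ p])
      fix q assume q: "q \<in> W"
      then show "pd u q ?gh = 1 * pd u q g + (-1) * pd u q h"
        using pd_diff[OF gq[OF q] hq[OF q], of u] W(3) by auto
    qed
    also have "\<dots> = (\<lambda>v. 1 * differential A (\<lambda>q. pd u q g) p v + (-1) * differential A (\<lambda>q. pd u q h) p v)"
      by (rule differential_comb[OF p pd_smooth_near[OF g p] pd_smooth_near[OF h p]])
    finally have "?t ?gh k = P p (?d(i := (\<lambda>v. 1 * differential A (\<lambda>q. pd u q g) p v +
        (-1) * differential A (\<lambda>q. pd u q h) p v)))"
      using True unfolding differential_upd by simp
    also have "\<dots> = 1 * P p (?d(i := differential A (\<lambda>q. pd u q g) p)) +
        (-1) * P p (?d(i := differential A (\<lambda>q. pd u q h) p))"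
      by (rule mv_lin[OF P_mv i]) (rule differential_cotangent[OF p])+
    finally show ?thesis using True unfolding differential_upd by simp
  next
    case False
    let ?e = "?d(k := differential A (\<lambda>q. pd u q (f k)) p)"
    have t: "?t g k = P p (?e(i := differential A g p))" for g
      using False unfolding differential_upd by (simp add: fun_upd_twist)
    have "?t ?gh k = 1 * P p (?e(i := differential A g p)) + (-1) * P p (?e(i := differential A h p))"
      unfolding t differential_comb[OF p g h]
      by (rule mv_lin[OF P_mv i]) (rule differential_cotangent[OF p])+
    then show ?thesis unfolding t by simp
  qed
  show ?thesis unfolding lie_form_def 1
    using 2 by (simp add: sum_subtractf del: fun_upd_apply)
qed

lemma lie_form_replace:
  assumes p: "p \<in> fst c" and f: "\<And>j. j < n \<Longrightarrow> smooth_fun_near A p (f j)"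
    and i: "i < n" and g: "smooth_fun_near A p g" and eq: "differential A g p = differential A (f i) p"
  shows "lie_form p u (f(i := g)) = lie_form p u f"
proof -
  have pd: "pd v p g = pd v p (f i)" for v
    using fun_cong[OF eq, of "pd v p"] p by simp
  have "lie_form p u (f(i := (\<lambda>q. 1 * g q + (-1) * f i q))) = 0"
  proof (rule lie_form_zero[OF p _ i])
    show "smooth_fun_near A p ((f(i := (\<lambda>q. 1 * g q + (-1) * f i q))) j)" if "j < n" for j
      using f that smooth_fun_near_diff[OF g f[OF i]] by simp
    show "pd v p ((f(i := (\<lambda>q. 1 * g q + (-1) * f i q))) i) = 0" for v
      using pd_diff[OF g f[OF i] p, of v] pd by simp
  qed
  moreover have "lie_form p u (f(i := (\<lambda>q. 1 * g q + (-1) * f i q))) =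
      lie_form p u (f(i := g)) - lie_form p u (f(i := f i))"
    by (rule lie_form_diff[OF p f i g f[OF i]])
  ultimately show ?thesis by (simp only: fun_upd_triv)
qed

lemma lie_form_cong:
  assumes "\<And>i. i < n \<Longrightarrow> f i = g i"
  shows "lie_form p u f = lie_form p u g"
proof -
  have b: "nary_bracket A P f = nary_bracket A P g" by (rule bracket_cong) (rule assms)
  show ?thesis
    unfolding lie_form_def b
    by (intro arg_cong2[where f = "(-)"] refl sum.cong mv_cong[OF P_mv]) (auto simp: assms)
qed

text \<open>Replacing the functions one by one by linear functions with the same differential at \<open>p\<close>.\<close>

lemma lie_form_lin:
  assumes p: "p \<in> fst c" and f: "\<And>j. j < n \<Longrightarrow> smooth_fun_near A p (f j)"
  shows "lie_form p u f = lie_form p u (\<lambda>i. lin p (differential A (f i) p))"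
proof -
  let ?l = "\<lambda>i. lin p (differential A (f i) p)"
  have "lie_form p u f = lie_form p u (\<lambda>j. if j < m then ?l j else f j)" if "m \<le> n" for m
    using that
  proof (induction m)
    case (Suc m)
    let ?f = "\<lambda>j. if j < m then ?l j else f j"
    have "lie_form p u (?f(m := ?l m)) = lie_form p u ?f"
      by (rule lie_form_replace[OF p])
        (use Suc.prems f p in \<open>auto intro: lin_smooth_near simp: differential_lin differential_cotangent\<close>)
    moreover have "?f(m := ?l m) = (\<lambda>j. if j < Suc m then ?l j else f j)" by auto
    ultimately show ?case using Suc by simp
  qed simp
  from this[of n] show ?thesis by (simp cong: lie_form_cong)
qed

text \<open>For functions with constant partial derivatives all correction terms vanish; this makes the Lie
  derivative along a coordinate field the derivative of the components of \<open>P\<close>.\<close>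

lemma lie_form_of_lin:
  assumes p: "p \<in> fst c"
  shows "lie_form p u (\<lambda>i. lin p (\<alpha> i)) = pd u p (nary_bracket A P (\<lambda>i. lin p (\<alpha> i)))"
proof -
  have "differential A (\<lambda>q. pd u q (lin p (\<alpha> i))) p = (\<lambda>_. 0)" for i
    by (rule differential_zero[OF p]) (rule pd_pd_lin[OF p])
  then show ?thesis unfolding lie_form_def by (simp add: mv_zero_slot[OF P_mv] del: fun_upd_apply)
qed

text \<open>An explicit form of the Lie derivative, which the definite description selects
  (\<open>lie_derivative_eq\<close>).\<close>

definition lie_tensor :: "'a \<Rightarrow> 'm \<Rightarrow> 'a multivector" where
  "lie_tensor p u \<alpha> = (if \<forall>i<n. \<alpha> i \<in> cotangent_space A p
     then pd u p (nary_bracket A P (\<lambda>i. lin p (\<alpha> i))) else 0)"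

lemma lie_tensor_differential:
  assumes p: "p \<in> fst c" and f: "\<And>j. j < n \<Longrightarrow> smooth_fun_near A p (f j)"
  shows "lie_tensor p u (\<lambda>i. differential A (f i) p) = lie_form p u f"
  using lie_form_lin[OF assms] by (simp add: lie_tensor_def differential_cotangent[OF p] lie_form_of_lin[OF p])

lemma lie_tensor_multivector:
  assumes p: "p \<in> fst c"
  shows "lie_tensor p u \<in> multivectors A n p"
  unfolding multivectors_def mem_Collect_eq
proof (intro conjI allI impI ballI)
  fix \<alpha> :: "nat \<Rightarrow> 'a cotangent" assume "\<exists>i<n. \<alpha> i \<notin> cotangent_space A p"
  then show "lie_tensor p u \<alpha> = 0" by (auto simp: lie_tensor_def)
next
  fix \<alpha> \<beta> :: "nat \<Rightarrow> 'a cotangent" assume eq: "\<forall>i<n. \<alpha> i = \<beta> i"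
  then have "nary_bracket A P (\<lambda>i. lin p (\<alpha> i)) = nary_bracket A P (\<lambda>i. lin p (\<beta> i))"
    by (intro bracket_cong) simp
  then show "lie_tensor p u \<alpha> = lie_tensor p u \<beta>" using eq by (auto simp: lie_tensor_def)
next
  fix \<alpha> :: "nat \<Rightarrow> 'a cotangent" and i \<beta> \<gamma> a b
  assume i: "i < n" and \<beta>: "\<beta> \<in> cotangent_space A p" and \<gamma>: "\<gamma> \<in> cotangent_space A p"
  let ?l = "\<lambda>j. lin p (\<alpha> j)"
  have upd: "(\<lambda>j. lin p ((\<alpha>(i := \<delta>)) j)) = ?l(i := lin p \<delta>)" for \<delta> by auto
  have cond: "(\<forall>j<n. (\<alpha>(i := \<delta>)) j \<in> cotangent_space A p) \<longleftrightarrow> (\<forall>j<n. j \<noteq> i \<longrightarrow> \<alpha> j \<in> cotangent_space A p)"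
    if "\<delta> \<in> cotangent_space A p" for \<delta> using that i by auto
  have "pd u p (nary_bracket A P (?l(i := (\<lambda>q. a * lin p \<beta> q + b * lin p \<gamma> q)))) =
      pd u p (\<lambda>q. a * nary_bracket A P (?l(i := lin p \<beta>)) q + b * nary_bracket A P (?l(i := lin p \<gamma>)) q)"
    by (rule pd_cong[OF c_open p _ p], rule bracket_comb[OF _ i]) (auto intro: lin_smooth_near)
  also have "\<dots> = a * pd u p (nary_bracket A P (?l(i := lin p \<beta>))) + b * pd u p (nary_bracket A P (?l(i := lin p \<gamma>)))"
  proof -
    have s: "smooth_fun_near A p (nary_bracket A P (?l(i := lin p \<delta>)))" for \<delta>
      by (rule bracket_smooth_near) (auto intro: lin_smooth_near[OF p])
    show ?thesis by (simp only: pd_add[OF smooth_fun_near_mult[OF smooth_fun_near_const s]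
            smooth_fun_near_mult[OF smooth_fun_near_const s] p] pd_cmult[OF s p])
  qed
  finally have eq: "pd u p (nary_bracket A P (?l(i := (\<lambda>q. a * lin p \<beta> q + b * lin p \<gamma> q)))) =
      a * pd u p (nary_bracket A P (?l(i := lin p \<beta>))) + b * pd u p (nary_bracket A P (?l(i := lin p \<gamma>)))" .
  have if_lin: "(if Q then a * y + b * z else 0) = a * (if Q then y else 0) + b * (if Q then z else 0)"
    for Q and y z :: real by simp
  show "lie_tensor p u (\<alpha>(i := (\<lambda>v. a * \<beta> v + b * \<gamma> v))) =
      a * lie_tensor p u (\<alpha>(i := \<beta>)) + b * lie_tensor p u (\<alpha>(i := \<gamma>))"
    unfolding lie_tensor_def upd cond[OF \<beta>] cond[OF \<gamma>] cond[OF cotangent_comb[OF \<beta> \<gamma>]] lin_comb eq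
    by (rule if_lin)
next
  fix \<alpha> :: "nat \<Rightarrow> 'a cotangent" and \<sigma> assume \<sigma>: "\<sigma> permutes {..<n}"
  have cond: "(\<forall>i<n. (\<alpha> \<circ> \<sigma>) i \<in> cotangent_space A p) \<longleftrightarrow> (\<forall>i<n. \<alpha> i \<in> cotangent_space A p)"
    using permutes_image[OF \<sigma>] by (metis comp_apply image_iff lessThan_iff)
  have s: "smooth_fun_near A p (nary_bracket A P (\<lambda>i. lin p (\<alpha> i)))"
    by (rule bracket_smooth_near) (rule lin_smooth_near[OF p])
  have "nary_bracket A P (\<lambda>i. lin p ((\<alpha> \<circ> \<sigma>) i)) =
      (\<lambda>q. of_int (sign \<sigma>) * nary_bracket A P (\<lambda>i. lin p (\<alpha> i)) q)"
    unfolding nary_bracket_def using mv_perm[OF P_mv \<sigma>, of _ "\<lambda>i. differential A (lin p (\<alpha> i)) _"]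
    by (simp add: comp_def)
  then show "lie_tensor p u (\<alpha> \<circ> \<sigma>) = of_int (sign \<sigma>) * lie_tensor p u \<alpha>"
    unfolding lie_tensor_def cond by (auto simp: pd_cmult[OF s p])
qed

lemma lie_derivative_eq:
  assumes p: "p \<in> fst c"
  shows "lie_derivative A n (pd u) P p = lie_tensor p u"
  unfolding lie_derivative_def
proof (rule the_equality)
  show "lie_tensor p u \<in> multivectors A n p \<and> (\<forall>f. (\<forall>i<n. smooth_fun_near A p (f i)) \<longrightarrow>
      lie_tensor p u (\<lambda>i. differential A (f i) p) =
        pd u p (\<lambda>q. P q (\<lambda>i. differential A (f i) q))
        - (\<Sum>i<n. P p ((\<lambda>j. differential A (f j) p)(i := differential A (\<lambda>q. pd u q (f i)) p))))"
    using lie_tensor_multivector[OF p] lie_tensor_differential[OF p]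
    by (simp add: lie_form_def nary_bracket_def)
next
  fix T
  assume T: "T \<in> multivectors A n p \<and> (\<forall>f. (\<forall>i<n. smooth_fun_near A p (f i)) \<longrightarrow>
      T (\<lambda>i. differential A (f i) p) =
        pd u p (\<lambda>q. P q (\<lambda>i. differential A (f i) q))
        - (\<Sum>i<n. P p ((\<lambda>j. differential A (f j) p)(i := differential A (\<lambda>q. pd u q (f i)) p))))"
  show "T = lie_tensor p u"
  proof
    fix \<alpha>
    show "T \<alpha> = lie_tensor p u \<alpha>"
    proof (cases "\<forall>i<n. \<alpha> i \<in> cotangent_space A p")
      case True
      let ?f = "\<lambda>i. lin p (\<alpha> i)"
      have "T \<alpha> = T (\<lambda>i. differential A (?f i) p)"
        by (rule mv_cong[OF conjunct1[OF T]]) (use True in \<open>simp add: differential_lin[OF p]\<close>)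
      also have "\<dots> = lie_form p u ?f"
        unfolding lie_form_def nary_bracket_def
        by (rule conjunct2[OF T, rule_format]) (rule lin_smooth_near[OF p])
      also have "\<dots> = lie_tensor p u \<alpha>" using True by (simp add: lie_tensor_def lie_form_of_lin[OF p])
      finally show ?thesis .
    next
      case False
      then show ?thesis using mv_zero[OF conjunct1[OF T]] by (auto simp: lie_tensor_def)
    qed
  qed
qed

section \<open>The generalized Jacobi sum in coordinates\<close>

abbreviation "L p u \<equiv> lie_derivative A n (pd u) P p"
abbreviation "I p u \<equiv> contract (dx u p) (P p)"

lemma L_multivector: "p \<in> fst c \<Longrightarrow> L p u \<in> multivectors A n p"
  by (simp add: lie_derivative_eq lie_tensor_multivector)

lemma pd_bracket:
  assumes p: "p \<in> fst c" and f: "\<And>j. j < n \<Longrightarrow> smooth_fun_near A p (f j)"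
  shows "pd u p (nary_bracket A P f) = L p u (\<lambda>i. differential A (f i) p) +
    (\<Sum>i<n. P p ((\<lambda>j. differential A (f j) p)(i := differential A (\<lambda>q. pd u q (f i)) p)))"
proof -
  have "lie_tensor p u (\<lambda>i. differential A (f i) p) = lie_form p u f"
    by (rule lie_tensor_differential[OF p f])
  then show ?thesis by (simp only: lie_derivative_eq[OF p] lie_form_def diff_add_cancel)
qed

lemma contract_cong:
  assumes "\<And>i. i < n - 1 \<Longrightarrow> \<beta> i = \<gamma> i"
  shows "contract \<alpha> (P p) \<beta> = contract \<alpha> (P p) \<gamma>"
  unfolding contract_def by (rule mv_cong[OF P_mv]) (use assms in \<open>auto split: nat.split\<close>)

lemma contract_zero:
  assumes "i < n - 1" "\<beta> i \<notin> cotangent_space A p"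
  shows "contract \<alpha> (P p) \<beta> = 0"
  unfolding contract_def by (rule mv_zero[OF P_mv, of "Suc i"]) (use assms in auto)

lemma contract_rep:
  assumes p: "p \<in> fst c" and n: "n > 0" and \<alpha>: "\<alpha> \<in> cotangent_space A p"
  shows "contract \<alpha> (P p) = (\<lambda>\<beta>. \<Sum>u\<in>UNIV. \<alpha> (pd u p) * I p u \<beta>)"
proof
  fix \<beta>
  have upd: "case_nat \<gamma> \<beta> = (case_nat \<alpha> \<beta>)(0 := \<gamma>)" for \<gamma> by (auto split: nat.split)
  have "contract \<alpha> (P p) \<beta> = P p ((case_nat \<alpha> \<beta>)(0 := (\<lambda>v. \<Sum>u\<in>UNIV. \<alpha> (pd u p) * dx u p v)))"
    unfolding contract_def cotangent_rep[OF p \<alpha>, symmetric] by (simp add: fun_upd_idem)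
  also have "\<dots> = (\<Sum>u\<in>UNIV. \<alpha> (pd u p) * P p ((case_nat \<alpha> \<beta>)(0 := dx u p)))"
    by (rule mv_sum[OF P_mv n differential_cotangent[OF p]])
  finally show "contract \<alpha> (P p) \<beta> = (\<Sum>u\<in>UNIV. \<alpha> (pd u p) * I p u \<beta>)"
    unfolding contract_def upd[symmetric] .
qed

text \<open>The part of the Jacobi sum that contains second derivatives, divided by \<open>n\<close>.\<close>

definition hessian_sum :: "'a \<Rightarrow> (nat \<Rightarrow> 'a \<Rightarrow> real) \<Rightarrow> real" where
  "hessian_sum p f = (\<Sum>u\<in>UNIV. \<Sum>v\<in>UNIV. alt_sum (2 * n - 1) (\<lambda>\<sigma>.
     pd v p (\<lambda>q. pd u q (f (\<sigma> 0))) *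
     (I p v (\<lambda>j. differential A (f (\<sigma> (Suc j))) p) * I p u (\<lambda>j. differential A (f (\<sigma> (n + j))) p))))"

text \<open>The \<open>2 n - 1\<close>-vector \<open>(\<Sum>u. i\<^sub>u P \<and> L\<^sub>u P)\<close>, which is the left-hand side of the second condition for
  odd \<open>n\<close> and \<open>-1/2\<close> times the Schouten bracket \<open>[P, P]\<close> for even \<open>n\<close>.\<close>

definition structure_form :: "'a \<Rightarrow> 'a multivector" where
  "structure_form p \<gamma> = (\<Sum>u\<in>UNIV. wedge (n - 1) n (I p u) (L p u) \<gamma>)"

lemma structure_form_eq:
  assumes p: "p \<in> fst c" and n: "n > 0"
  shows "structure_form p \<gamma> = (\<Sum>u\<in>UNIV. wedge n (n - 1) (L p u) (I p u) \<gamma>)"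
proof -
  have "even ((n - 1) * n)" using n by simp
  then have 1: "(-1) ^ ((n - 1) * n) = (1 :: real)" by (rule neg_one_even_power)
  have "wedge (n - 1) n (I p u) (L p u) \<gamma> = (-1) ^ ((n - 1) * n) * wedge n (n - 1) (L p u) (I p u) \<gamma>" for u
    by (rule wedge_commute, erule contract_cong, erule mv_cong[OF L_multivector[OF p]])
  then show ?thesis unfolding structure_form_def 1 by simp
qed

definition jacobi_sum :: "'a \<Rightarrow> (nat \<Rightarrow> 'a \<Rightarrow> real) \<Rightarrow> real" where
  "jacobi_sum p f = alt_sum (2 * n - 1) (\<lambda>\<sigma>. nary_bracket A P
     (case_nat (nary_bracket A P (\<lambda>i. f (\<sigma> i))) (\<lambda>i. f (\<sigma> (n + i)))) p)"

text \<open>Of the two parts of the Leibniz rule, the Lie derivative gives the structure form and the correction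
  terms give the Hessian sum. The \<open>n\<close> correction terms contribute equally to the alternating sum
  because a transposition of arguments relates them.\<close>

lemma jacobi_sum_eq:
  assumes p: "p \<in> fst c" and n: "n > 0"
    and f: "\<And>i. i < 2 * n - 1 \<Longrightarrow> smooth_fun_near A p (f i)"
  shows "jacobi_sum p f = fact n * fact (n - 1) * structure_form p (\<lambda>i. differential A (f i) p)
    + real n * hessian_sum p f"
proof -
  let ?N = "2 * n - 1"
  have N: "n + (n - 1) = ?N" using n by simp
  let ?d = "\<lambda>i. differential A (f i) p"
  let ?h = "\<lambda>u i. differential A (\<lambda>q. pd u q (f i)) p"
  let ?I = "\<lambda>u \<sigma>. I p u (\<lambda>j. ?d (\<sigma> (n + j)))"
  let ?H = "\<lambda>u i \<sigma>. P p ((\<lambda>j. ?d (\<sigma> j))(i := ?h u (\<sigma> i))) * ?I u \<sigma>"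
  have f\<sigma>: "smooth_fun_near A p (f (\<sigma> j))" if "\<sigma> permutes {..<?N}" "j < n" for \<sigma> j
    using f permutes_in_image[OF that(1), of j] that(2) n by auto
  have "nary_bracket A P (case_nat (nary_bracket A P (\<lambda>i. f (\<sigma> i))) (\<lambda>i. f (\<sigma> (n + i)))) p =
      (\<Sum>u\<in>UNIV. L p u (\<lambda>i. ?d (\<sigma> i)) * ?I u \<sigma>) + (\<Sum>u\<in>UNIV. \<Sum>i<n. ?H u i \<sigma>)"
    if \<sigma>: "\<sigma> permutes {..<?N}" for \<sigma>
  proof -
    let ?g = "nary_bracket A P (\<lambda>i. f (\<sigma> i))"
    have "nary_bracket A P (case_nat ?g (\<lambda>i. f (\<sigma> (n + i)))) p =
        contract (differential A ?g p) (P p) (\<lambda>i. ?d (\<sigma> (n + i)))"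
      unfolding nary_bracket_def contract_def
      by (rule arg_cong[of _ _ "P p"]) (auto split: nat.split)
    also have "\<dots> = (\<Sum>u\<in>UNIV. pd u p ?g * ?I u \<sigma>)"
      by (simp add: contract_rep[OF p n differential_cotangent[OF p, of ?g]] p)
    also have "\<dots> = (\<Sum>u\<in>UNIV. L p u (\<lambda>i. ?d (\<sigma> i)) * ?I u \<sigma> + (\<Sum>i<n. ?H u i \<sigma>))"
      by (rule sum.cong) (simp_all add: pd_bracket[OF p f\<sigma>[OF \<sigma>]] distrib_right sum_distrib_right
          del: fun_upd_apply)
    finally show ?thesis by (simp only: sum.distrib)
  qed
  then have "jacobi_sum p f = alt_sum ?N (\<lambda>\<sigma>. (\<Sum>u\<in>UNIV. L p u (\<lambda>i. ?d (\<sigma> i)) * ?I u \<sigma>) +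
      (\<Sum>u\<in>UNIV. \<Sum>i<n. ?H u i \<sigma>))"
    unfolding jacobi_sum_def by (rule alt_sum_cong)
  also have "\<dots> = (\<Sum>u\<in>UNIV. alt_sum ?N (\<lambda>\<sigma>. L p u (\<lambda>i. ?d (\<sigma> i)) * ?I u \<sigma>)) +
      (\<Sum>u\<in>UNIV. \<Sum>i<n. alt_sum ?N (?H u i))"
    by (simp only: alt_sum_add alt_sum_sum)
  also have "(\<Sum>u\<in>UNIV. alt_sum ?N (\<lambda>\<sigma>. L p u (\<lambda>i. ?d (\<sigma> i)) * ?I u \<sigma>)) =
      fact n * fact (n - 1) * structure_form p ?d"
    unfolding structure_form_eq[OF p n] wedge_alt_sum N sum_distrib_left by (rule sum.cong) auto
  \<comment> \<open>The transposition of \<open>0\<close> and \<open>i\<close> changes the sign of the sum and of \<open>P\<close>.\<close>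
  also have "(\<Sum>u\<in>UNIV. \<Sum>i<n. alt_sum ?N (?H u i)) = (\<Sum>u\<in>UNIV. \<Sum>i<n. alt_sum ?N (?H u 0))"
  proof (intro sum.cong refl)
    fix u i assume "i \<in> {..<n}"
    then have i: "i < n" by simp
    let ?\<tau> = "Transposition.transpose 0 i"
    have \<tau>: "?\<tau> permutes {..<?N}" "?\<tau> permutes {..<n}"
      using i n by (auto intro!: permutes_swap_id)
    have "?H u i (\<sigma> \<circ> ?\<tau>) = of_int (sign ?\<tau>) * ?H u 0 \<sigma>" for \<sigma>
    proof -
      have "(\<lambda>j. ?d ((\<sigma> \<circ> ?\<tau>) j))(i := ?h u ((\<sigma> \<circ> ?\<tau>) i)) = ((\<lambda>j. ?d (\<sigma> j))(0 := ?h u (\<sigma> 0))) \<circ> ?\<tau>"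
        by (rule ext) (auto simp: Transposition.transpose_def)
      moreover have "?I u (\<sigma> \<circ> ?\<tau>) = ?I u \<sigma>"
        using i by (simp add: Transposition.transpose_def)
      ultimately show ?thesis by (simp only: mv_perm[OF P_mv \<tau>(2)] mult.assoc)
    qed
    then have "alt_sum ?N (?H u i) = of_int (sign ?\<tau>) * (of_int (sign ?\<tau>) * alt_sum ?N (?H u 0))"
      by (subst alt_sum_compose[OF \<tau>(1)]) (simp only: alt_sum_cmult)
    moreover have "of_int (sign ?\<tau>) * (of_int (sign ?\<tau>) * y) = y" for y :: real
      by (simp add: sign_swap_id)
    ultimately show "alt_sum ?N (?H u i) = alt_sum ?N (?H u 0)" by (simp only:)
  qed
  also have "\<dots> = real n * (\<Sum>u\<in>UNIV. alt_sum ?N (?H u 0))"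
    by (simp add: sum_distrib_left)
  also have "(\<Sum>u\<in>UNIV. alt_sum ?N (?H u 0)) = hessian_sum p f"
  proof -
    have "?H u 0 \<sigma> = (\<Sum>v\<in>UNIV. pd v p (\<lambda>q. pd u q (f (\<sigma> 0))) * (I p v (\<lambda>j. ?d (\<sigma> (Suc j))) * ?I u \<sigma>))"
      for u \<sigma>
    proof -
      have "(\<lambda>j. ?d (\<sigma> j))(0 := ?h u (\<sigma> 0)) = case_nat (?h u (\<sigma> 0)) (\<lambda>j. ?d (\<sigma> (Suc j)))"
        by (auto split: nat.split)
      then have "P p ((\<lambda>j. ?d (\<sigma> j))(0 := ?h u (\<sigma> 0))) = contract (?h u (\<sigma> 0)) (P p) (\<lambda>j. ?d (\<sigma> (Suc j)))"
        by (simp only: contract_def)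
      then show ?thesis
        by (simp add: contract_rep[OF p n differential_cotangent[OF p, of "\<lambda>q. pd u q (f (\<sigma> 0))"]]
            p sum_distrib_right mult.assoc del: fun_upd_apply)
    qed
    then show ?thesis unfolding hessian_sum_def by (simp only: alt_sum_sum)
  qed
  finally show ?thesis .
qed

text \<open>Exchanging the two blocks of \<open>n - 1\<close> arguments behind the first one is an odd permutation for even
  \<open>n\<close>. It exchanges the roles of \<open>u\<close> and \<open>v\<close> in the two contractions, and the second derivatives are
  symmetric, so the sum equals its negative.\<close>

lemma hessian_sum_even:
  assumes p: "p \<in> fst c" and n: "n > 0" and even: "even n"
    and f: "\<And>i. i < 2 * n - 1 \<Longrightarrow> smooth_fun_near A p (f i)"
  shows "hessian_sum p f = 0"
proof -
  let ?N = "2 * n - 1"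
  let ?d = "\<lambda>i. differential A (f i) p"
  define Q where "Q u v = alt_sum ?N (\<lambda>\<sigma>. pd v p (\<lambda>q. pd u q (f (\<sigma> 0))) *
     (I p v (\<lambda>j. ?d (\<sigma> (Suc j))) * I p u (\<lambda>j. ?d (\<sigma> (n + j)))))" for u v
  let ?\<pi> = "shift_perm 1 (block_rot (n - 1) (n - 1))"
  have "1 + ((n - 1) + (n - 1)) = ?N" using n by simp
  then have \<pi>: "?\<pi> permutes {..<?N}"
    using shift_perm_permutes[OF block_rot_permutes[of "n - 1" "n - 1"], of 1] by metis
  have "odd ((n - 1) * (n - 1))" using even n by simp
  then have s: "sign ?\<pi> = - 1"
    by (simp add: sign_shift_perm[OF block_rot_permutes] sign_block_rot minus_one_power_iff)
  obtain k where k: "n = Suc k" using n by (cases n) auto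
  have \<pi>1: "?\<pi> (Suc j) = n + j" if "j < n - 1" for j
    using that by (simp add: k shift_perm_def block_rot_def)
  have \<pi>2: "?\<pi> (n + j) = Suc j" if "j < n - 1" for j
    using that by (simp add: k shift_perm_def block_rot_def)
  have "Q u v = - Q v u" for u v
  proof -
    have 1: "I p v (\<lambda>j. ?d ((\<sigma> \<circ> ?\<pi>) (Suc j))) = I p v (\<lambda>j. ?d (\<sigma> (n + j)))" for \<sigma>
      by (rule contract_cong) (simp only: comp_apply \<pi>1)
    have 2: "I p u (\<lambda>j. ?d ((\<sigma> \<circ> ?\<pi>) (n + j))) = I p u (\<lambda>j. ?d (\<sigma> (Suc j)))" for \<sigma>
      by (rule contract_cong) (simp only: comp_apply \<pi>2)
    have 3: "pd v p (\<lambda>q. pd u q (f ((\<sigma> \<circ> ?\<pi>) 0))) = pd u p (\<lambda>q. pd v q (f (\<sigma> 0)))"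
      if "\<sigma> permutes {..<?N}" for \<sigma>
    proof -
      have "\<sigma> 0 < ?N" using permutes_in_image[OF that, of 0] n by simp
      from pd_commute[OF f[OF this] p] show ?thesis by (simp add: shift_perm_def)
    qed
    have "Q u v = of_int (sign ?\<pi>) * alt_sum ?N (\<lambda>\<sigma>. pd v p (\<lambda>q. pd u q (f ((\<sigma> \<circ> ?\<pi>) 0))) *
     (I p v (\<lambda>j. ?d ((\<sigma> \<circ> ?\<pi>) (Suc j))) * I p u (\<lambda>j. ?d ((\<sigma> \<circ> ?\<pi>) (n + j)))))"
      unfolding Q_def by (rule alt_sum_compose[OF \<pi>])
    also have "\<dots> = of_int (sign ?\<pi>) * Q v u"
      unfolding Q_def
    proof (rule arg_cong[where f = "\<lambda>y. of_int (sign ?\<pi>) * y"], rule alt_sum_cong)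
      fix \<sigma> assume \<sigma>: "\<sigma> permutes {..<?N}"
      show "pd v p (\<lambda>q. pd u q (f ((\<sigma> \<circ> ?\<pi>) 0))) *
          (I p v (\<lambda>j. ?d ((\<sigma> \<circ> ?\<pi>) (Suc j))) * I p u (\<lambda>j. ?d ((\<sigma> \<circ> ?\<pi>) (n + j)))) =
        pd u p (\<lambda>q. pd v q (f (\<sigma> 0))) *
          (I p u (\<lambda>j. ?d (\<sigma> (Suc j))) * I p v (\<lambda>j. ?d (\<sigma> (n + j))))"
        unfolding 1 2 3[OF \<sigma>] by (simp only: mult.commute)
    qed
    finally show ?thesis unfolding s by simp
  qed
  then have "(\<Sum>u\<in>UNIV. \<Sum>v\<in>UNIV. Q u v) = (\<Sum>u\<in>UNIV. \<Sum>v\<in>UNIV. - Q v u)"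
    by (intro sum.cong refl)
  also have "\<dots> = - (\<Sum>u\<in>UNIV. \<Sum>v\<in>UNIV. Q v u)"
    by (simp only: sum_negf)
  also have "(\<Sum>u\<in>UNIV. \<Sum>v\<in>UNIV. Q v u) = (\<Sum>u\<in>UNIV. \<Sum>v\<in>UNIV. Q u v)"
    by (rule sum.swap)
  finally show ?thesis by (simp add: hessian_sum_def Q_def)
qed

text \<open>Alternating over the arguments of the contractions, with the twice differentiated function held
  fixed, already produces the exterior product of the two contractions.\<close>

lemma hessian_sum_zero_if_contractions:
  assumes p: "p \<in> fst c" and n: "n > 0"
    and 0: "\<And>\<alpha> \<beta> \<gamma>. \<alpha> \<in> cotangent_space A p \<Longrightarrow> \<beta> \<in> cotangent_space A p \<Longrightarrow>
      wedge (n - 1) (n - 1) (contract \<alpha> (P p)) (contract \<beta> (P p)) \<gamma> = 0"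
  shows "hessian_sum p f = 0"
proof -
  have N: "2 * n - 1 = Suc ((n - 1) + (n - 1))" using n by simp
  have "alt_sum (2 * n - 1) (\<lambda>\<sigma>. pd v p (\<lambda>q. pd u q (f (\<sigma> 0))) *
     (I p v (\<lambda>j. differential A (f (\<sigma> (Suc j))) p) * I p u (\<lambda>j. differential A (f (\<sigma> (n + j))) p))) = 0"
    for u v
    unfolding N
  proof (rule alt_sum_eq_0_if_stabilizer)
    fix \<sigma> :: "nat \<Rightarrow> nat"
    let ?d = "\<lambda>i. differential A (f (\<sigma> (Suc i))) p"
    have n': "shift_perm 1 \<tau> (n + j) = Suc (\<tau> (n - 1 + j))" for \<tau> j
      using n by (simp add: shift_perm_def)
    have s: "shift_perm 1 \<tau> (Suc j) = Suc (\<tau> j)" "shift_perm 1 \<tau> 0 = 0" for \<tau> j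
      by (simp_all add: shift_perm_def)
    show "alt_sum (n - 1 + (n - 1)) (\<lambda>\<tau>. pd v p (\<lambda>q. pd u q (f ((\<sigma> \<circ> shift_perm 1 \<tau>) 0))) *
       (I p v (\<lambda>j. differential A (f ((\<sigma> \<circ> shift_perm 1 \<tau>) (Suc j))) p) *
        I p u (\<lambda>j. differential A (f ((\<sigma> \<circ> shift_perm 1 \<tau>) (n + j))) p))) = 0"
      using 0[OF differential_cotangent[OF p] differential_cotangent[OF p], of "x v" "x u" ?d]
      unfolding comp_apply n' s alt_sum_cmult by (simp add: wedge_alt_sum)
  qed
  then show ?thesis by (simp add: hessian_sum_def)
qed

section \<open>Necessity of the conditions\<close>

lemma extend_germ:
  assumes f: "smooth_fun_on A (fst c) f" and p: "p \<in> fst c"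
  obtains g where "smooth_fun_on A UNIV g" "differential A g p = differential A f p"
    "\<And>u v. pd v p (\<lambda>q. pd u q g) = pd v p (\<lambda>q. pd u q f)"
proof -
  obtain g W where g: "smooth_fun_on A UNIV g" and W: "open W" "p \<in> W" and eq: "\<And>q. q \<in> W \<Longrightarrow> g q = f q"
    using extend_smooth_fun[OF assms] by metis
  have "differential A g p = differential A f p"
    by (rule differential_cong[OF W _ p]) (rule eq)
  moreover have "pd v p (\<lambda>q. pd u q g) = pd v p (\<lambda>q. pd u q f)" for u v
  proof (rule pd_cong[OF open_Int[OF W(1) c_open] _ _ p])
    show "p \<in> W \<inter> fst c" using W p by simp
    show "pd u q g = pd u q f" if "q \<in> W \<inter> fst c" for q
      by (rule pd_cong[OF W(1)]) (use that eq in auto)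
  qed
  ultimately show ?thesis using that g by metis
qed

lemma ex_affine_germ:
  assumes p: "p \<in> fst c"
  shows "\<exists>g. smooth_fun_on A UNIV g \<and> differential A g p = differential A (lin p \<alpha>) p \<and>
    (\<forall>u v. pd v p (\<lambda>q. pd u q g) = 0)"
  by (rule extend_germ[OF lin_smooth p, of p \<alpha>]) (simp only: pd_pd_lin[OF p], blast)

lemma structure_form_zero:
  assumes p: "p \<in> fst c" and n: "n > 0" and i: "i < 2 * n - 1" "\<gamma> i \<notin> cotangent_space A p"
  shows "structure_form p \<gamma> = 0"
proof -
  have "wedge (n - 1) n (I p u) (L p u) \<gamma> = 0" for u
    by (rule wedge_zero[where C = "cotangent_space A p" and i = i])
      (use contract_zero mv_zero[OF L_multivector[OF p]] i in auto)
  then show ?thesis by (simp add: structure_form_def)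
qed

lemma structure_form_cong:
  assumes p: "p \<in> fst c" and n: "n > 0" and eq: "\<And>i. i < 2 * n - 1 \<Longrightarrow> \<gamma> i = \<delta> i"
  shows "structure_form p \<gamma> = structure_form p \<delta>"
proof -
  have "wedge (n - 1) n (I p u) (L p u) \<gamma> = wedge (n - 1) n (I p u) (L p u) \<delta>" for u
    by (rule wedge_cong, erule contract_cong, erule mv_cong[OF L_multivector[OF p]], rule eq)
      (use n in auto)
  then show ?thesis by (simp add: structure_form_def)
qed

text \<open>Functions that are affine near \<open>p\<close> have arbitrary differentials at \<open>p\<close> and no second derivatives.\<close>

lemma structure_form_zero_if_jacobi:
  assumes p: "p \<in> fst c" and n: "n > 0"
    and J: "\<And>f. (\<And>i. smooth_fun_on A UNIV (f i)) \<Longrightarrow> jacobi_sum p f = 0"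
  shows "structure_form p \<gamma> = 0"
proof (cases "\<forall>i<2 * n - 1. \<gamma> i \<in> cotangent_space A p")
  case True
  from ex_affine_germ[OF p, of "\<gamma> _"] obtain g where g: "\<And>i. smooth_fun_on A UNIV (g i)"
    "\<And>i. differential A (g i) p = differential A (lin p (\<gamma> i)) p"
    "\<And>i u v. pd v p (\<lambda>q. pd u q (g i)) = 0" by metis
  have "hessian_sum p g = 0" by (simp add: hessian_sum_def g(3) alt_sum_def)
  moreover have "jacobi_sum p g = 0" by (rule J) (rule g(1))
  ultimately have "structure_form p (\<lambda>i. differential A (g i) p) = 0"
    using jacobi_sum_eq[OF p n smooth_fun_nearI[OF open_UNIV UNIV_I g(1)]] by simp
  moreover have "structure_form p (\<lambda>i. differential A (g i) p) = structure_form p \<gamma>"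
    by (rule structure_form_cong[OF p n]) (use True in \<open>simp add: g(2) differential_lin[OF p]\<close>)
  ultimately show ?thesis by simp
next
  case False
  then show ?thesis using structure_form_zero[OF p n] by blast
qed

text \<open>This germ isolates the pair of contractions with \<open>\<alpha>\<close> and \<open>\<beta>\<close> in the Hessian sum: its Hessian at \<open>p\<close> is
  the symmetrization of \<open>\<alpha> \<otimes> \<beta>\<close>.\<close>

lemma lin_product_jet:
  fixes \<alpha> \<beta> :: "'a cotangent"
  assumes p: "p \<in> fst c"
  defines "f \<equiv> \<lambda>q. (lin p \<alpha> q + - lin p \<alpha> p) * (lin p \<beta> q + - lin p \<beta> p)"
  shows "smooth_fun_on A (fst c) f"
    and "pd v p (\<lambda>q. pd u q f) = \<alpha> (pd u p) * \<beta> (pd v p) + \<alpha> (pd v p) * \<beta> (pd u p)"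
proof -
  let ?l = "\<lambda>\<alpha> q. lin p \<alpha> q + - lin p \<alpha> p"
  have l: "smooth_fun_on A (fst c) (?l \<alpha>)" for \<alpha>
    by (rule smooth_fun_on_add[OF c_open lin_smooth smooth_fun_on_const])
  have ln: "smooth_fun_near A q (?l \<alpha>)" if "q \<in> fst c" for q \<alpha>
    by (rule smooth_fun_nearI[OF c_open that l])
  show "smooth_fun_on A (fst c) f" unfolding f_def by (rule smooth_fun_on_mult[OF c_open l l])
  have pl: "pd u q (?l \<alpha>) = \<alpha> (pd u p)" if "q \<in> fst c" for q u \<alpha>
    unfolding pd_add[OF lin_smooth_near[OF that] smooth_fun_near_const that] pd_lin[OF that] by simp
  have "pd v p (\<lambda>q. pd u q f) = pd v p (\<lambda>q. \<alpha> (pd u p) * ?l \<beta> q + ?l \<alpha> q * \<beta> (pd u p))"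
  proof (rule pd_cong[OF c_open p _ p])
    fix q assume q: "q \<in> fst c"
    show "pd u q f = \<alpha> (pd u p) * ?l \<beta> q + ?l \<alpha> q * \<beta> (pd u p)"
      unfolding f_def pd_mult[OF ln[OF q] ln[OF q] q] pl[OF q] ..
  qed
  also have "\<dots> = \<alpha> (pd u p) * \<beta> (pd v p) + \<alpha> (pd v p) * \<beta> (pd u p)"
    unfolding pd_add[OF smooth_fun_near_mult[OF smooth_fun_near_const ln[OF p]]
        smooth_fun_near_mult[OF ln[OF p] smooth_fun_near_const] p]
      pd_mult[OF smooth_fun_near_const ln[OF p] p] pd_mult[OF ln[OF p] smooth_fun_near_const p] pl[OF p]
    by simp
  finally show "pd v p (\<lambda>q. pd u q f) = \<alpha> (pd u p) * \<beta> (pd v p) + \<alpha> (pd v p) * \<beta> (pd u p)" .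
qed

lemma wedge_contract_rep:
  assumes p: "p \<in> fst c" and n: "n > 0"
    and \<alpha>: "\<alpha> \<in> cotangent_space A p" and \<beta>: "\<beta> \<in> cotangent_space A p"
  shows "wedge k l (contract \<alpha> (P p)) (contract \<beta> (P p)) \<gamma> =
    (\<Sum>u\<in>UNIV. \<Sum>v\<in>UNIV. \<alpha> (pd u p) * \<beta> (pd v p) * wedge k l (I p u) (I p v) \<gamma>)"
  unfolding contract_rep[OF p n \<alpha>] contract_rep[OF p n \<beta>] wedge_sum_left wedge_sum_right
  by (simp add: sum_distrib_left mult.assoc)

text \<open>With the quadratic function in the first place and affine functions in all others, only the
  permutations that fix the first argument contribute to the Hessian sum. The result is the exterior
  product of the two contractions, symmetrized in \<open>\<alpha>\<close> and \<open>\<beta>\<close>. For odd \<open>n\<close> this product is itself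
  symmetric because the contractions have even degree.\<close>

lemma contractions_zero_if_jacobi:
  assumes p: "p \<in> fst c" and n: "n > 0" and odd: "odd n"
    and J: "\<And>f. (\<And>i. smooth_fun_on A UNIV (f i)) \<Longrightarrow> jacobi_sum p f = 0"
    and \<alpha>: "\<alpha> \<in> cotangent_space A p" and \<beta>: "\<beta> \<in> cotangent_space A p"
  shows "wedge (n - 1) (n - 1) (contract \<alpha> (P p)) (contract \<beta> (P p)) \<gamma> = 0"
proof (cases "\<forall>i<(n - 1) + (n - 1). \<gamma> i \<in> cotangent_space A p")
  case True
  let ?q = "\<lambda>q. (lin p \<alpha> q + - lin p \<alpha> p) * (lin p \<beta> q + - lin p \<beta> p)"
  let ?h = "\<lambda>u v. \<alpha> (pd u p) * \<beta> (pd v p) + \<alpha> (pd v p) * \<beta> (pd u p)"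
  obtain g0 where g0: "smooth_fun_on A UNIV g0" "\<And>u v. pd v p (\<lambda>q. pd u q g0) = ?h u v"
    by (rule extend_germ[OF lin_product_jet(1)[OF p] p, of \<alpha> \<beta>])
      (use lin_product_jet(2)[OF p, of _ _ \<alpha> \<beta>] in auto)
  from ex_affine_germ[OF p, of "\<gamma> _"] obtain g where g: "\<And>i. smooth_fun_on A UNIV (g i)"
    "\<And>i. differential A (g i) p = differential A (lin p (\<gamma> i)) p"
    "\<And>i u v. pd v p (\<lambda>q. pd u q (g i)) = 0" by metis
  let ?f = "case_nat g0 g"
  let ?\<gamma> = "\<lambda>i. differential A (g i) p"
  let ?W = "\<lambda>\<alpha> \<beta>. wedge (n - 1) (n - 1) (contract \<alpha> (P p)) (contract \<beta> (P p))"
  have f: "smooth_fun_on A UNIV (?f i)" for i using g0 g by (cases i) auto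
  have "jacobi_sum p ?f = 0" by (rule J) (rule f)
  then have h0: "hessian_sum p ?f = 0"
    using jacobi_sum_eq[OF p n smooth_fun_nearI[OF open_UNIV UNIV_I f]]
      structure_form_zero_if_jacobi[OF p n J] n by simp
  have N: "2 * n - 1 = Suc ((n - 1) + (n - 1))" using n by simp
  have n': "shift_perm 1 \<tau> (n + j) = Suc (\<tau> (n - 1 + j))" for \<tau> j
    using n by (simp add: shift_perm_def)
  have s: "shift_perm 1 \<tau> (Suc j) = Suc (\<tau> j)" "shift_perm 1 \<tau> 0 = 0" for \<tau> j
    by (simp_all add: shift_perm_def)
  have "alt_sum (2 * n - 1) (\<lambda>\<sigma>. pd v p (\<lambda>q. pd u q (?f (\<sigma> 0))) *
     (I p v (\<lambda>j. differential A (?f (\<sigma> (Suc j))) p) * I p u (\<lambda>j. differential A (?f (\<sigma> (n + j))) p))) =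
     (fact (n - 1) * fact (n - 1)) * (?h u v * wedge (n - 1) (n - 1) (I p v) (I p u) ?\<gamma>)" for u v
  proof -
    have "pd v p (\<lambda>q. pd u q (?f k)) = (if k = 0 then ?h u v else 0)" for k
      using g0(2) g(3) by (cases k) auto
    then have "alt_sum (2 * n - 1) (\<lambda>\<sigma>. pd v p (\<lambda>q. pd u q (?f (\<sigma> 0))) *
       (I p v (\<lambda>j. differential A (?f (\<sigma> (Suc j))) p) * I p u (\<lambda>j. differential A (?f (\<sigma> (n + j))) p))) =
      alt_sum (Suc ((n - 1) + (n - 1))) (\<lambda>\<sigma>. if \<sigma> 0 = 0 then ?h u v *
       (I p v (\<lambda>j. differential A (?f (\<sigma> (Suc j))) p) * I p u (\<lambda>j. differential A (?f (\<sigma> (n + j))) p)) else 0)"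
      unfolding N by (intro alt_sum_cong) simp
    also have "\<dots> = ?h u v * alt_sum ((n - 1) + (n - 1)) (\<lambda>\<tau>. I p v (\<lambda>j. ?\<gamma> (\<tau> j)) * I p u (\<lambda>j. ?\<gamma> (\<tau> (n - 1 + j))))"
      unfolding alt_sum_stabilizer alt_sum_cmult n' s by simp
    finally show ?thesis by (simp add: wedge_alt_sum)
  qed
  then have "(fact (n - 1) * fact (n - 1)) *
      (\<Sum>u\<in>UNIV. \<Sum>v\<in>UNIV. ?h u v * wedge (n - 1) (n - 1) (I p v) (I p u) ?\<gamma>) = 0"
    using h0 unfolding hessian_sum_def by (simp only: sum_distrib_left)
  then have "(\<Sum>u\<in>UNIV. \<Sum>v\<in>UNIV. ?h u v * wedge (n - 1) (n - 1) (I p v) (I p u) ?\<gamma>) = 0"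
    by simp
  moreover have "?W \<beta> \<alpha> ?\<gamma> = (\<Sum>u\<in>UNIV. \<Sum>v\<in>UNIV. \<alpha> (pd u p) * \<beta> (pd v p) * wedge (n - 1) (n - 1) (I p v) (I p u) ?\<gamma>)"
    unfolding wedge_contract_rep[OF p n \<beta> \<alpha>] by (subst sum.swap) (simp only: mult.commute[of "\<beta> _"])
  moreover have "?W \<alpha> \<beta> ?\<gamma> = (\<Sum>u\<in>UNIV. \<Sum>v\<in>UNIV. \<alpha> (pd v p) * \<beta> (pd u p) * wedge (n - 1) (n - 1) (I p v) (I p u) ?\<gamma>)"
    unfolding wedge_contract_rep[OF p n \<alpha> \<beta>] by (rule sum.swap)
  \<comment> \<open>The Hessian of the quadratic function is the symmetrization of \<open>\<alpha> \<otimes> \<beta>\<close>.\<close>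
  ultimately have "?W \<beta> \<alpha> ?\<gamma> + ?W \<alpha> \<beta> ?\<gamma> = 0"
    by (simp only: distrib_right sum.distrib)
  moreover have "?W \<beta> \<alpha> ?\<gamma> = ?W \<alpha> \<beta> ?\<gamma>"
  proof -
    have "even ((n - 1) * (n - 1))" using odd by simp
    then have 1: "(-1) ^ ((n - 1) * (n - 1)) = (1 :: real)" by (rule neg_one_even_power)
    have "?W \<beta> \<alpha> ?\<gamma> = (-1) ^ ((n - 1) * (n - 1)) * ?W \<alpha> \<beta> ?\<gamma>"
      by (rule wedge_commute, erule contract_cong, erule contract_cong)
    then show ?thesis unfolding 1 by simp
  qed
  moreover have "?W \<alpha> \<beta> ?\<gamma> = ?W \<alpha> \<beta> \<gamma>"
    by (rule wedge_cong, erule contract_cong, erule contract_cong)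
      (use True in \<open>simp add: g(2) differential_lin[OF p]\<close>)
  ultimately show ?thesis by simp
next
  case False
  then obtain i where i: "i < (n - 1) + (n - 1)" "\<gamma> i \<notin> cotangent_space A p" by blast
  show ?thesis
    by (rule wedge_zero[where C = "cotangent_space A p" and i = i]) (use contract_zero i in auto)
qed

section \<open>Lie brackets and Lie derivatives of decomposable fields\<close>

text \<open>Differentiates the components of a vector field, so that this is the bracket with the coordinate
  field \<open>\<partial>\<^sub>u\<close>.\<close>

definition pd_field :: "'m \<Rightarrow> ('a \<Rightarrow> 'a tangent) \<Rightarrow> 'a \<Rightarrow> 'a tangent" where
  "pd_field u Y p = (\<lambda>f. \<Sum>v\<in>UNIV. pd u p (\<lambda>q. Y q (x v)) * pd v p f)"

lemma vector_field_smooth: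
  "vector_field_on A W X \<Longrightarrow> open V \<Longrightarrow> V \<subseteq> W \<Longrightarrow> smooth_fun_on A V f \<Longrightarrow> smooth_fun_on A V (\<lambda>p. X p f)"
  unfolding vector_field_on_def by blast

lemma vector_field_tangent: "vector_field_on A W X \<Longrightarrow> p \<in> W \<Longrightarrow> X p \<in> tangent_space A p"
  unfolding vector_field_on_def by blast

text \<open>The second derivatives of \<open>f\<close> in \<open>X (Y f)\<close> and \<open>Y (X f)\<close> cancel by symmetry, so the commutator is a
  tangent vector. This is where it matters that covectors vanish on everything else.\<close>

lemma lie_bracket_eq:
  assumes W: "open W" "W \<subseteq> fst c" "p \<in> W" and X: "vector_field_on A W X" and Y: "vector_field_on A W Y"
  shows "lie_bracket A X Y p = (\<lambda>f. \<Sum>v\<in>UNIV. (\<Sum>u\<in>UNIV. X p (x u) * pd u p (\<lambda>q. Y q (x v)) -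
    Y p (x u) * pd u p (\<lambda>q. X q (x v))) * pd v p f)"
proof
  fix f
  have p: "p \<in> fst c" using W by auto
  show "lie_bracket A X Y p f = (\<Sum>v\<in>UNIV. (\<Sum>u\<in>UNIV. X p (x u) * pd u p (\<lambda>q. Y q (x v)) -
    Y p (x u) * pd u p (\<lambda>q. X q (x v))) * pd v p f)"
  proof (cases "smooth_fun_near A p f")
    case True
    have XY: "X p (\<lambda>q. Y q f) = (\<Sum>v\<in>UNIV. (\<Sum>u\<in>UNIV. X p (x u) * pd u p (\<lambda>q. Y q (x v))) * pd v p f) +
        (\<Sum>u\<in>UNIV. \<Sum>v\<in>UNIV. X p (x u) * Y p (x v) * pd u p (\<lambda>q. pd v q f))"
      if X: "vector_field_on A W X" and Y: "vector_field_on A W Y" for X Y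
    proof -
      have Ys: "smooth_fun_near A p (\<lambda>q. Y q (x v))" for v
        by (rule smooth_fun_nearI[OF W(1,3) vector_field_smooth[OF Y W(1) order_refl smooth_fun_on_subset[OF x_smooth W(2)]]])
      have "pd u p (\<lambda>q. Y q f) = (\<Sum>v\<in>UNIV. pd u p (\<lambda>q. Y q (x v)) * pd v p f + Y p (x v) * pd u p (\<lambda>q. pd v q f))" for u
      proof -
        have "pd u p (\<lambda>q. Y q f) = pd u p (\<lambda>q. \<Sum>v\<in>UNIV. Y q (x v) * pd v q f)"
          by (rule pd_cong[OF W(1,3) _ p], rule tangent_apply) (use W vector_field_tangent[OF Y] in auto)
        also have "\<dots> = (\<Sum>v\<in>UNIV. pd u p (\<lambda>q. Y q (x v) * pd v q f))"
          by (rule pd_sum[OF _ p]) (rule smooth_fun_near_mult[OF Ys pd_smooth_near[OF True p]])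
        finally show ?thesis by (simp only: pd_mult[OF Ys pd_smooth_near[OF True p] p])
      qed
      then have "X p (\<lambda>q. Y q f) = (\<Sum>u\<in>UNIV. X p (x u) *
          (\<Sum>v\<in>UNIV. pd u p (\<lambda>q. Y q (x v)) * pd v p f + Y p (x v) * pd u p (\<lambda>q. pd v q f)))"
        by (subst tangent_apply[OF p vector_field_tangent[OF X W(3)]]) simp
      also have "\<dots> = (\<Sum>u\<in>UNIV. \<Sum>v\<in>UNIV. X p (x u) * pd u p (\<lambda>q. Y q (x v)) * pd v p f) +
        (\<Sum>u\<in>UNIV. \<Sum>v\<in>UNIV. X p (x u) * Y p (x v) * pd u p (\<lambda>q. pd v q f))"
        by (simp add: sum_distrib_left sum.distrib distrib_left mult.assoc)
      also have "(\<Sum>u\<in>UNIV. \<Sum>v\<in>UNIV. X p (x u) * pd u p (\<lambda>q. Y q (x v)) * pd v p f) =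
          (\<Sum>v\<in>UNIV. (\<Sum>u\<in>UNIV. X p (x u) * pd u p (\<lambda>q. Y q (x v))) * pd v p f)"
        unfolding sum_distrib_right by (rule sum.swap)
      finally show ?thesis .
    qed
    have "(\<Sum>u\<in>UNIV. \<Sum>v\<in>UNIV. Y p (x u) * X p (x v) * pd u p (\<lambda>q. pd v q f)) =
        (\<Sum>u\<in>UNIV. \<Sum>v\<in>UNIV. X p (x u) * Y p (x v) * pd u p (\<lambda>q. pd v q f))"
      by (subst sum.swap) (simp only: pd_commute[OF True p] mult.commute[of "Y p _"])
    then show ?thesis using True unfolding lie_bracket_def
      by (simp add: XY[OF X Y] XY[OF Y X] sum_subtractf left_diff_distrib)
  next
    case False
    then show ?thesis by (simp add: lie_bracket_def coord_field_def)
  qed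
qed

lemma cotangent_lie_bracket:
  assumes W: "open W" "W \<subseteq> fst c" "p \<in> W" and X: "vector_field_on A W X" and Y: "vector_field_on A W Y"
    and \<alpha>: "\<alpha> \<in> cotangent_space A p"
  shows "\<alpha> (lie_bracket A X Y p) =
    (\<Sum>u\<in>UNIV. X p (x u) * \<alpha> (pd_field u Y p) - Y p (x u) * \<alpha> (pd_field u X p))"
proof -
  have p: "p \<in> fst c" using W by auto
  have lc: "\<alpha> (\<lambda>f. \<Sum>v\<in>UNIV. a v * pd v p f) = (\<Sum>v\<in>UNIV. a v * \<alpha> (pd v p))" for a
    using cotangent_lincomb[OF p \<alpha>, of UNIV a] by simp
  show ?thesis
    unfolding lie_bracket_eq[OF W X Y] pd_field_def lc
    by (simp add: sum_distrib_right sum_distrib_left left_diff_distrib sum_subtractf mult.assoc)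
      (intro arg_cong2[where f = "(-)"] sum.swap)
qed

lemma pd_prod:
  fixes k :: nat
  assumes p: "p \<in> fst c" and h: "\<And>i. i < k \<Longrightarrow> smooth_fun_near A p (h i)"
  shows "smooth_fun_near A p (\<lambda>q. \<Prod>i<k. h i q) \<and>
    pd u p (\<lambda>q. \<Prod>i<k. h i q) = (\<Sum>j<k. \<Prod>i<k. if i = j then pd u p (h j) else h i p)"
  using h
proof (induction k)
  case 0
  then show ?case using p by (simp add: smooth_fun_near_const)
next
  case (Suc k)
  then have IH: "smooth_fun_near A p (\<lambda>q. \<Prod>i<k. h i q)"
    "pd u p (\<lambda>q. \<Prod>i<k. h i q) = (\<Sum>j<k. \<Prod>i<k. if i = j then pd u p (h j) else h i p)" by auto
  have h: "smooth_fun_near A p (h k)" using Suc.prems by simp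
  have "(\<Prod>i<k. if i = k then pd u p (h k) else h i p) = (\<Prod>i<k. h i p)"
    by (rule prod.cong) auto
  then show ?case
    using smooth_fun_near_mult[OF IH(1) h] pd_mult[OF IH(1) h p, of u]
    by (simp add: IH(2) sum_distrib_left mult.commute)
qed

text \<open>Evaluated on linear functions, the Lie derivative is the partial derivative of a sum of
  determinants, to which the product rule applies.\<close>

lemma L_decomposition:
  assumes W: "open W" "W \<subseteq> fst c" "p \<in> W" and X: "decomposition_on A n P W N X"
  shows "L p u = (\<lambda>\<alpha>. \<Sum>a<N. \<Sum>j<n. wedge_vectors A n p ((\<lambda>i. X a i p)(j := pd_field u (X a j) p)) \<alpha>)"
proof
  fix \<alpha>
  have p: "p \<in> fst c" using W by auto
  have vf: "vector_field_on A W (X a i)" if "a < N" "i < n" for a i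
    using X that unfolding decomposition_on_def by blast
  have Pq: "P q = (\<lambda>\<alpha>. \<Sum>a<N. wedge_vectors A n q (\<lambda>i. X a i q) \<alpha>)" if "q \<in> W" for q
    using X that unfolding decomposition_on_def by blast
  show "L p u \<alpha> = (\<Sum>a<N. \<Sum>j<n. wedge_vectors A n p ((\<lambda>i. X a i p)(j := pd_field u (X a j) p)) \<alpha>)"
  proof (cases "\<forall>i<n. \<alpha> i \<in> cotangent_space A p")
    case False
    then have "L p u \<alpha> = 0" using mv_zero[OF L_multivector[OF p]] by blast
    moreover have "wedge_vectors A n p V \<alpha> = 0" for V
      using False by (simp only: wedge_vectors_alt_sum if_False)
    ultimately show ?thesis by simp
  next
    case True
    define h where "h a i k = (\<lambda>q. X a i q (lin p (\<alpha> k)))" for a i k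
    have hs: "smooth_fun_near A p (h a i k)" if "a < N" "i < n" for a i k
      unfolding h_def
      by (rule smooth_fun_nearI[OF W(1,3) vector_field_smooth[OF vf[OF that] W(1) order_refl
              smooth_fun_on_subset[OF lin_smooth W(2)]]])
    have hp: "h a i k p = \<alpha> k (X a i p)" if "a < N" "i < n" "k < n" for a i k
    proof -
      have "\<alpha> k (X a i p) = differential A (lin p (\<alpha> k)) p (X a i p)"
        using True that(3) by (simp add: differential_lin[OF p])
      then show ?thesis using vector_field_tangent[OF vf[OF that(1,2)] W(3)]
        by (simp add: h_def differential_def)
    qed
    have pdh: "pd u p (h a i k) = \<alpha> k (pd_field u (X a i) p)" if "a < N" "i < n" "k < n" for a i k
    proof -
      have Xs: "smooth_fun_near A p (\<lambda>q. X a i q (x v))" for v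
        by (rule smooth_fun_nearI[OF W(1,3) vector_field_smooth[OF vf[OF that(1,2)] W(1) order_refl
              smooth_fun_on_subset[OF x_smooth W(2)]]])
      have "pd u p (h a i k) = pd u p (\<lambda>q. \<Sum>v\<in>UNIV. \<alpha> k (pd v p) * X a i q (x v))"
      proof (rule pd_cong[OF W(1,3) _ p])
        fix q assume q: "q \<in> W"
        then have qc: "q \<in> fst c" using W by auto
        show "h a i k q = (\<Sum>v\<in>UNIV. \<alpha> k (pd v p) * X a i q (x v))"
          unfolding h_def
          by (subst tangent_apply[OF qc vector_field_tangent[OF vf[OF that(1,2)] q]])
            (simp add: pd_lin[OF qc] mult.commute)
      qed
      also have "\<dots> = (\<Sum>v\<in>UNIV. \<alpha> k (pd v p) * pd u p (\<lambda>q. X a i q (x v)))"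
        by (subst pd_sum[OF smooth_fun_near_mult[OF smooth_fun_near_const Xs] p]) (simp only: pd_cmult[OF Xs p])
      also have "\<dots> = \<alpha> k (pd_field u (X a i) p)"
        using cotangent_lincomb[OF p True[rule_format, OF that(3)], of UNIV "\<lambda>v. pd u p (\<lambda>q. X a i q (x v))"]
        by (simp add: pd_field_def mult.commute)
      finally show ?thesis .
    qed
    have "L p u \<alpha> = pd u p (nary_bracket A P (\<lambda>i. lin p (\<alpha> i)))"
      by (simp only: lie_derivative_eq[OF p] lie_tensor_def if_P[OF True])
    also have "\<dots> = pd u p (\<lambda>q. \<Sum>a<N. \<Sum>\<sigma> | \<sigma> permutes {..<n}. of_int (sign \<sigma>) * (\<Prod>i<n. h a i (\<sigma> i) q))"
    proof (rule pd_cong[OF W(1,3) _ p])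
      fix q assume q: "q \<in> W"
      then have qc: "q \<in> fst c" using W by auto
      have "wedge_vectors A n q (\<lambda>i. X a i q) (\<lambda>i. differential A (lin p (\<alpha> i)) q) =
          (\<Sum>\<sigma> | \<sigma> permutes {..<n}. of_int (sign \<sigma>) * (\<Prod>i<n. h a i (\<sigma> i) q))" if "a < N" for a
      proof -
        have "differential A (lin p (\<alpha> k)) q (X a i q) = h a i k q" if "i < n" for i k
          using vector_field_tangent[OF vf[OF \<open>a < N\<close> that] q] by (simp add: differential_def h_def)
        then show ?thesis
          by (simp add: wedge_vectors_def differential_cotangent[OF qc])
      qed
      then show "nary_bracket A P (\<lambda>i. lin p (\<alpha> i)) q =
          (\<Sum>a<N. \<Sum>\<sigma> | \<sigma> permutes {..<n}. of_int (sign \<sigma>) * (\<Prod>i<n. h a i (\<sigma> i) q))"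
        by (simp add: nary_bracket_def Pq[OF q])
    qed
    also have "\<dots> = (\<Sum>a<N. \<Sum>\<sigma> | \<sigma> permutes {..<n}. of_int (sign \<sigma>) *
        (\<Sum>j<n. \<Prod>i<n. if i = j then pd u p (h a j (\<sigma> j)) else h a i (\<sigma> i) p))"
    proof -
      have s: "smooth_fun_near A p (\<lambda>q. of_int (sign \<sigma>) * (\<Prod>i<n. h a i (\<sigma> i) q))"
        and d: "pd u p (\<lambda>q. of_int (sign \<sigma>) * (\<Prod>i<n. h a i (\<sigma> i) q)) = of_int (sign \<sigma>) *
          (\<Sum>j<n. \<Prod>i<n. if i = j then pd u p (h a j (\<sigma> j)) else h a i (\<sigma> i) p)" if "a < N" for a \<sigma>
      proof -
        note pr = pd_prod[OF p hs[OF that], of n "\<lambda>i. i" "\<lambda>i. \<sigma> i" u]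
        show "smooth_fun_near A p (\<lambda>q. of_int (sign \<sigma>) * (\<Prod>i<n. h a i (\<sigma> i) q))"
          by (rule smooth_fun_near_mult[OF smooth_fun_near_const]) (use pr in simp)
        show "pd u p (\<lambda>q. of_int (sign \<sigma>) * (\<Prod>i<n. h a i (\<sigma> i) q)) = of_int (sign \<sigma>) *
          (\<Sum>j<n. \<Prod>i<n. if i = j then pd u p (h a j (\<sigma> j)) else h a i (\<sigma> i) p)"
          using pr by (simp add: pd_cmult p)
      qed
      let ?s = "\<lambda>a q. \<Sum>\<sigma> | \<sigma> permutes {..<n}. of_int (sign \<sigma>) * (\<Prod>i<n. h a i (\<sigma> i) q)"
      have "pd u p (\<lambda>q. \<Sum>a<N. ?s a q) = (\<Sum>a<N. pd u p (?s a))"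
        by (rule pd_sum[OF smooth_fun_near_sum[OF s] p]) simp
      also have "\<dots> = (\<Sum>a<N. \<Sum>\<sigma> | \<sigma> permutes {..<n}. of_int (sign \<sigma>) *
          (\<Sum>j<n. \<Prod>i<n. if i = j then pd u p (h a j (\<sigma> j)) else h a i (\<sigma> i) p))"
      proof (rule sum.cong[OF refl])
        fix a assume "a \<in> {..<N}"
        then have a: "a < N" by simp
        show "pd u p (?s a) = (\<Sum>\<sigma> | \<sigma> permutes {..<n}. of_int (sign \<sigma>) *
          (\<Sum>j<n. \<Prod>i<n. if i = j then pd u p (h a j (\<sigma> j)) else h a i (\<sigma> i) p))"
          by (simp only: pd_sum[OF s[OF a] p] d[OF a])
      qed
      finally show ?thesis .
    qed
    also have "\<dots> = (\<Sum>a<N. \<Sum>j<n. wedge_vectors A n p ((\<lambda>i. X a i p)(j := pd_field u (X a j) p)) \<alpha>)"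
    proof (rule sum.cong[OF refl])
      fix a assume "a \<in> {..<N}"
      then have a: "a < N" by simp
      have "(\<Sum>\<sigma> | \<sigma> permutes {..<n}. of_int (sign \<sigma>) *
          (\<Sum>j<n. \<Prod>i<n. if i = j then pd u p (h a j (\<sigma> j)) else h a i (\<sigma> i) p)) =
        alt_sum n (\<lambda>\<sigma>. \<Sum>j<n. \<Prod>i<n. \<alpha> (\<sigma> i) (((\<lambda>i. X a i p)(j := pd_field u (X a j) p)) i))"
        unfolding alt_sum_def[symmetric]
      proof (intro alt_sum_cong sum.cong prod.cong refl)
        fix \<sigma> j i assume "\<sigma> permutes {..<n}" and "i \<in> {..<n}"
        then show "(if i = j then pd u p (h a j (\<sigma> j)) else h a i (\<sigma> i) p) =
            \<alpha> (\<sigma> i) (((\<lambda>i. X a i p)(j := pd_field u (X a j) p)) i)"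
          using permutes_in_image[of \<sigma> "{..<n}" i] by (auto simp: hp[OF a] pdh[OF a])
      qed
      also have "\<dots> = (\<Sum>j<n. wedge_vectors A n p ((\<lambda>i. X a i p)(j := pd_field u (X a j) p)) \<alpha>)"
        by (simp only: alt_sum_sum wedge_vectors_alt_sum if_P[OF True])
      finally show "(\<Sum>\<sigma> | \<sigma> permutes {..<n}. of_int (sign \<sigma>) *
          (\<Sum>j<n. \<Prod>i<n. if i = j then pd u p (h a j (\<sigma> j)) else h a i (\<sigma> i) p)) =
        (\<Sum>j<n. wedge_vectors A n p ((\<lambda>i. X a i p)(j := pd_field u (X a j) p)) \<alpha>)" .
    qed
    finally show ?thesis .
  qed
qed

section \<open>The Schouten bracket in coordinates\<close>

text \<open>The part of the bracket of decomposable fields in which \<open>X\<close> is differentiated, in the direction of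
  a single coordinate and without the sign.\<close>

definition half_schouten ::
  "'a \<Rightarrow> 'm \<Rightarrow> (nat \<Rightarrow> 'a \<Rightarrow> 'a tangent) \<Rightarrow> (nat \<Rightarrow> 'a \<Rightarrow> 'a tangent) \<Rightarrow> 'a multivector"
where
  "half_schouten p u X Y \<alpha> = (\<Sum>i<n. \<Sum>j<n. (-1) ^ (i + j) * (Y j p (x u) *
     wedge_vectors A (2 * n - 1) p (\<lambda>s. if s = 0 then pd_field u (X i) p
       else if s < n then X (skip i (s - 1)) p else Y (skip j (s - n)) p) \<alpha>))"

lemma half_schouten_eq:
  assumes p: "p \<in> fst c" and n: "n > 0" and Y: "\<And>j. j < n \<Longrightarrow> Y j p \<in> tangent_space A p"
  shows "half_schouten p u X Y \<alpha> = wedge n (n - 1)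
    (\<lambda>\<beta>. \<Sum>i<n. 1 * wedge_vectors A n p ((\<lambda>k. X k p)(i := pd_field u (X i) p)) \<beta>)
    (contract (dx u p) (wedge_vectors A n p (\<lambda>k. Y k p))) \<alpha>"
proof -
  obtain m where m: "n = Suc m" using n by (cases n) auto
  let ?Z = "\<lambda>i s. if s = 0 then pd_field u (X i) p else X (skip i (s - 1)) p"
  have c: "contract (dx u p) (wedge_vectors A n p (\<lambda>k. Y k p)) =
      (\<lambda>\<beta>. \<Sum>j<n. ((-1) ^ j * Y j p (x u)) * wedge_vectors A (n - 1) p (\<lambda>s. Y (skip j s) p) \<beta>)"
  proof
    fix \<beta>
    have "contract (dx u p) (wedge_vectors A n p (\<lambda>k. Y k p)) \<beta> =
      (\<Sum>j<n. (-1) ^ j * dx u p (Y j p) * wedge_vectors A (n - 1) p (\<lambda>s. Y (skip j s) p) \<beta>)"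
      unfolding m by (simp only: contract_wedge_vectors[OF differential_cotangent[OF p]] diff_Suc_1)
    also have "\<dots> = (\<Sum>j<n. ((-1) ^ j * Y j p (x u)) * wedge_vectors A (n - 1) p (\<lambda>s. Y (skip j s) p) \<beta>)"
      by (rule sum.cong) (use Y in \<open>auto simp: differential_def\<close>)
    finally show "contract (dx u p) (wedge_vectors A n p (\<lambda>k. Y k p)) \<beta> =
      (\<Sum>j<n. ((-1) ^ j * Y j p (x u)) * wedge_vectors A (n - 1) p (\<lambda>s. Y (skip j s) p) \<beta>)" .
  qed
  have N: "n + (n - 1) = 2 * n - 1" using n by simp
  have w: "wedge_vectors A n p ((\<lambda>k. X k p)(i := pd_field u (X i) p)) = (\<lambda>\<beta>. (-1) ^ i * wedge_vectors A n p (?Z i) \<beta>)"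
    if "i < n" for i
    by (rule ext) (rule wedge_vectors_update[OF that])
  have scale: "wedge n (n - 1) (\<lambda>\<beta>. k * S \<beta>) T \<alpha> = k * wedge n (n - 1) S T \<alpha>" for k S T
    using wedge_sum_left[of n "n - 1" "\<lambda>_. k" "\<lambda>_. S" "{()}" T \<alpha>] by simp
  have "wedge n (n - 1) (\<lambda>\<beta>. \<Sum>i<n. 1 * wedge_vectors A n p ((\<lambda>k. X k p)(i := pd_field u (X i) p)) \<beta>)
    (contract (dx u p) (wedge_vectors A n p (\<lambda>k. Y k p))) \<alpha> =
    (\<Sum>i<n. \<Sum>j<n. (-1) ^ j * Y j p (x u) * ((-1) ^ i *
      wedge n (n - 1) (wedge_vectors A n p (?Z i)) (wedge_vectors A (n - 1) p (\<lambda>s. Y (skip j s) p)) \<alpha>))"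
    unfolding c wedge_sum_left wedge_sum_right unfolding mult_1
  proof (intro sum.cong refl)
    fix i j assume "i \<in> {..<n}"
    then have "i < n" by simp
    from w[OF this] show "(-1) ^ j * Y j p (x u) *
        wedge n (n - 1) (wedge_vectors A n p ((\<lambda>k. X k p)(i := pd_field u (X i) p)))
          (wedge_vectors A (n - 1) p (\<lambda>s. Y (skip j s) p)) \<alpha> =
      (-1) ^ j * Y j p (x u) * ((-1) ^ i *
        wedge n (n - 1) (wedge_vectors A n p (?Z i)) (wedge_vectors A (n - 1) p (\<lambda>s. Y (skip j s) p)) \<alpha>)"
      by (simp only: scale)
  qed
  also have "\<dots> = half_schouten p u X Y \<alpha>"
    unfolding half_schouten_def
  proof (intro sum.cong refl)
    fix i j
    have "wedge_vectors A (2 * n - 1) p (\<lambda>s. if s < n then ?Z i s else Y (skip j (s - n)) p) =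
        wedge_vectors A (2 * n - 1) p (\<lambda>s. if s = 0 then pd_field u (X i) p
          else if s < n then X (skip i (s - 1)) p else Y (skip j (s - n)) p)"
      by (rule wedge_vectors_cong) (use n in auto)
    then show "(-1) ^ j * Y j p (x u) * ((-1) ^ i *
        wedge n (n - 1) (wedge_vectors A n p (?Z i)) (wedge_vectors A (n - 1) p (\<lambda>s. Y (skip j s) p)) \<alpha>) =
      (-1) ^ (i + j) * (Y j p (x u) * wedge_vectors A (2 * n - 1) p (\<lambda>s. if s = 0 then pd_field u (X i) p
          else if s < n then X (skip i (s - 1)) p else Y (skip j (s - n)) p) \<alpha>)"
      unfolding wedge_wedge_vectors N by (simp add: power_add)
  qed
  finally show ?thesis by (rule sym)
qed

lemma sum_rotate:
  "(\<Sum>a\<in>R. \<Sum>b\<in>S. \<Sum>u\<in>U. F a b u) = (\<Sum>u\<in>U. \<Sum>a\<in>R. \<Sum>b\<in>S. F a b u :: real)"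
  by (subst sum.swap, rule sum.cong[OF refl], rule sum.swap)

text \<open>The terms in which \<open>Y\<close> is differentiated become terms of the other kind, with \<open>X\<close> and \<open>Y\<close> exchanged,
  by swapping the blocks of the remaining factors. For even \<open>n\<close> this turns their sign \<open>+\<close> into \<open>-\<close>.
  So both halves add up.\<close>

lemma schouten_decomposable_eq:
  assumes W: "open W" "W \<subseteq> fst c" "p \<in> W" and n: "n > 0" and even: "even n"
    and X: "\<And>i. i < n \<Longrightarrow> vector_field_on A W (X i)" and Y: "\<And>i. i < n \<Longrightarrow> vector_field_on A W (Y i)"
    and \<alpha>: "\<forall>i<2 * n - 1. \<alpha> i \<in> cotangent_space A p"
  shows "schouten_decomposable A n n X Y p \<alpha> =
    - (\<Sum>u\<in>UNIV. half_schouten p u X Y \<alpha> + half_schouten p u Y X \<alpha>)"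
proof -
  let ?M = "2 * n - 1"
  let ?w = "\<lambda>Z i j. wedge_vectors A ?M p (\<lambda>s. if s = 0 then Z
       else if s < n then X (skip i (s - 1)) p else Y (skip j (s - n)) p) \<alpha>"
  let ?w' = "\<lambda>Z i j. wedge_vectors A ?M p (\<lambda>s. if s = 0 then Z
       else if s < n then Y (skip j (s - 1)) p else X (skip i (s - n)) p) \<alpha>"
  have M: "n + n - 1 = ?M" "?M > 0" using n by auto
  have odd: "(-1) ^ (n - 1) = (- 1 :: real)" using even n by (intro neg_one_odd_power) simp
  have swap: "?w Z i j = - ?w' Z i j" for Z i j
    using wedge_vectors_swap_blocks[OF n, of A p Z "\<lambda>s. X (skip i s) p" "\<lambda>s. Y (skip j s) p" \<alpha>]
    unfolding odd by simp
  have w: "?w (lie_bracket A (X i) (Y j) p) i j =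
      (\<Sum>u\<in>UNIV. X i p (x u) * ?w (pd_field u (Y j) p) i j - Y j p (x u) * ?w (pd_field u (X i) p) i j)"
    if "i < n" "j < n" for i j
    by (rule wedge_vectors_first_linear[OF cotangent_lie_bracket[OF W X[OF that(1)] Y[OF that(2)]] M(2)])
      (use \<alpha> in blast)
  have "schouten_decomposable A n n X Y p \<alpha> =
      (\<Sum>i<n. \<Sum>j<n. (-1) ^ (i + j) * ?w (lie_bracket A (X i) (Y j) p) i j)"
    unfolding schouten_decomposable_def M(1) ..
  also have "\<dots> = (\<Sum>i<n. \<Sum>j<n. \<Sum>u\<in>UNIV. - ((-1) ^ (i + j) * (X i p (x u) * ?w' (pd_field u (Y j) p) i j) +
      (-1) ^ (i + j) * (Y j p (x u) * ?w (pd_field u (X i) p) i j)))"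
  proof (intro sum.cong refl)
    fix i j assume "i \<in> {..<n}" "j \<in> {..<n}"
    then have "i < n" "j < n" by auto
    from w[OF this] show "(-1) ^ (i + j) * ?w (lie_bracket A (X i) (Y j) p) i j =
      (\<Sum>u\<in>UNIV. - ((-1) ^ (i + j) * (X i p (x u) * ?w' (pd_field u (Y j) p) i j) +
      (-1) ^ (i + j) * (Y j p (x u) * ?w (pd_field u (X i) p) i j)))"
      unfolding swap[of "pd_field _ (Y j) p"]
      by (simp only: sum_distrib_left) (simp add: algebra_simps)
  qed
  also have "\<dots> = (\<Sum>u\<in>UNIV. \<Sum>i<n. \<Sum>j<n. - ((-1) ^ (i + j) * (X i p (x u) * ?w' (pd_field u (Y j) p) i j) +
      (-1) ^ (i + j) * (Y j p (x u) * ?w (pd_field u (X i) p) i j)))"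
    by (rule sum_rotate)
  also have "\<dots> = (\<Sum>u\<in>UNIV. - ((\<Sum>i<n. \<Sum>j<n. (-1) ^ (i + j) * (X i p (x u) * ?w' (pd_field u (Y j) p) i j)) +
      half_schouten p u X Y \<alpha>))"
    unfolding half_schouten_def by (simp only: sum_negf sum.distrib)
  also have "\<dots> = (\<Sum>u\<in>UNIV. - (half_schouten p u Y X \<alpha> + half_schouten p u X Y \<alpha>))"
  proof -
    have "(\<Sum>i<n. \<Sum>j<n. (-1) ^ (i + j) * (X i p (x u) * ?w' (pd_field u (Y j) p) i j)) =
        half_schouten p u Y X \<alpha>" for u
      unfolding half_schouten_def by (subst sum.swap) (simp only: add.commute[of _ "_ :: nat"])
    then show ?thesis by simp
  qed
  finally show ?thesis by (simp only: sum_negf add.commute)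
qed

text \<open>The sum of the first halves is \<open>(\<Sum>u. L\<^sub>u P \<and> i\<^sub>u P)\<close>, and so is the sum of the second halves, because
  both decompositions are decompositions of \<open>P\<close>.\<close>

lemma schouten_sum_eq:
  assumes W: "open W" "p \<in> W" and p: "p \<in> fst c" and n: "n > 0" and even: "even n"
    and X: "decomposition_on A n P W N X" and Y: "decomposition_on A n P W K Y"
  shows "(\<Sum>a<N. \<Sum>b<K. schouten_decomposable A n n (X a) (Y b) p \<alpha>) = - 2 * structure_form p \<alpha>"
proof (cases "\<forall>i<2 * n - 1. \<alpha> i \<in> cotangent_space A p")
  case True
  let ?W = "W \<inter> fst c"
  have W': "open ?W" "?W \<subseteq> fst c" "p \<in> ?W" using W p c_open by auto
  have restrict: "vector_field_on A ?W V" if "vector_field_on A W V" for V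
    using that unfolding vector_field_on_def by blast
  have dec: "decomposition_on A n P ?W N X" if "decomposition_on A n P W N X" for N X
    using that restrict unfolding decomposition_on_def by blast
  have vf: "vector_field_on A ?W (X a i)" if "decomposition_on A n P W N X" "a < N" "i < n" for N X a i
    using dec[OF that(1)] that(2,3) unfolding decomposition_on_def by blast
  have Pp: "P p = (\<lambda>\<beta>. \<Sum>a<N. wedge_vectors A n p (\<lambda>i. X a i p) \<beta>)" if "decomposition_on A n P W N X" for N X
    using that W(2) unfolding decomposition_on_def by blast
  have half: "(\<Sum>a<N. \<Sum>b<K. half_schouten p u (X a) (Y b) \<alpha>) = wedge n (n - 1) (L p u) (I p u) \<alpha>"
    if X: "decomposition_on A n P W N X" and Y: "decomposition_on A n P W K Y" for N X K Y u
  proof -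
    let ?S = "\<lambda>a \<beta>. \<Sum>i<n. 1 * wedge_vectors A n p ((\<lambda>k. X a k p)(i := pd_field u (X a i) p)) \<beta>"
    let ?T = "\<lambda>b. contract (dx u p) (wedge_vectors A n p (\<lambda>k. Y b k p))"
    have "half_schouten p u (X a) (Y b) \<alpha> = wedge n (n - 1) (?S a) (?T b) \<alpha>" if "b < K" for a b
      by (rule half_schouten_eq[OF p n]) (rule vector_field_tangent[OF vf[OF Y that] W'(3)])
    then have "(\<Sum>a<N. \<Sum>b<K. half_schouten p u (X a) (Y b) \<alpha>) = (\<Sum>a<N. 1 * (\<Sum>b<K. 1 * wedge n (n - 1) (?S a) (?T b) \<alpha>))"
      unfolding mult_1 by (intro sum.cong refl) simp
    also have "\<dots> = wedge n (n - 1) (\<lambda>\<beta>. \<Sum>a<N. 1 * ?S a \<beta>) (\<lambda>\<beta>. \<Sum>b<K. 1 * ?T b \<beta>) \<alpha>"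
      by (rule wedge_sum_sum[symmetric])
    also have "(\<lambda>\<beta>. \<Sum>a<N. 1 * ?S a \<beta>) = L p u"
      by (simp only: L_decomposition[OF W' dec[OF X]] mult_1)
    also have "(\<lambda>\<beta>. \<Sum>b<K. 1 * ?T b \<beta>) = I p u"
      by (simp only: contract_def Pp[OF Y] mult_1)
    finally show ?thesis .
  qed
  have "(\<Sum>a<N. \<Sum>b<K. schouten_decomposable A n n (X a) (Y b) p \<alpha>) =
      (\<Sum>a<N. \<Sum>b<K. - (\<Sum>u\<in>UNIV. half_schouten p u (X a) (Y b) \<alpha> + half_schouten p u (Y b) (X a) \<alpha>))"
    by (intro sum.cong refl schouten_decomposable_eq[OF W' n even _ _ True]) (use vf X Y in auto)
  also have "\<dots> = - (\<Sum>u\<in>UNIV. \<Sum>a<N. \<Sum>b<K. half_schouten p u (X a) (Y b) \<alpha> + half_schouten p u (Y b) (X a) \<alpha>)"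
    unfolding sum_negf by (rule arg_cong[where f = uminus]) (rule sum_rotate)
  also have "\<dots> = - (\<Sum>u\<in>UNIV. (\<Sum>a<N. \<Sum>b<K. half_schouten p u (X a) (Y b) \<alpha>) +
      (\<Sum>b<K. \<Sum>a<N. half_schouten p u (Y b) (X a) \<alpha>))"
  proof -
    have "(\<Sum>a<N. \<Sum>b<K. half_schouten p u (Y b) (X a) \<alpha>) =
        (\<Sum>b<K. \<Sum>a<N. half_schouten p u (Y b) (X a) \<alpha>)" for u
      by (rule sum.swap)
    then show ?thesis by (simp only: sum.distrib)
  qed
  also have "\<dots> = - 2 * structure_form p \<alpha>"
    by (simp only: half[OF X Y] half[OF Y X] structure_form_eq[OF p n]) (simp add: sum_distrib_left[symmetric])
  finally show ?thesis .
next
  case False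
  then have "structure_form p \<alpha> = 0" using structure_form_zero[OF p n] by blast
  moreover have M: "n + n - 1 = 2 * n - 1" by simp
  have "schouten_decomposable A n n (X a) (Y b) p \<alpha> = 0" for a b
    unfolding schouten_decomposable_def M wedge_vectors_alt_sum if_not_P[OF False] by simp
  ultimately show ?thesis by simp
qed

section \<open>Local decompositions of a multivector field\<close>

text \<open>Expands the first \<open>k\<close> arguments of \<open>P\<close> in the basis \<open>dx\<^sup>u\<close>; the case \<open>k = n\<close> gives the
  components of \<open>P\<close>, and the general case makes the induction possible.\<close>

lemma multivector_coordinates:
  assumes q: "q \<in> fst c" and \<alpha>: "\<forall>i<n. \<alpha> i \<in> cotangent_space A q" and k: "k \<le> n"
  shows "P q \<alpha> = (\<Sum>J\<in>PiE {..<k} (\<lambda>_. UNIV). (\<Prod>i<k. \<alpha> i (pd (J i) q)) *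
    P q (\<lambda>i. if i < k then dx (J i) q else \<alpha> i))"
  using k
proof (induction k)
  case (Suc k)
  then have k: "k < n" by simp
  let ?e = "\<lambda>J i. if i < k then dx (J i) q else \<alpha> i"
  let ?e' = "\<lambda>J i. if i < Suc k then dx (J i) q else \<alpha> i"
  let ?B = "PiE {..<k} (\<lambda>_. UNIV :: 'm set)"
  have step: "P q (?e J) = (\<Sum>w\<in>UNIV. \<alpha> k (pd w q) * P q (?e' (J(k := w))))" for J
  proof -
    have "\<alpha> k \<in> cotangent_space A q" using \<alpha> k by blast
    then have rep: "(\<lambda>v. \<Sum>w\<in>UNIV. \<alpha> k (pd w q) * dx w q v) = \<alpha> k"
      by (rule cotangent_rep[OF q, symmetric])
    have "(?e J)(k := (\<lambda>v. \<Sum>w\<in>UNIV. \<alpha> k (pd w q) * dx w q v)) = ?e J"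
      unfolding rep by auto
    moreover have "P q ((?e J)(k := (\<lambda>v. \<Sum>w\<in>UNIV. \<alpha> k (pd w q) * dx w q v))) =
        (\<Sum>w\<in>UNIV. \<alpha> k (pd w q) * P q ((?e J)(k := dx w q)))"
      by (rule mv_sum[OF P_mv k differential_cotangent[OF q]])
    ultimately have "P q (?e J) = (\<Sum>w\<in>UNIV. \<alpha> k (pd w q) * P q ((?e J)(k := dx w q)))"
      by (simp only:)
    moreover have "(?e J)(k := dx w q) = ?e' (J(k := w))" for w by (auto simp: fun_eq_iff)
    ultimately show ?thesis by simp
  qed
  have Pi: "PiE {..<Suc k} (\<lambda>_. UNIV :: 'm set) = (\<lambda>(w, J). J(k := w)) ` (UNIV \<times> ?B)"
    unfolding lessThan_Suc by (rule PiE_insert_eq)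
  have inj: "inj_on (\<lambda>(w, J). J(k := w)) (UNIV \<times> ?B)"
    by (rule inj_combinator) simp
  have "(\<Sum>J\<in>PiE {..<Suc k} (\<lambda>_. UNIV). (\<Prod>i<Suc k. \<alpha> i (pd (J i) q)) * P q (?e' J)) =
      (\<Sum>(w, J)\<in>UNIV \<times> ?B. (\<Prod>i<Suc k. \<alpha> i (pd ((J(k := w)) i) q)) * P q (?e' (J(k := w))))"
    unfolding Pi sum.reindex[OF inj] by (simp only: comp_def case_prod_unfold)
  also have "\<dots> = (\<Sum>w\<in>UNIV. \<Sum>J\<in>?B. (\<Prod>i<Suc k. \<alpha> i (pd ((J(k := w)) i) q)) * P q (?e' (J(k := w))))"
    by (rule sum.cartesian_product[symmetric])
  also have "\<dots> = (\<Sum>J\<in>?B. \<Sum>w\<in>UNIV. (\<Prod>i<Suc k. \<alpha> i (pd ((J(k := w)) i) q)) * P q (?e' (J(k := w))))"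
    by (rule sum.swap)
  also have "\<dots> = (\<Sum>J\<in>?B. (\<Prod>i<k. \<alpha> i (pd (J i) q)) * P q (?e J))"
  proof (rule sum.cong[OF refl])
    fix J
    have "(\<Prod>i<k. \<alpha> i (pd ((J(k := w)) i) q)) = (\<Prod>i<k. \<alpha> i (pd (J i) q))" for w
      by (rule prod.cong) auto
    then show "(\<Sum>w\<in>UNIV. (\<Prod>i<Suc k. \<alpha> i (pd ((J(k := w)) i) q)) * P q (?e' (J(k := w)))) =
        (\<Prod>i<k. \<alpha> i (pd (J i) q)) * P q (?e J)"
      unfolding step sum_distrib_left prod.lessThan_Suc by (simp only: fun_upd_same mult.assoc)
  qed
  finally show ?case using Suc by simp
qed simp

text \<open>Every index tuple \<open>J\<close> gives one decomposable summand, the exterior product of the coordinate fields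
  with the component of \<open>P\<close> as coefficient of the first factor. Tuples that differ by a permutation
  give the same summand, hence the factor \<open>1 / fact n\<close>.\<close>

lemma ex_decomposition:
  assumes n: "n > 0"
  shows "\<exists>N X. decomposition_on A n P (fst c) N X"
proof -
  let ?B = "PiE {..<n} (\<lambda>_. UNIV :: 'm set)"
  define C where "C J q = nary_bracket A P (\<lambda>i. x (J i)) q / fact n" for J q
  define V where "V J i q = (if i = 0 then (\<lambda>f. C J q * pd (J 0) q f) else pd (J i) q)" for J and i :: nat and q
  have "finite ?B" by (rule finite_PiE) auto
  then obtain h where h: "bij_betw h {..<card ?B} ?B"
    using ex_bij_betw_nat_finite atLeast0LessThan by metis
  have vf_pd: "vector_field_on A (fst c) (pd u)" for u
    unfolding vector_field_on_def using pd_tangent pd_smooth by blast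
  have Cs: "smooth_fun_on A (fst c) (C J)" for J
  proof -
    have "smooth_fun_on A (fst c) (\<lambda>q. inverse (fact n) * nary_bracket A P (\<lambda>i. x (J i)) q)"
      by (rule smooth_fun_on_mult[OF c_open smooth_fun_on_const bracket_smooth[OF c_open x_smooth]])
    then show ?thesis unfolding C_def by (simp add: divide_inverse mult.commute)
  qed
  have vf: "vector_field_on A (fst c) (V J i)" for J i
  proof (cases "i = 0")
    case True
    have "smooth_fun_on A U (\<lambda>q. C J q * pd (J 0) q f)" if "open U" "U \<subseteq> fst c" "smooth_fun_on A U f" for U f
      by (rule smooth_fun_on_mult[OF that(1) smooth_fun_on_subset[OF Cs that(2)] pd_smooth[OF that(3,1,2)]])
    moreover have "(\<lambda>f. C J q * pd (J 0) q f) \<in> tangent_space A q" if "q \<in> fst c" for q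
      using tangent_comb[OF that pd_tangent[OF that] pd_tangent[OF that], of "C J q" "J 0" 0] by simp
    ultimately show ?thesis using True unfolding vector_field_on_def V_def by simp
  next
    case False
    then have "V J i = pd (J i)" by (auto simp: V_def)
    then show ?thesis using vf_pd by simp
  qed
  have "P q = (\<lambda>\<alpha>. \<Sum>J\<in>?B. wedge_vectors A n q (\<lambda>i. V J i q) \<alpha>)" if q: "q \<in> fst c" for q
  proof
    fix \<alpha>
    show "P q \<alpha> = (\<Sum>J\<in>?B. wedge_vectors A n q (\<lambda>i. V J i q) \<alpha>)"
    proof (cases "\<forall>i<n. \<alpha> i \<in> cotangent_space A q")
      case True
      obtain m where m: "n = Suc m" using n by (cases n) auto
      have sgn: "of_int (sign \<sigma>) * (of_int (sign \<sigma>) * y) = y" for \<sigma> :: "nat \<Rightarrow> nat" and y :: real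
        by (simp add: sign_def)
      have "fact n * P q \<alpha> = alt_sum n (\<lambda>\<sigma>. P q (\<alpha> \<circ> \<sigma>))"
      proof -
        have "alt_sum n (\<lambda>\<sigma>. P q (\<alpha> \<circ> \<sigma>)) = (\<Sum>\<sigma> | \<sigma> permutes {..<n}. P q \<alpha>)"
          unfolding alt_sum_def by (rule sum.cong) (auto simp: mv_perm[OF P_mv] sgn)
        then show ?thesis by (simp add: card_permutations)
      qed
      also have "\<dots> = alt_sum n (\<lambda>\<sigma>. \<Sum>J\<in>?B. (fact n * C J q) * (\<Prod>i<n. \<alpha> (\<sigma> i) (pd (J i) q)))"
      proof (rule alt_sum_cong)
        fix \<sigma> assume \<sigma>: "\<sigma> permutes {..<n}"
        have "\<forall>i<n. (\<alpha> \<circ> \<sigma>) i \<in> cotangent_space A q"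
          using True permutes_in_image[OF \<sigma>] by auto
        from multivector_coordinates[OF q this order_refl]
        have "P q (\<alpha> \<circ> \<sigma>) = (\<Sum>J\<in>?B. (\<Prod>i<n. \<alpha> (\<sigma> i) (pd (J i) q)) *
            P q (\<lambda>i. if i < n then dx (J i) q else \<alpha> (\<sigma> i)))" by (simp only: comp_def)
        moreover have "P q (\<lambda>i. if i < n then dx (J i) q else \<alpha> (\<sigma> i)) = fact n * C J q" for J
        proof -
          have "P q (\<lambda>i. if i < n then dx (J i) q else \<alpha> (\<sigma> i)) = P q (\<lambda>i. dx (J i) q)"
            by (rule mv_cong[OF P_mv]) simp
          then show ?thesis by (simp add: C_def nary_bracket_def)
        qed
        ultimately show "P q (\<alpha> \<circ> \<sigma>) = (\<Sum>J\<in>?B. (fact n * C J q) * (\<Prod>i<n. \<alpha> (\<sigma> i) (pd (J i) q)))"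
          by (simp add: mult.commute)
      qed
      also have "\<dots> = (\<Sum>J\<in>?B. fact n * wedge_vectors A n q (\<lambda>i. V J i q) \<alpha>)"
        unfolding alt_sum_sum
      proof (rule sum.cong[OF refl])
        fix J
        have "(\<Prod>i<n. \<alpha> (\<sigma> i) (V J i q)) = C J q * (\<Prod>i<n. \<alpha> (\<sigma> i) (pd (J i) q))"
          if \<sigma>: "\<sigma> permutes {..<n}" for \<sigma>
        proof -
          have "\<alpha> (\<sigma> 0) \<in> cotangent_space A q"
            using True permutes_in_image[OF \<sigma>, of 0] n by auto
          from cotangent_lincomb[OF q this, of "{J 0}" "\<lambda>_. C J q"]
          have "\<alpha> (\<sigma> 0) (V J 0 q) = C J q * \<alpha> (\<sigma> 0) (pd (J 0) q)" by (simp add: V_def)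
          then show ?thesis unfolding m prod.lessThan_Suc_shift by (simp add: V_def)
        qed
        then have "alt_sum n (\<lambda>\<sigma>. \<Prod>i<n. \<alpha> (\<sigma> i) (V J i q)) =
            alt_sum n (\<lambda>\<sigma>. C J q * (\<Prod>i<n. \<alpha> (\<sigma> i) (pd (J i) q)))"
          by (rule alt_sum_cong)
        then show "alt_sum n (\<lambda>\<sigma>. (fact n * C J q) * (\<Prod>i<n. \<alpha> (\<sigma> i) (pd (J i) q))) =
            fact n * wedge_vectors A n q (\<lambda>i. V J i q) \<alpha>"
          unfolding wedge_vectors_alt_sum if_P[OF True] by (simp add: alt_sum_cmult)
      qed
      finally show ?thesis by (simp add: sum_distrib_left[symmetric])
    next
      case False
      then have "P q \<alpha> = 0" using mv_zero[OF P_mv] by blast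
      then show ?thesis unfolding wedge_vectors_alt_sum if_not_P[OF False] by simp
    qed
  qed
  then have "P q = (\<lambda>\<alpha>. \<Sum>a<card ?B. wedge_vectors A n q (\<lambda>i. V (h a) i q) \<alpha>)" if "q \<in> fst c" for q
    using that sum.reindex_bij_betw[OF h, of "\<lambda>J. wedge_vectors A n q (\<lambda>i. V J i q) _"] by simp
  then have "decomposition_on A n P (fst c) (card ?B) (\<lambda>a. V (h a))"
    unfolding decomposition_on_def using vf by blast
  then show ?thesis by blast
qed

text \<open>The definite description needs both lemmas: all decompositions give the same value, and there is a
  decomposition near \<open>p\<close>, so that the value is unique.\<close>

lemma schouten_bracket_eq:
  assumes p: "p \<in> fst c" and n: "n > 0" and even: "even n"
  shows "schouten_bracket A n n P P p = (\<lambda>\<alpha>. - 2 * structure_form p \<alpha>)"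
  unfolding schouten_bracket_def
proof (rule the_equality)
  show "\<forall>W N X K Y. open W \<and> p \<in> W \<and> decomposition_on A n P W N X \<and> decomposition_on A n P W K Y \<longrightarrow>
      (\<lambda>\<alpha>. - 2 * structure_form p \<alpha>) = (\<lambda>\<alpha>. \<Sum>a<N. \<Sum>b<K. schouten_decomposable A n n (X a) (Y b) p \<alpha>)"
    using schouten_sum_eq[OF _ _ p n even] by (intro allI impI ext) auto
next
  fix T
  assume T: "\<forall>W N X K Y. open W \<and> p \<in> W \<and> decomposition_on A n P W N X \<and> decomposition_on A n P W K Y \<longrightarrow>
      T = (\<lambda>\<alpha>. \<Sum>a<N. \<Sum>b<K. schouten_decomposable A n n (X a) (Y b) p \<alpha>)"
  obtain N X where X: "decomposition_on A n P (fst c) N X" using ex_decomposition[OF n] by blast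
  have "T = (\<lambda>\<alpha>. \<Sum>a<N. \<Sum>b<N. schouten_decomposable A n n (X a) (X b) p \<alpha>)"
    by (rule T[rule_format]) (use X p c_open in blast)
  then show "T = (\<lambda>\<alpha>. - 2 * structure_form p \<alpha>)"
    by (simp only: schouten_sum_eq[OF c_open p p n even X X])
qed

end

section \<open>The characterization of Poisson multivectors\<close>

theorem proposition1:
  fixes A :: "('a::{t2_space, second_countable_topology}, 'm::finite) chart set"
    and n :: nat
    and P :: "'a \<Rightarrow> 'a multivector"
  assumes "smooth_structure A"
    and "n \<ge> 3"
    and "multivector_field A n P"
  shows "defines_nary_poisson_bracket A n P \<longleftrightarrow>
     (even n \<and> (\<forall>p. schouten_bracket A n n P P p = (\<lambda>_. 0))) \<or>
     (odd n \<and>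
       (\<forall>p. \<forall>\<alpha>\<in>cotangent_space A p. \<forall>\<beta>\<in>cotangent_space A p.
          wedge (n - 1) (n - 1) (contract \<alpha> (P p)) (contract \<beta> (P p)) = (\<lambda>_. 0)) \<and>
       (\<forall>c\<in>A. \<forall>p\<in>fst c.
          (\<lambda>\<gamma>. \<Sum>u\<in>UNIV. wedge (n - 1) n
             (contract (differential A (coord_fun c u) p) (P p))
             (lie_derivative A n (coord_field A c u) P p) \<gamma>) = (\<lambda>_. 0)))"
proof -
  interpret manifold A by unfold_locales (rule assms)
  have chart: "multivector_chart A c n P" if "c \<in> A" for c
    by unfold_locales (use that assms in auto)
  have n: "n > 0" using assms(2) by simp
  have poisson: "defines_nary_poisson_bracket A n P \<longleftrightarrow>
      (\<forall>f. (\<forall>i<2 * n - 1. smooth_fun_on A UNIV (f i)) \<longrightarrow> (\<forall>p. multivector_chart.jacobi_sum A n P p f = 0))"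
  proof -
    obtain c where "c \<in> A" using chart_cover by blast
    then interpret multivector_chart A c n P by (rule chart)
    show ?thesis unfolding defines_nary_poisson_bracket_def jacobi_sum_def alt_sum_def ..
  qed
  have even_case: "defines_nary_poisson_bracket A n P \<longleftrightarrow> (\<forall>p. schouten_bracket A n n P P p = (\<lambda>_. 0))"
    if even: "even n"
  proof
    assume J: "defines_nary_poisson_bracket A n P"
    show "\<forall>p. schouten_bracket A n n P P p = (\<lambda>_. 0)"
    proof
      fix p
      obtain c where cp: "c \<in> A" "p \<in> fst c" using chart_cover by blast
      interpret multivector_chart A c n P by (rule chart[OF cp(1)])
      have "structure_form p \<gamma> = 0" for \<gamma>
        by (rule structure_form_zero_if_jacobi[OF cp(2) n]) (use J poisson in auto)
      then show "schouten_bracket A n n P P p = (\<lambda>_. 0)"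
        by (simp add: schouten_bracket_eq[OF cp(2) n even])
    qed
  next
    assume S: "\<forall>p. schouten_bracket A n n P P p = (\<lambda>_. 0)"
    show "defines_nary_poisson_bracket A n P"
      unfolding poisson
    proof (intro allI impI)
      fix f p assume f: "\<forall>i<2 * n - 1. smooth_fun_on A UNIV (f i)"
      obtain c where cp: "c \<in> A" "p \<in> fst c" using chart_cover by blast
      interpret multivector_chart A c n P by (rule chart[OF cp(1)])
      have near: "smooth_fun_near A p (f i)" if "i < 2 * n - 1" for i
        using f that by (intro smooth_fun_nearI[OF open_UNIV UNIV_I]) simp
      have "structure_form p \<gamma> = 0" for \<gamma>
        using fun_cong[OF S[rule_format, of p], of \<gamma>] unfolding schouten_bracket_eq[OF cp(2) n even] by simp
      then show "multivector_chart.jacobi_sum A n P p f = 0"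
        using jacobi_sum_eq[OF cp(2) n near] hessian_sum_even[OF cp(2) n even near] by simp
    qed
  qed
  have odd_case: "defines_nary_poisson_bracket A n P \<longleftrightarrow>
       (\<forall>p. \<forall>\<alpha>\<in>cotangent_space A p. \<forall>\<beta>\<in>cotangent_space A p.
          wedge (n - 1) (n - 1) (contract \<alpha> (P p)) (contract \<beta> (P p)) = (\<lambda>_. 0)) \<and>
       (\<forall>c\<in>A. \<forall>p\<in>fst c.
          (\<lambda>\<gamma>. \<Sum>u\<in>UNIV. wedge (n - 1) n
             (contract (differential A (coord_fun c u) p) (P p))
             (lie_derivative A n (coord_field A c u) P p) \<gamma>) = (\<lambda>_. 0))" (is "_ \<longleftrightarrow> ?algebraic \<and> ?differential")
    if odd: "odd n"
  proof
    assume J: "defines_nary_poisson_bracket A n P"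
    have ?algebraic
    proof (intro allI ballI ext)
      fix p \<alpha> \<beta> \<gamma> assume \<alpha>: "\<alpha> \<in> cotangent_space A p" and \<beta>: "\<beta> \<in> cotangent_space A p"
      obtain c where cp: "c \<in> A" "p \<in> fst c" using chart_cover by blast
      interpret multivector_chart A c n P by (rule chart[OF cp(1)])
      show "wedge (n - 1) (n - 1) (contract \<alpha> (P p)) (contract \<beta> (P p)) \<gamma> = 0"
        by (rule contractions_zero_if_jacobi[OF cp(2) n odd _ \<alpha> \<beta>]) (use J poisson in auto)
    qed
    moreover have ?differential
    proof (intro ballI ext)
      fix c p \<gamma> assume cp: "c \<in> A" "p \<in> fst c"
      interpret multivector_chart A c n P by (rule chart[OF cp(1)])
      have "structure_form p \<gamma> = 0"
        by (rule structure_form_zero_if_jacobi[OF cp(2) n]) (use J poisson in auto)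
      then show "(\<Sum>u\<in>UNIV. wedge (n - 1) n (contract (differential A (coord_fun c u) p) (P p))
          (lie_derivative A n (coord_field A c u) P p) \<gamma>) = 0"
        by (simp only: structure_form_def)
    qed
    ultimately show "?algebraic \<and> ?differential" ..
  next
    assume R: "?algebraic \<and> ?differential"
    show "defines_nary_poisson_bracket A n P"
      unfolding poisson
    proof (intro allI impI)
      fix f p assume f: "\<forall>i<2 * n - 1. smooth_fun_on A UNIV (f i)"
      obtain c where cp: "c \<in> A" "p \<in> fst c" using chart_cover by blast
      interpret multivector_chart A c n P by (rule chart[OF cp(1)])
      have near: "smooth_fun_near A p (f i)" if "i < 2 * n - 1" for i
        using f that by (intro smooth_fun_nearI[OF open_UNIV UNIV_I]) simp
      have "structure_form p \<gamma> = 0" for \<gamma>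
        unfolding structure_form_def by (rule fun_cong[OF conjunct2[OF R, rule_format, OF cp], of \<gamma>])
      moreover have "hessian_sum p f = 0"
        by (rule hessian_sum_zero_if_contractions[OF cp(2) n])
          (rule fun_cong[OF conjunct1[OF R, rule_format]])
      ultimately show "multivector_chart.jacobi_sum A n P p f = 0"
        using jacobi_sum_eq[OF cp(2) n near] by simp
    qed
  qed
  show ?thesis
    using even_case odd_case by (cases "even n") (simp_all only: simp_thms)
qed

end
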